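(* Let $\{\mathbf y(k)=(y_i(k))_{i=1}^N\}_{k\in\mathbb Z_+}$ be the sequence generated by the distributed quantized average consensus algorithm described in the context, under the assumptions (A1)–(A5) stated there, and let $\bar y(0)=\frac1N\sum_{i=1}^N y_i(0)$. Then: (a) $\mathbb P\big(\lim_{k\to\infty}\mathbf y(k)=\bar y(0)\cdot\mathbf 1\big)=1$. (b) $\lim_{k\to\infty}\mathbb E\big[e^{r\|\mathbf y(k)-\bar y(0)\cdot\mathbf 1\|}\big]=1$ for all $r\in\mathbb R$. (c) Let $V(\mathbf y)=\|\mathbf y-\bar y(0)\mathbf 1\|^2$ and $V_k=\mathbb E[V(\mathbf y(k))]$. There exist finite constants $\xi_1,\xi_2>0$ satisfying, almost surely for all $k\in\mathbb Z_+$, $$\mathbf y(k)^\top\mathbf L^+(k)\tilde{\mathbf y}(k)\ge \xi_1V(\mathbf y(k))-\xi_2\|\mathbf b(k)\|_1,$$ such that, if in addition $\alpha(k)=\mathcal O(1/k)$ and there is $m>0$ with $\alpha(k)\ge m/(k+1)$ for all $k$, then with $\rho=2\xi_1m>0$, as $k\to\infty$, $$V_k=\begin{cases}\mathcal O(1/k), & \rho>1,\\ \mathcal O(\ln(k)/k), & \rho=1,\\ \mathcal O(1/k^{\rho}), & \rho<1.\end{cases}$$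
   Context: $\mathbb Z_+=\{0,1,2,\dots\}$, $\mathbb Z_{++}=\{1,2,\dots\}$, $\mathrm{sgn}(0)=0$, $\|\cdot\|$ is the Euclidean norm. Graph: $\mathcal G=(\mathcal V,\mathcal E)$ is a strongly connected digraph, $\mathcal V=\{1,\dots,N\}$, $N\ge2$, no self-loops; $\mathcal N_i^-=\{j:(j,i)\in\mathcal E\}$, $\mathcal N_i^+=\{j:(i,j)\in\mathcal E\}$, $d_i^\pm=|\mathcal N_i^\pm|$. (A1) There are $B^{(w)}(k)\in\{0,1\}$ ($k\in\mathbb Z_+$) and $W\in\mathbb Z_{++}$ with $\sum_{t=nW}^{(n+1)W-1}B^{(w)}(t)\ge1$ for all $n\in\mathbb Z_+$, and $B_{\max}\in\mathbb Z_+$, such that the integers $B_i^{(w)}(k)$ satisfy for all $i$: $1\le B_i^{(w)}(k)\le B_{\max}$ if $B^{(w)}(k)=1$, and $B_i^{(w)}(k)=0$ otherwise. (A2) For some integer $c_1\ge2$ and real $c_2>0$, for every $k\in\mathbb Z_+$ there is $n\in\mathbb Z_+$ with $(c_1^n-1)c_2\le k\le(c_1^{n+1}-1)c_2-1$ and $\gamma(k)=c_1^{-n}$; and $a_{ij}(0)=1$ if $(j,i)\in\mathcal E$, $a_{ij}(0)=0$ otherwise. (A3) There are $B^{(c)}(k)\in\{0,1\}$ ($k\in\mathbb Z_+$) and $W\in\mathbb Z_{++}$ with $\sum_{t=nW}^{(n+1)W-1}B^{(c)}(t)\ge1$ for all $n\in\mathbb Z_+$, such that the integers $B_i^{(c)}(k)$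 satisfy for all $i$: $B_i^{(c)}(k)\ge1$ if $B^{(c)}(k)=1$, and $B_i^{(c)}(k)=0$ otherwise. (A4) $\bar y(0)\in[q_{\min},q_{\max}]$, where $q_{\min}<q_{\max}$ are given reals (the individual $y_i(0)\in\mathbb R$ are arbitrary). (A5) $\alpha(k)>0$, $\alpha(k+1)\le\alpha(k)$ for all $k\in\mathbb Z_+$, $\sum_{k\ge1}\alpha(k)=\infty$, $\sum_{k\ge1}\alpha(k)^2<\infty$. Weight-balancing part: $\mathbf A(k)=(a_{ij}(k))$, $b_i(0)=\sum_{j\in\mathcal N_i^-}a_{ij}(0)-\sum_{j\in\mathcal N_i^+}a_{ji}(0)$, and for $k\in\mathbb Z_+$: $n_i(k)=\mathrm{sgn}(b_i(k))\min\big\{\frac{2}{2^{B_i^{(w)}(k)}}\big[\big\lceil\frac{2^{B_i^{(w)}(k)}|b_i(k)|}{2d_i^+\gamma(k)}\big\rceil-1\big],1\big\}$ if $B_i^{(w)}(k)\ge1$ and $n_i(k)=0$ if $B_i^{(w)}(k)=0$; $a_{ij}(k+1)=a_{ij}(k)+\gamma(k)n_j(k)$ for $j\in\mathcal N_i^-$ (and $a_{ij}\equiv0$ for $(j,i)\notin\mathcal E$); $b_i(k+1)=b_i(k)-\gamma(k)d_i^+n_i(k)+\gamma(k)\sum_{j\in\mathcal N_i^-}n_j(k)$. Write $\mathbf b(k)=(b_i(k))_i$, $S_i^+(k)=\sum_{j\in\mathcal N_i^+}a_{ji}(k)$, $\mathbf S^+(k)=\mathrm{diag}(S_i^+(k))$,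 $\mathbf L^+(k)=\mathbf S^+(k)-\mathbf A(k)$. Consensus part: $\tilde y_i(k)=\min\{\max\{y_i(k),q_{\min}\},q_{\max}\}$, $\tilde{\mathbf y}(k)=(\tilde y_i(k))_i$, $\Delta(B)=\frac{q_{\max}-q_{\min}}{2^B-1}$. If $B_i^{(c)}(k)=0$, $x_i(k)=0$. If $B_i^{(c)}(k)>0$, put $\theta_i(k)=\frac{\tilde y_i(k)-q_{\min}}{\Delta(B_i^{(c)}(k))}$ and $p_i(k)=\theta_i(k)-\lfloor\theta_i(k)\rfloor$; conditionally on the history up to time $k$ (that is, on $\mathbf y(0),\dots,\mathbf y(k)$), $x_i(k)=q_{\min}+\lceil\theta_i(k)\rceil\Delta(B_i^{(c)}(k))$ with probability $p_i(k)$ and $x_i(k)=q_{\min}+\lfloor\theta_i(k)\rfloor\Delta(B_i^{(c)}(k))$ with probability $1-p_i(k)$. The update is $$y_i(k+1)=y_i(k)+\alpha(k)b_i(k)x_i(k)+\alpha(k)\sum_{j\in\mathcal N_i^-}a_{ij}(k)\big(x_j(k)-x_i(k)\big).$$ *)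

theory Defs
  imports "HOL-Probability.Probability" "HOL-Library.Landau_Symbols"
begin

text \<open>The vertex set is a finite type \<open>'n\<close>, so \<open>N = CARD('n)\<close>; \<open>(j, i) \<in> E\<close> is an edge
  from \<open>j\<close> to \<open>i\<close>.\<close>

definition strongly_connected_digraph :: "('n::finite \<times> 'n) set \<Rightarrow> bool" where
  "strongly_connected_digraph E \<longleftrightarrow> (\<forall>i. (i, i) \<notin> E) \<and> (\<forall>i j. (i, j) \<in> E\<^sup>*)"

definition in_nbrs :: "('n::finite \<times> 'n) set \<Rightarrow> 'n \<Rightarrow> 'n set" where
  "in_nbrs E i = {j. (j, i) \<in> E}"

definition out_nbrs :: "('n::finite \<times> 'n) set \<Rightarrow> 'n \<Rightarrow> 'n set" where
  "out_nbrs E i = {j. (i, j) \<in> E}"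

definition out_degree :: "('n::finite \<times> 'n) set \<Rightarrow> 'n \<Rightarrow> nat" where
  "out_degree E i = card (out_nbrs E i)"

definition active_schedule :: "(nat \<Rightarrow> nat) \<Rightarrow> nat \<Rightarrow> bool" where
  "active_schedule F W \<longleftrightarrow>
     W \<ge> 1 \<and> (\<forall>k. F k \<in> {0, 1}) \<and> (\<forall>n. (\<Sum>t = n * W..(n + 1) * W - 1. F t) \<ge> 1)"

definition weight_bits :: "(nat \<Rightarrow> 'n::finite \<Rightarrow> nat) \<Rightarrow> bool" where
  "weight_bits Bw \<longleftrightarrow>
     (\<exists>F W Bmax. active_schedule F W \<and>
        (\<forall>k i. if F k = 1 then 1 \<le> Bw k i \<and> Bw k i \<le> Bmax else Bw k i = 0))"

definition weight_steps :: "(nat \<Rightarrow> real) \<Rightarrow> bool" where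
  "weight_steps \<gamma> \<longleftrightarrow>
     (\<exists>(c1::nat) (c2::real). c1 \<ge> 2 \<and> c2 > 0 \<and>
        (\<forall>k. \<exists>n. (real c1 ^ n - 1) * c2 \<le> real k \<and>
                 real k \<le> (real c1 ^ (n + 1) - 1) * c2 - 1 \<and>
                 \<gamma> k = 1 / real c1 ^ n))"

definition consensus_bits :: "(nat \<Rightarrow> 'n::finite \<Rightarrow> nat) \<Rightarrow> bool" where
  "consensus_bits Bc \<longleftrightarrow>
     (\<exists>F W. active_schedule F W \<and>
        (\<forall>k i. if F k = 1 then Bc k i \<ge> 1 else Bc k i = 0))"

definition consensus_steps :: "(nat \<Rightarrow> real) \<Rightarrow> bool" where
  "consensus_steps \<alpha> \<longleftrightarrow>
     (\<forall>k. \<alpha> k > 0) \<and> (\<forall>k. \<alpha> (k + 1) \<le> \<alpha> k) \<and>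
     filterlim (\<lambda>n. \<Sum>k = 1..n. \<alpha> k) at_top sequentially \<and>
     summable (\<lambda>k. (\<alpha> (k + 1))\<^sup>2)"

definition init_weight :: "('n::finite \<times> 'n) set \<Rightarrow> 'n \<Rightarrow> 'n \<Rightarrow> real" where
  "init_weight E i j = (if (j, i) \<in> E then 1 else 0)"

text \<open>The quantized value \<open>n\<^sub>i(k)\<close> as a function of the number of bits \<open>B\<close>, the out-degree
  \<open>d\<close>, the step size \<open>g\<close> and the imbalance \<open>b\<close>.\<close>

definition quantized_imbalance :: "nat \<Rightarrow> nat \<Rightarrow> real \<Rightarrow> real \<Rightarrow> real" where
  "quantized_imbalance B d g b =
     (if B \<ge> 1
      then sgn b * min (2 / 2 ^ B * (real_of_int \<lceil>2 ^ B * \<bar>b\<bar> / (2 * real d * g)\<rceil> - 1)) 1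
      else 0)"

primrec imbalance ::
  "('n::finite \<times> 'n) set \<Rightarrow> (nat \<Rightarrow> 'n \<Rightarrow> nat) \<Rightarrow> (nat \<Rightarrow> real) \<Rightarrow> nat \<Rightarrow> 'n \<Rightarrow> real"
where
  "imbalance E Bw \<gamma> 0 =
     (\<lambda>i. (\<Sum>j\<in>in_nbrs E i. init_weight E i j) - (\<Sum>j\<in>out_nbrs E i. init_weight E j i))"
| "imbalance E Bw \<gamma> (Suc k) =
     (let b = imbalance E Bw \<gamma> k;
          n = (\<lambda>i. quantized_imbalance (Bw k i) (out_degree E i) (\<gamma> k) (b i))
      in (\<lambda>i. b i - \<gamma> k * real (out_degree E i) * n i + \<gamma> k * (\<Sum>j\<in>in_nbrs E i. n j)))"

definition weight_increment ::
  "('n::finite \<times> 'n) set \<Rightarrow> (nat \<Rightarrow> 'n \<Rightarrow> nat) \<Rightarrow> (nat \<Rightarrow> real) \<Rightarrow> nat \<Rightarrow> 'n \<Rightarrow> real"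
where
  "weight_increment E Bw \<gamma> k i =
     quantized_imbalance (Bw k i) (out_degree E i) (\<gamma> k) (imbalance E Bw \<gamma> k i)"

primrec weight ::
  "('n::finite \<times> 'n) set \<Rightarrow> (nat \<Rightarrow> 'n \<Rightarrow> nat) \<Rightarrow> (nat \<Rightarrow> real) \<Rightarrow> nat \<Rightarrow> 'n \<Rightarrow> 'n \<Rightarrow> real"
where
  "weight E Bw \<gamma> 0 = init_weight E"
| "weight E Bw \<gamma> (Suc k) =
     (\<lambda>i j. if j \<in> in_nbrs E i
            then weight E Bw \<gamma> k i j + \<gamma> k * weight_increment E Bw \<gamma> k j else 0)"

definition out_laplacian ::
  "('n::finite \<times> 'n) set \<Rightarrow> ('n \<Rightarrow> 'n \<Rightarrow> real) \<Rightarrow> real^'n^'n"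
where
  "out_laplacian E a =
     (\<chi> i j. if i = j then \<Sum>l\<in>out_nbrs E i. a l i else 0) - (\<chi> i j. a i j)"

definition vec_mean :: "real^'n::finite \<Rightarrow> real" where
  "vec_mean v = (\<Sum>i\<in>UNIV. v $ i) / real CARD('n)"

definition clip :: "real \<Rightarrow> real \<Rightarrow> real \<Rightarrow> real" where
  "clip qmin qmax t = min (max t qmin) qmax"

definition clip_vec :: "real \<Rightarrow> real \<Rightarrow> real^'n::finite \<Rightarrow> real^'n" where
  "clip_vec qmin qmax v = (\<chi> i. clip qmin qmax (v $ i))"

definition quant_step :: "real \<Rightarrow> real \<Rightarrow> nat \<Rightarrow> real" where
  "quant_step qmin qmax B = (qmax - qmin) / (2 ^ B - 1)"

definition quant_level :: "real \<Rightarrow> real \<Rightarrow> nat \<Rightarrow> real \<Rightarrow> real" where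
  "quant_level qmin qmax B t = (clip qmin qmax t - qmin) / quant_step qmin qmax B"

definition quant_prob :: "real \<Rightarrow> real \<Rightarrow> nat \<Rightarrow> real \<Rightarrow> real" where
  "quant_prob qmin qmax B t =
     quant_level qmin qmax B t - real_of_int \<lfloor>quant_level qmin qmax B t\<rfloor>"

definition quant_up :: "real \<Rightarrow> real \<Rightarrow> nat \<Rightarrow> real \<Rightarrow> real" where
  "quant_up qmin qmax B t =
     qmin + real_of_int \<lceil>quant_level qmin qmax B t\<rceil> * quant_step qmin qmax B"

definition quant_down :: "real \<Rightarrow> real \<Rightarrow> nat \<Rightarrow> real \<Rightarrow> real" where
  "quant_down qmin qmax B t =
     qmin + real_of_int \<lfloor>quant_level qmin qmax B t\<rfloor> * quant_step qmin qmax B"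

text \<open>The \<open>\<sigma>\<close>-algebra generated by \<open>y(0), \<dots>, y(k)\<close>.\<close>

definition history :: "'w measure \<Rightarrow> (nat \<Rightarrow> 'w \<Rightarrow> real^'n::finite) \<Rightarrow> nat \<Rightarrow> 'w measure" where
  "history M y k =
     sigma (space M) {y j -` S \<inter> space M | j S. j \<le> k \<and> S \<in> sets borel}"

text \<open>The conditional law of \<open>x\<^sub>i(k)\<close> given the history is stated as a two-point law on Borel
  sets, because the two values coincide when the quantization level is an integer. Nothing is
  assumed about the joint conditional law of different components of \<open>x(k)\<close>.\<close>

definition quantized_consensus ::
  "'w measure \<Rightarrow> ('n::finite \<times> 'n) set \<Rightarrow> (nat \<Rightarrow> 'n \<Rightarrow> nat) \<Rightarrow> (nat \<Rightarrow> real) \<Rightarrow>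
   (nat \<Rightarrow> 'n \<Rightarrow> nat) \<Rightarrow> (nat \<Rightarrow> real) \<Rightarrow> real \<Rightarrow> real \<Rightarrow> real^'n \<Rightarrow>
   (nat \<Rightarrow> 'w \<Rightarrow> real^'n) \<Rightarrow> (nat \<Rightarrow> 'w \<Rightarrow> real^'n) \<Rightarrow> bool"
where
  "quantized_consensus M E Bw \<gamma> Bc \<alpha> qmin qmax y0 x y \<longleftrightarrow>
     prob_space M \<and>
     (\<forall>k. x k \<in> borel_measurable M) \<and>
     (\<forall>\<omega>\<in>space M. y 0 \<omega> = y0) \<and>
     (\<forall>k i. Bc k i = 0 \<longrightarrow> (\<forall>\<omega>\<in>space M. x k \<omega> $ i = 0)) \<and>
     (\<forall>k i. Bc k i > 0 \<longrightarrow>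
        (\<forall>S\<in>sets borel. AE \<omega> in M.
           real_cond_exp M (history M y k) (\<lambda>\<omega>'. indicator S (x k \<omega>' $ i)) \<omega> =
             quant_prob qmin qmax (Bc k i) (y k \<omega> $ i) *
               indicator S (quant_up qmin qmax (Bc k i) (y k \<omega> $ i)) +
             (1 - quant_prob qmin qmax (Bc k i) (y k \<omega> $ i)) *
               indicator S (quant_down qmin qmax (Bc k i) (y k \<omega> $ i)))) \<and>
     (\<forall>k. \<forall>\<omega>\<in>space M. \<forall>i.
        y (Suc k) \<omega> $ i =
          y k \<omega> $ i + \<alpha> k * imbalance E Bw \<gamma> k i * x k \<omega> $ i +
          \<alpha> k * (\<Sum>j\<in>in_nbrs E i. weight E Bw \<gamma> k i j * (x k \<omega> $ j - x k \<omega> $ i)))"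

definition sq_error :: "real^'n::finite \<Rightarrow> real^'n \<Rightarrow> real" where
  "sq_error y0 v = (norm (v - vec (vec_mean y0)))\<^sup>2"

end

theory Submission
  imports Defs
begin

text \<open>In matrix form the iteration reads \<open>y(k+1) = y(k) - \<alpha>(k) L\<^sup>+(k) x(k)\<close>. The columns of \<open>L\<^sup>+\<close>
  sum to zero, so the mean of \<open>y\<close> never changes, and the rows sum to \<open>-b(k)\<close>. There are three
  things to prove: the imbalance \<open>b(k)\<close> is \<open>O(1/k)\<close>, the form \<open>y\<^sup>T L\<^sup>+ clip(y)\<close> controls the
  squared error, and the noise of the quantizer is summable.

  \<^bold>\<open>Weight balancing.\<close> All edges leaving a node \<open>j\<close> always carry the same weight \<open>w\<^sub>j\<close>. Strong
  connectivity provides a positive vector \<open>\<pi>\<close> of balanced weights (\<open>balanced_vector_exists\<close>). Since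
  the quantized increments never overshoot, each ratio \<open>w\<^sub>i/\<pi>\<^sub>i\<close> moves towards a convex combination
  of the ratios at the in-neighbours. Hence the largest ratio decreases and the smallest
  increases, which bounds the weights away from \<open>0\<close> and from above, and the imbalance is bounded
  by the spread between the two. If the spread exceeds a constant times the step size, then a gap
  below the largest ratio propagates along the edges at saturated speed and, after a fixed number
  of steps, has lowered the largest ratio by one step (\<open>spread_contraction\<close>). As the steps decay
  like \<open>1/k\<close>, so does the spread (\<open>imbalance_decay\<close>).

  \<^bold>\<open>Coercivity.\<close> Clipping is the derivative of a convex function \<open>F\<close>, so along an edge from \<open>j\<close>
  to \<open>i\<close> the product \<open>clip(y\<^sub>j)(y\<^sub>j - y\<^sub>i)\<close> is at least \<open>F(y\<^sub>j) - F(y\<^sub>i)\<close> plus half the squared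
  difference of the clipped values. Weighted and summed over the edges, the differences of \<open>F\<close>
  collapse to \<open>-\<Sum>\<^sub>i b\<^sub>i F(y\<^sub>i)\<close>, and the squares control the squared error as long as \<open>y\<close> stays
  bounded (\<open>clipped_laplacian_coercive\<close>). It does: a state at or above \<open>qmax\<close> is quantized to
  exactly \<open>qmax\<close>, so it can only be raised by its own imbalance term, and \<open>\<Sum> \<alpha>(k)/k < \<infinity>\<close>
  (\<open>deviation_bound\<close>).

  \<^bold>\<open>Drift.\<close> The quantizer is conditionally unbiased, and the form is linear in \<open>x\<close>; therefore the
  mean square error contracts by the factor \<open>1 - 2 \<xi> \<alpha>(k)\<close> at every active time, up to an error
  \<open>O(\<alpha>(k)/k + \<alpha>(k)\<^sup>2)\<close> (\<open>drift_active\<close>). It follows that it tends to \<open>0\<close>, at the claimed rate when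
  \<open>\<alpha>(k)\<close> is comparable to \<open>1/k\<close>. The same estimate on events of the history says that the squared
  error plus the remaining noise is a nonnegative supermartingale; its expectation tends to \<open>0\<close>, so
  the maximal inequality gives almost sure convergence. Bounded convergence then yields the
  exponential moments.\<close>


section \<open>Balanced edge weights on a strongly connected digraph\<close>

lemma in_nbrs_iff [simp]: "j \<in> in_nbrs E i \<longleftrightarrow> (j, i) \<in> E"
  by (simp add: in_nbrs_def)

lemma out_nbrs_iff [simp]: "j \<in> out_nbrs E i \<longleftrightarrow> (i, j) \<in> E"
  by (simp add: out_nbrs_def)

lemma sum_in_nbrs_swap:
  fixes E :: "('n::finite \<times> 'n) set" and f :: "'n \<Rightarrow> 'n \<Rightarrow> real"
  shows "(\<Sum>i\<in>UNIV. \<Sum>j\<in>in_nbrs E i. f i j) = (\<Sum>j\<in>UNIV. \<Sum>i\<in>out_nbrs E j. f i j)"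
proof -
  have "(\<Sum>i\<in>UNIV. \<Sum>j\<in>{j\<in>UNIV. (j, i) \<in> E}. f i j) = (\<Sum>j\<in>UNIV. \<Sum>i\<in>{i\<in>UNIV. (j, i) \<in> E}. f i j)"
    by (rule sum.swap_restrict) auto
  then show ?thesis by (simp add: in_nbrs_def out_nbrs_def)
qed

lemma sum_in_nbrs_const:
  fixes E :: "('n::finite \<times> 'n) set" and f :: "'n \<Rightarrow> real"
  shows "(\<Sum>i\<in>UNIV. \<Sum>j\<in>in_nbrs E i. f j) = (\<Sum>j\<in>UNIV. real (out_degree E j) * f j)"
  unfolding sum_in_nbrs_swap by (simp add: out_degree_def)

lemma out_degree_pos:
  fixes E :: "('n::finite \<times> 'n) set"
  assumes "strongly_connected_digraph E" "CARD('n) \<ge> 2"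
  shows "out_degree E i \<ge> 1"
proof -
  have "UNIV \<noteq> {i}" using assms(2) by (metis card.empty card.insert_remove card_1_singleton_iff numeral_le_one_iff semiring_norm(69) finite One_nat_def is_singletonI is_singleton_altdef)
  then obtain j where "j \<noteq> i" by blast
  moreover have "(i, j) \<in> E\<^sup>*" using assms(1) by (simp add: strongly_connected_digraph_def)
  ultimately obtain l where "(i, l) \<in> E" by (metis converse_rtranclE)
  then have "out_nbrs E i \<noteq> {}" by auto
  then show ?thesis by (simp add: out_degree_def Suc_le_eq card_gt_0_iff)
qed

text \<open>The matrix of the balance equations has zero column sums, hence a nonzero kernel vector \<open>v\<close>. By
  the triangle inequality \<open>\<bar>v\<bar>\<close> satisfies the balance equations as inequalities; their two sides
  have the same total, so they are equalities. Positivity of one entry spreads along the edges.\<close>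

lemma balanced_vector_exists:
  fixes E :: "('n::finite \<times> 'n) set"
  assumes "strongly_connected_digraph E" "CARD('n) \<ge> 2"
  shows "\<exists>\<pi>. \<forall>i. \<pi> i > 0 \<and> real (out_degree E i) * \<pi> i = (\<Sum>j\<in>in_nbrs E i. \<pi> j)"
proof -
  let ?d = "\<lambda>i. real (out_degree E i)"
  define K :: "real^'n^'n" where
    "K = (\<chi> i j. (if (j, i) \<in> E then 1 else 0) - (if i = j then ?d i else 0))"
  have Kv: "(K *v v) $ i = (\<Sum>j\<in>in_nbrs E i. v $ j) - ?d i * v $ i" for v i
  proof -
    have "(K *v v) $ i = (\<Sum>j\<in>UNIV. (if (j, i) \<in> E then v $ j else 0) - (if i = j then ?d i * v $ j else 0))"
      unfolding matrix_vector_mult_def K_def by (auto simp: left_diff_distrib intro!: sum.cong)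
    also have "\<dots> = (\<Sum>j\<in>UNIV. if (j, i) \<in> E then v $ j else 0) - ?d i * v $ i"
      by (simp add: sum_subtractf)
    also have "(\<Sum>j\<in>UNIV. if (j, i) \<in> E then v $ j else 0) = (\<Sum>j\<in>in_nbrs E i. v $ j)"
      by (simp add: in_nbrs_def sum.If_cases)
    finally show ?thesis .
  qed
  have "transpose K *v 1 = 0"
  proof (subst vec_eq_iff, intro allI)
    fix j
    have "(transpose K *v 1) $ j = (\<Sum>i\<in>UNIV. (if (j, i) \<in> E then 1 else 0) - (if i = j then ?d i else 0))"
      unfolding matrix_vector_mult_def transpose_def K_def by (auto intro!: sum.cong)
    also have "\<dots> = (\<Sum>i\<in>UNIV. if (j, i) \<in> E then 1 else 0) - ?d j"
      by (simp add: sum_subtractf)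
    also have "(\<Sum>i\<in>UNIV. if (j, i) \<in> E then 1 else 0) = ?d j"
      by (simp add: out_degree_def out_nbrs_def sum.If_cases)
    finally show "(transpose K *v 1) $ j = 0 $ j" by simp
  qed
  then have "rank (transpose K) \<noteq> CARD('n)"
    using matrix_nonfull_linear_equations_eq[of "transpose K"] by (metis zero_neq_one)
  then have "rank K \<noteq> CARD('n)" by (simp add: rank_transpose)
  then obtain v where v: "v \<noteq> 0" "K *v v = 0"
    using matrix_nonfull_linear_equations_eq[of K] by blast
  have eq: "?d i * v $ i = (\<Sum>j\<in>in_nbrs E i. v $ j)" for i
    using v(2) Kv[of v i] by simp
  have le: "?d i * \<bar>v $ i\<bar> \<le> (\<Sum>j\<in>in_nbrs E i. \<bar>v $ j\<bar>)" for i
  proof -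
    have "?d i * \<bar>v $ i\<bar> = \<bar>?d i * v $ i\<bar>" by (simp add: abs_mult)
    also have "\<dots> \<le> (\<Sum>j\<in>in_nbrs E i. \<bar>v $ j\<bar>)" unfolding eq by (rule sum_abs)
    finally show ?thesis .
  qed
  have bal: "?d i * \<bar>v $ i\<bar> = (\<Sum>j\<in>in_nbrs E i. \<bar>v $ j\<bar>)" for i
    by (rule sum_mono_inv[of "\<lambda>i. ?d i * \<bar>v $ i\<bar>" UNIV "\<lambda>i. \<Sum>j\<in>in_nbrs E i. \<bar>v $ j\<bar>"])
      (auto simp: sum_in_nbrs_const le)
  from v(1) obtain r where r: "v $ r \<noteq> 0" by (auto simp: vec_eq_iff)
  have "\<bar>v $ i\<bar> > 0" for i
  proof -
    have "(r, i) \<in> E\<^sup>*" using assms(1) by (simp add: strongly_connected_digraph_def)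
    then show ?thesis
    proof (induction rule: rtrancl_induct)
      case base then show ?case using r by simp
    next
      case (step j i)
      have "0 < \<bar>v $ j\<bar>" using step by simp
      also have "\<dots> \<le> (\<Sum>j\<in>in_nbrs E i. \<bar>v $ j\<bar>)"
        using step by (intro member_le_sum) auto
      also have "\<dots> = ?d i * \<bar>v $ i\<bar>" using bal by simp
      finally show ?case by (auto simp: zero_less_mult_iff)
    qed
  qed
  then show ?thesis using bal by (intro exI[of _ "\<lambda>i. \<bar>v $ i\<bar>"]) simp
qed

section \<open>The quantized imbalance\<close>

lemma quantized_imbalance_active:
  assumes "g > 0" "d \<ge> 1" "B \<ge> 1" "b \<noteq> 0"
  defines "q \<equiv> min (2 / 2 ^ B * (real_of_int \<lceil>2 ^ B * \<bar>b\<bar> / (2 * real d * g)\<rceil> - 1)) 1"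
  shows "quantized_imbalance B d g b = sgn b * q" "0 \<le> q"
proof -
  have "0 < 2 ^ B * \<bar>b\<bar> / (2 * real d * g)" using assms by simp
  then have "1 \<le> \<lceil>2 ^ B * \<bar>b\<bar> / (2 * real d * g)\<rceil>" by simp
  then show "0 \<le> q" unfolding q_def by simp
  show "quantized_imbalance B d g b = sgn b * q"
    unfolding q_def quantized_imbalance_def using assms(3) by simp
qed

lemma quantized_imbalance_inactive:
  "\<not> (B \<ge> 1 \<and> b \<noteq> 0) \<Longrightarrow> quantized_imbalance B d g b = 0"
  by (auto simp: quantized_imbalance_def)

lemma quantized_imbalance_same_sign:
  assumes "g > 0" "d \<ge> 1"
  shows "quantized_imbalance B d g b = sgn b * \<bar>quantized_imbalance B d g b\<bar>"
  using quantized_imbalance_active[OF assms, of B b] quantized_imbalance_inactive[of B b]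
  by (cases "B \<ge> 1 \<and> b \<noteq> 0") (auto simp: abs_mult sgn_if)

lemma quantized_imbalance_le_1:
  assumes "g > 0" "d \<ge> 1"
  shows "\<bar>quantized_imbalance B d g b\<bar> \<le> 1"
  using quantized_imbalance_active[OF assms, of B b] quantized_imbalance_inactive[of B b]
  by (cases "B \<ge> 1 \<and> b \<noteq> 0") (auto simp: abs_mult sgn_if)

text \<open>The rounding goes strictly downwards, \<open>\<lceil>z\<rceil> - 1 < z\<close>, so a node never sends out more
  than its imbalance.\<close>

lemma quantized_imbalance_no_overshoot:
  assumes "g > 0" "d \<ge> 1"
  shows "real d * g * \<bar>quantized_imbalance B d g b\<bar> \<le> \<bar>b\<bar>"
proof (cases "B \<ge> 1 \<and> b \<noteq> 0")
  case True
  let ?z = "2 ^ B * \<bar>b\<bar> / (2 * real d * g)"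
  let ?q = "min (2 / 2 ^ B * (real_of_int \<lceil>?z\<rceil> - 1)) 1"
  have "?q \<le> 2 / 2 ^ B * (real_of_int \<lceil>?z\<rceil> - 1)" by simp
  also have "\<dots> \<le> 2 / 2 ^ B * ?z" by (intro mult_left_mono) (linarith, simp)
  also have "\<dots> = \<bar>b\<bar> / (real d * g)" by (simp add: field_simps)
  finally have "real d * g * ?q \<le> \<bar>b\<bar>" using assms by (simp add: pos_le_divide_eq mult.commute)
  moreover have "\<bar>quantized_imbalance B d g b\<bar> = ?q"
    using True quantized_imbalance_active[OF assms, of B b] by (auto simp: abs_mult sgn_if)
  ultimately show ?thesis by simp
next
  case False then show ?thesis by (simp add: quantized_imbalance_inactive)
qed

text \<open>Once the imbalance exceeds one full step per outgoing edge, every active node moves by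
  exactly one step, whatever its number of bits. This is the only lower bound on the speed of
  the weight balancing that enters below.\<close>

lemma quantized_imbalance_saturated:
  assumes "g > 0" "d \<ge> 1" "B \<ge> 1" "\<bar>b\<bar> > real d * g"
  shows "\<bar>quantized_imbalance B d g b\<bar> = 1"
proof -
  let ?z = "2 ^ B * \<bar>b\<bar> / (2 * real d * g)"
  have "real d * g > 0" using assms by (intro mult_pos_pos) auto
  then have b0: "b \<noteq> 0" using assms(4) by linarith
  have "(2::real) ^ (B - 1) = 2 ^ B / 2" using assms(3) by (cases B) auto
  also have "\<dots> < ?z" using assms by (simp add: field_simps)
  finally have "of_int (2 ^ (B - 1)) < ?z" by simp
  then have "2 ^ (B - 1) < \<lceil>?z\<rceil>" by (simp only: less_ceiling_iff)
  then have "2 ^ (B - 1) \<le> \<lceil>?z\<rceil> - 1" by simp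
  then have "real_of_int (2 ^ (B - 1)) \<le> real_of_int (\<lceil>?z\<rceil> - 1)" by (simp only: of_int_le_iff)
  then have "2 / 2 ^ B * 2 ^ (B - 1) \<le> 2 / 2 ^ B * (real_of_int \<lceil>?z\<rceil> - 1)"
    by (intro mult_left_mono) auto
  moreover have "2 / 2 ^ B * 2 ^ (B - 1) = (1::real)" using assms(3) by (cases B) auto
  ultimately show ?thesis using assms(3) b0 by (simp add: quantized_imbalance_def abs_mult)
qed


section \<open>Decay of the imbalance\<close>

text \<open>Blocks of length \<open>W\<close> are aligned at multiples of \<open>W\<close>; an arbitrary window needs length \<open>2 * W\<close> to
  contain one of them.\<close>

lemma active_schedule_window:
  assumes "active_schedule F W"
  shows "\<exists>t\<in>{k..<k + 2 * W}. F t = 1"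
proof -
  have W: "W \<ge> 1" and F01: "\<And>k. F k \<in> {0, 1}"
    using assms unfolding active_schedule_def by auto
  define n where "n = k div W + 1"
  have "(\<Sum>t = n * W..(n + 1) * W - 1. F t) \<ge> 1"
    using assms unfolding active_schedule_def by blast
  then have "(\<Sum>t = n * W..(n + 1) * W - 1. F t) \<noteq> 0" by linarith
  then obtain t where t: "t \<in> {n * W..(n + 1) * W - 1}" "F t \<noteq> 0"
    by (meson sum.neutral)
  have "k div W * W + k mod W = k" by simp
  moreover have "k mod W < W" using W by simp
  ultimately have "k \<le> n * W" "n * W \<le> k + W" unfolding n_def by (simp_all only: distrib_right)
  moreover have "(n + 1) * W - 1 < n * W + W" using W by simp
  ultimately have "t \<in> {k..<k + 2 * W}" using t(1) by auto
  moreover have "F t = 1" using t(2) F01[of t] by auto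
  ultimately show ?thesis by blast
qed

text \<open>While above the threshold \<open>\<theta>\<close>, the sequence loses \<open>\<delta>\<close> at least once in every window of length \<open>L\<close>;
  once at or below \<open>\<theta>\<close>, it stays there. So \<open>q\<close> windows are enough to lose \<open>q * \<delta>\<close>.\<close>

lemma scheduled_descent_below:
  fixes f :: "nat \<Rightarrow> real" and \<theta> \<delta> :: real
  assumes window: "\<And>k. \<exists>t\<in>{k..<k + L}. act t"
    and stay: "\<And>t. a \<le> t \<Longrightarrow> t < b \<Longrightarrow> f t \<le> \<theta> \<Longrightarrow> f (Suc t) \<le> \<theta>"
    and noninc: "\<And>t. a \<le> t \<Longrightarrow> t < b \<Longrightarrow> f t > \<theta> \<Longrightarrow> f (Suc t) \<le> f t"
    and drop: "\<And>t. a \<le> t \<Longrightarrow> t < b \<Longrightarrow> f t > \<theta> \<Longrightarrow> act t \<Longrightarrow> f (Suc t) \<le> f t - \<delta>"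
    and \<delta>: "\<delta> \<ge> 0"
    and "f a \<le> \<theta> + real q * \<delta>"
  shows "a + L * q \<le> t \<Longrightarrow> t \<le> b \<Longrightarrow> f t \<le> \<theta>"
proof -
  have step: "f (Suc t) \<le> \<theta> + real p * \<delta>" if "a \<le> t" "t < b" "f t \<le> \<theta> + real p * \<delta>" for t p
  proof (cases "f t \<le> \<theta>")
    case True
    have "0 \<le> real p * \<delta>" using \<delta> by simp
    then show ?thesis using stay[OF that(1,2) True] by linarith
  next
    case False
    then show ?thesis using noninc[OF that(1,2)] that(3) by linarith
  qed
  have steps: "f t \<le> \<theta> + real p * \<delta>" if "a \<le> s" "s \<le> t" "t \<le> b" "f s \<le> \<theta> + real p * \<delta>" for s t p
    using that(2,3)
  proof (induction rule: dec_induct)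
    case base then show ?case using that by simp
  next
    case (step n) then show ?case using \<open>a \<le> s\<close> by (intro \<open>\<And>t p. a \<le> t \<Longrightarrow> t < b \<Longrightarrow> f t \<le> \<theta> + real p * \<delta> \<Longrightarrow> f (Suc t) \<le> \<theta> + real p * \<delta>\<close>) auto
  qed
  have main: "f (a + L * n) \<le> \<theta> + real (q - n) * \<delta>" if "a + L * n \<le> b" "n \<le> q" for n
    using that
  proof (induction n)
    case 0 then show ?case using assms(6) by simp
  next
    case (Suc n)
    define s where "s = a + L * n"
    have sb: "s + L \<le> b" using Suc.prems unfolding s_def by simp
    obtain t where t: "s \<le> t" "t < s + L" "act t" using window[of s] by auto
    have as: "a \<le> s" unfolding s_def by simp
    have "f s \<le> \<theta> + real (q - n) * \<delta>" using Suc unfolding s_def by simp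
    then have ft: "f t \<le> \<theta> + real (q - n) * \<delta>" using steps[OF as t(1)] t sb by simp
    have "f (Suc t) \<le> \<theta> + real (q - Suc n) * \<delta>"
    proof (cases "f t \<le> \<theta>")
      case True
      have "0 \<le> real (q - Suc n) * \<delta>" using \<delta> by simp
      then show ?thesis using stay[of t] True t as sb by linarith
    next
      case False
      have "f (Suc t) \<le> f t - \<delta>" using drop[of t] False t as sb by linarith
      moreover have "real (q - n) * \<delta> = real (q - Suc n) * \<delta> + \<delta>"
        using Suc.prems by (simp add: of_nat_diff algebra_simps)
      ultimately show ?thesis using ft by linarith
    qed
    then have "f (s + L) \<le> \<theta> + real (q - Suc n) * \<delta>"
      using steps[of "Suc t" "s + L"] t as sb by simp
    moreover have "s + L = a + L * Suc n" unfolding s_def by simp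
    ultimately show ?case by simp
  qed
  show "f t \<le> \<theta>" if "a + L * q \<le> t" "t \<le> b"
  proof -
    have "f (a + L * q) \<le> \<theta> + real 0 * \<delta>" using main[of q] that by simp
    then show ?thesis using steps[of "a + L * q" t 0] that by simp
  qed
qed

text \<open>A positive limit \<open>l\<close> is impossible, because then all decrements are eventually of harmonic size.
  After \<open>D\<close> has become smaller than \<open>c / (2 * s)\<close>, the bound \<open>K'/(k+1)\<close> is inherited from \<open>k\<close> to
  \<open>k + s\<close>: it decreases by about \<open>K' * s / k\<^sup>2\<close>, which is less than the decrement \<open>c/(k+1)\<close>.\<close>

lemma harmonic_rate_from_decrements:
  fixes D :: "nat \<Rightarrow> real"
  assumes nonneg: "\<And>k. D k \<ge> 0" and dec: "\<And>k. D (Suc k) \<le> D k"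
    and c: "c > 0" and s: "s > 0" and K: "K \<ge> 0"
    and step: "\<And>k. k \<ge> s \<Longrightarrow> D k \<le> K / real (k + 1) \<or> D (k + s) \<le> D k - c / real (k + 1)"
  shows "\<exists>C>0. \<forall>k. D k \<le> C / real (k + 1)"
proof -
  have decs: "D n \<le> D m" if "m \<le> n" for m n
    using that dec by (rule lift_Suc_antimono_le[rotated])
  obtain l where l: "D \<longlonglongrightarrow> l" "\<And>k. l \<le> D k"
    using decseq_convergent[of D 0] nonneg dec by (metis decseq_Suc_iff)
  have l0: "l \<ge> 0" using l(1) nonneg by (intro LIMSEQ_le_const) auto
  have lim0: "l = 0"
  proof (rule ccontr)
    assume "l \<noteq> 0"
    then have lp: "l > 0" using l0 by simp
    have "(\<lambda>k. K / real (k + 1)) \<longlonglongrightarrow> 0" by real_asymp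
    then have "\<forall>\<^sub>F k in sequentially. K / real (k + 1) < l" using lp by (auto simp: order_tendsto_iff)
    then obtain k2 where k2: "\<And>k. k \<ge> k2 \<Longrightarrow> K / real (k + 1) < l"
      by (auto simp: eventually_sequentially)
    have summ: "summable (\<lambda>k. D k - D (k + m))" for m
    proof (induction m)
      case 0 then show ?case by simp
    next
      case (Suc m)
      have "summable (\<lambda>k. D k - D (Suc k))" using telescope_summable'[OF l(1)] .
      then have "summable (\<lambda>k. D (k + m) - D (Suc (k + m)))"
        by (subst summable_iff_shift[of "\<lambda>k. D k - D (Suc k)"])
      from summable_add[OF Suc this] show ?case by simp
    qed
    have "summable (\<lambda>k. c / real (k + 1))"
    proof (rule summable_comparison_test_ev[OF _ summ[of s]])
      show "\<forall>\<^sub>F k in sequentially. norm (c / real (k + 1)) \<le> D k - D (k + s)"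
        using eventually_ge_at_top[of "max s k2"]
      proof eventually_elim
        case (elim k)
        then have "K / real (k + 1) < D k" using k2[of k] l(2)[of k] by simp
        then show ?case using step[of k] elim c by auto
      qed
    qed
    then have "summable (\<lambda>k. (1 / c) * (c / real (k + 1)))" by (rule summable_mult)
    then have "summable (\<lambda>k. 1 / real (Suc k))" using c by simp
    then have "summable (\<lambda>k. 1 / real k)" by (subst (asm) summable_Suc_iff)
    then show False using not_summable_harmonic[where 'a=real] by (simp add: inverse_eq_divide)
  qed
  have "\<forall>\<^sub>F k in sequentially. D k < c / (2 * real s)"
    using l(1) lim0 c s by (auto simp: order_tendsto_iff)
  then obtain k3' where k3': "\<And>k. k \<ge> k3' \<Longrightarrow> D k < c / (2 * real s)"
    by (auto simp: eventually_sequentially)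
  obtain k4 where k4: "real k4 \<ge> 2 * K * real s / c" using real_arch_simple by blast
  define k3 where "k3 = max (max k3' s) k4"
  have k3: "k3 \<ge> s" "k3 \<ge> k3'" "real k3 \<ge> 2 * K * real s / c" using k4 unfolding k3_def by auto
  \<comment> \<open>The first term covers steps that start below \<open>K/(k+1)\<close>, the second one the initial stretch.\<close>
  define K' where "K' = max (2 * K) (c * real (k3 + s) / (2 * real s))"
  have K'0: "K' \<ge> 0" using K unfolding K'_def by simp
  have K's: "K' * real s \<le> c * real (k + s + 1)" if "k \<ge> k3" for k
  proof -
    have "2 * K * real s \<le> c * real k3" using k3(3) c by (simp add: pos_divide_le_eq mult.commute)
    also have "\<dots> \<le> c * real (k + s + 1)" using that c by (intro mult_left_mono) auto
    finally have 1: "2 * K * real s \<le> c * real (k + s + 1)" .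
    have "c * real (k3 + s) / (2 * real s) * real s = c * (real (k3 + s) / 2)" using s by simp
    also have "\<dots> \<le> c * real (k + s + 1)" using that c by (intro mult_left_mono) auto
    finally show ?thesis using 1 unfolding K'_def by (simp add: max_def)
  qed
  have rate: "D k \<le> K' / real (k + 1)" if "k \<ge> k3" for k
    using that
  proof (induction k rule: less_induct)
    case (less k)
    show ?case
    proof (cases "k < k3 + s")
      case True
      have "real (k + 1) \<le> real (k3 + s)" using True by linarith
      then have "c / (2 * real s) * real (k + 1) \<le> c / (2 * real s) * real (k3 + s)"
        using c by (intro mult_left_mono) auto
      also have "\<dots> \<le> K'" unfolding K'_def by simp
      finally have "c / (2 * real s) \<le> K' / real (k + 1)" by (simp add: pos_le_divide_eq)
      then show ?thesis using k3'[of k] k3(2) less.prems by linarith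
    next
      case False
      define j where "j = k - s"
      have j: "k = j + s" "j \<ge> k3" "j < k" "j \<ge> s" using False s k3 unfolding j_def by auto
      have ih: "D j \<le> K' / real (j + 1)" using less.IH[of j] j by simp
      from step[OF j(4)] show ?thesis
      proof
        assume "D j \<le> K / real (j + 1)"
        then have "D k \<le> K / real (j + 1)" using decs[of j k] j by simp
        also have "\<dots> = 2 * K / real (2 * j + 2)" by (simp add: field_simps)
        also have "\<dots> \<le> K' / real (k + 1)"
          using K j unfolding K'_def by (intro frac_le) auto
        finally show ?thesis .
      next
        assume "D (j + s) \<le> D j - c / real (j + 1)"
        then have "D k \<le> (K' - c) / real (j + 1)" using ih j by (simp add: diff_divide_distrib)
        also have "\<dots> \<le> K' / real (k + 1)"
        proof -
          have "(K' - c) * real (k + 1) \<le> K' * real (j + 1)"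
            using K's[of j] j by (simp add: algebra_simps)
          then show ?thesis by (simp add: field_simps)
        qed
        finally show ?thesis .
      qed
    qed
  qed
  define C where "C = K' + D 0 * real (k3 + 1) + 1"
  have "D k \<le> C / real (k + 1)" for k
  proof (cases "k \<ge> k3")
    case True
    have "K' / real (k + 1) \<le> C / real (k + 1)"
      unfolding C_def using nonneg[of 0] by (intro divide_right_mono) auto
    then show ?thesis using rate[OF True] by linarith
  next
    case False
    have "D k * real (k + 1) \<le> D 0 * real (k3 + 1)"
      using decs[of 0 k] nonneg False by (intro mult_mono) auto
    also have "\<dots> \<le> C" unfolding C_def using K'0 by simp
    finally show ?thesis by (simp add: pos_le_divide_eq)
  qed
  moreover have "C > 0" unfolding C_def using K'0 nonneg[of 0] by (smt (verit) mult_nonneg_nonneg of_nat_0_le_iff)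
  ultimately show ?thesis by blast
qed


text \<open>The facts about the weight iteration that determine its rate, for the common weight \<open>w t i\<close> of the
  edges leaving \<open>i\<close>. The target \<open>\<Sum>\<^sub>j w\<^sub>j / d\<^sub>i\<close> over the in-neighbours is approached but never
  crossed. Saturation is recorded for falling weights only: the spread is contracted at its upper
  end, while its lower end is monotone.\<close>

locale balancing_flow =
  fixes E :: "('n::finite \<times> 'n) set" and \<pi> :: "'n \<Rightarrow> real"
    and w :: "nat \<Rightarrow> 'n \<Rightarrow> real" and \<gamma> :: "nat \<Rightarrow> real" and act :: "nat \<Rightarrow> bool" and L :: nat
  assumes connected: "(i, j) \<in> E\<^sup>*"
    and degree: "out_degree E i \<ge> 1"
    and \<pi>_pos: "\<pi> i > 0"
    and \<pi>_balanced: "real (out_degree E i) * \<pi> i = (\<Sum>j\<in>in_nbrs E i. \<pi> j)"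
    and \<gamma>_pos: "\<gamma> t > 0"
    and rise: "real (out_degree E i) * w t i \<le> (\<Sum>j\<in>in_nbrs E i. w t j) \<Longrightarrow>
      w t i \<le> w (Suc t) i \<and> real (out_degree E i) * w (Suc t) i \<le> (\<Sum>j\<in>in_nbrs E i. w t j)"
    and fall: "real (out_degree E i) * w t i \<ge> (\<Sum>j\<in>in_nbrs E i. w t j) \<Longrightarrow>
      w t i \<ge> w (Suc t) i \<and> real (out_degree E i) * w (Suc t) i \<ge> (\<Sum>j\<in>in_nbrs E i. w t j)"
    and full_fall: "act t \<Longrightarrow>
      real (out_degree E i) * w t i - (\<Sum>j\<in>in_nbrs E i. w t j) > real (out_degree E i) * \<gamma> t \<Longrightarrow>
      w (Suc t) i = w t i - \<gamma> t"
    and rise_le: "w (Suc t) i \<le> w t i + \<gamma> t"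
    and window: "\<exists>t\<in>{k..<k + L}. act t"
begin

abbreviation deg :: "'n \<Rightarrow> real" where "deg i \<equiv> real (out_degree E i)"

lemma deg_pos: "deg i > 0"
  using degree[of i] by linarith

text \<open>Relative to \<open>\<pi>\<close> every weight moves towards a convex combination of the weights at the
  in-neighbours, so a common bound survives.\<close>

lemma upper_preserved:
  assumes "\<And>j. w t j \<le> \<pi> j * c"
  shows "w (Suc t) i \<le> \<pi> i * c"
proof (cases "deg i * w t i \<le> (\<Sum>j\<in>in_nbrs E i. w t j)")
  case True
  have "deg i * w (Suc t) i \<le> (\<Sum>j\<in>in_nbrs E i. w t j)" using rise[OF True] by simp
  also have "\<dots> \<le> (\<Sum>j\<in>in_nbrs E i. \<pi> j * c)" by (intro sum_mono assms)
  also have "\<dots> = deg i * (\<pi> i * c)"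
    by (simp add: sum_distrib_right[symmetric] \<pi>_balanced[symmetric] mult.assoc)
  finally show ?thesis using deg_pos[of i] by (simp add: mult_le_cancel_left)
next
  case False
  then show ?thesis using fall[of t i] assms[of i] by linarith
qed

lemma lower_preserved:
  assumes "\<And>j. w t j \<ge> \<pi> j * c"
  shows "w (Suc t) i \<ge> \<pi> i * c"
proof (cases "deg i * w t i \<ge> (\<Sum>j\<in>in_nbrs E i. w t j)")
  case True
  have "deg i * (\<pi> i * c) = (\<Sum>j\<in>in_nbrs E i. \<pi> j * c)"
    by (simp add: sum_distrib_right[symmetric] \<pi>_balanced[symmetric] mult.assoc)
  also have "\<dots> \<le> (\<Sum>j\<in>in_nbrs E i. w t j)" by (intro sum_mono assms)
  also have "\<dots> \<le> deg i * w (Suc t) i" using fall[OF True] by simp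
  finally show ?thesis using deg_pos[of i] by (simp add: mult_le_cancel_left)
next
  case False
  then show ?thesis using rise[of i t] assms[of i] by linarith
qed

lemma upper_preserved_from:
  assumes "\<And>j. w t0 j \<le> \<pi> j * c" "t0 \<le> t"
  shows "w t i \<le> \<pi> i * c"
  using assms(2) by (induction arbitrary: i rule: dec_induct) (auto intro: assms(1) upper_preserved)

lemma lower_preserved_from:
  assumes "\<And>j. w t0 j \<ge> \<pi> j * c" "t0 \<le> t"
  shows "w t i \<ge> \<pi> i * c"
  using assms(2) by (induction arbitrary: i rule: dec_induct) (auto intro: assms(1) lower_preserved)

text \<open>If an in-neighbour \<open>j\<close> of \<open>i\<close> is far below the bound \<open>c\<close>, by a large multiple of the step \<open>g\<close>,
  then so is the target of \<open>i\<close>. Hence \<open>i\<close> either is already well below the bound or falls at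
  saturated speed until it is; and it cannot come back as long as \<open>j\<close> stays low. Along a path from
  \<open>r\<close>, the gap required at the start grows with every edge, but it is a fixed multiple of \<open>g\<close> that
  does not depend on the time or on the bound.\<close>

lemma gap_propagates:
  assumes "\<kappa> > 0" "(r, i) \<in> E\<^sup>*" "C > 0"
  shows "\<exists>K s. \<forall>g t0 t1 c. 0 < g \<longrightarrow> (\<forall>t\<in>{t0..<t1}. \<kappa> * g \<le> \<gamma> t \<and> \<gamma> t \<le> g) \<longrightarrow>
     (\<forall>j. w t0 j \<le> \<pi> j * c) \<longrightarrow> (\<forall>t\<in>{t0..t1}. w t r \<le> \<pi> r * (c - K * g)) \<longrightarrow>
     (\<forall>t\<in>{t0 + s..t1}. w t i \<le> \<pi> i * (c - C * g))"
  using assms(2,3)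
proof (induction arbitrary: C rule: rtrancl_induct)
  case base
  then show ?case by (intro exI[of _ C] exI[of _ 0]) auto
next
  case (step j i)
  note dpos = deg_pos[of i]
  obtain q :: nat where "real q \<ge> \<pi> i * C / \<kappa>" using real_arch_simple by blast
  then have q: "real q * \<kappa> \<ge> \<pi> i * C" using \<open>\<kappa> > 0\<close> by (simp add: pos_divide_le_eq)
  \<comment> \<open>The gap needed at \<open>j\<close>: the first summand puts the target of \<open>i\<close> below the threshold by a
    margin, the second one makes this margin larger than the saturation level.\<close>
  define C' where "C' = 2 * deg i * \<pi> i * C / \<pi> j + 4 * deg i / \<pi> j"
  have C'pos: "C' > 0" unfolding C'_def using dpos \<pi>_pos step.prems
    by (intro add_pos_pos divide_pos_pos mult_pos_pos) auto
  have C'1: "\<pi> j * C' \<ge> 2 * deg i * \<pi> i * C" and C'2: "\<pi> j * C' / 2 > deg i"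
  proof -
    have "\<pi> j * C' = 2 * deg i * \<pi> i * C + 4 * deg i"
      unfolding C'_def using \<pi>_pos[of j] by (simp add: distrib_left)
    moreover have "2 * deg i * \<pi> i * C \<ge> 0" using dpos \<pi>_pos[of i] step.prems by simp
    ultimately show "\<pi> j * C' \<ge> 2 * deg i * \<pi> i * C" "\<pi> j * C' / 2 > deg i"
      using dpos by linarith+
  qed
  from step.IH[OF C'pos] obtain K s where IH:
    "\<And>g t0 t1 c. 0 < g \<Longrightarrow> (\<forall>t\<in>{t0..<t1}. \<kappa> * g \<le> \<gamma> t \<and> \<gamma> t \<le> g) \<Longrightarrow>
     (\<forall>j. w t0 j \<le> \<pi> j * c) \<Longrightarrow> (\<forall>t\<in>{t0..t1}. w t r \<le> \<pi> r * (c - K * g)) \<Longrightarrow>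
     (\<forall>t\<in>{t0 + s..t1}. w t j \<le> \<pi> j * (c - C' * g))" by blast
  show ?case
  proof (rule exI[of _ K], rule exI[of _ "s + L * q"], intro allI impI ballI)
    fix g c :: real and t0 t1 t
    assume g: "0 < g" and \<gamma>: "\<forall>t\<in>{t0..<t1}. \<kappa> * g \<le> \<gamma> t \<and> \<gamma> t \<le> g"
      and init: "\<forall>j. w t0 j \<le> \<pi> j * c"
      and root: "\<forall>t\<in>{t0..t1}. w t r \<le> \<pi> r * (c - K * g)"
      and t: "t \<in> {t0 + (s + L * q)..t1}"
    have j: "w t j \<le> \<pi> j * (c - C' * g)" if "t0 + s \<le> t" "t \<le> t1" for t
      using IH[OF g \<gamma> init root] that by simp
    have all: "w t l \<le> \<pi> l * c" if "t0 \<le> t" for t l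
      using upper_preserved_from[of t0 c t l] init that by blast
    have avg: "(\<Sum>l\<in>in_nbrs E i. w t l) \<le> deg i * (\<pi> i * c) - \<pi> j * C' * g"
      if "t0 + s \<le> t" "t \<le> t1" for t
    proof -
      have "(\<Sum>l\<in>in_nbrs E i. w t l) \<le> (\<Sum>l\<in>in_nbrs E i. \<pi> l * c - (if l = j then \<pi> j * C' * g else 0))"
      proof (rule sum_mono)
        fix l
        show "w t l \<le> \<pi> l * c - (if l = j then \<pi> j * C' * g else 0)"
          using all[of t l] j[OF that] that by (auto simp: algebra_simps)
      qed
      also have "\<dots> = deg i * (\<pi> i * c) - \<pi> j * C' * g"
        using step.hyps(2)
        by (simp add: sum_subtractf sum_distrib_right[symmetric] \<pi>_balanced[symmetric] mult.assoc)
      finally show ?thesis .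
    qed
    define \<theta> where "\<theta> = \<pi> i * (c - C * g)"
    have \<theta>: "deg i * \<theta> \<ge> deg i * (\<pi> i * c) - \<pi> j * C' * g / 2"
      using mult_right_mono[OF C'1, of g] g unfolding \<theta>_def by (simp add: algebra_simps)
    have above: "deg i * w t i - (\<Sum>l\<in>in_nbrs E i. w t l) > deg i * g"
      if "t0 + s \<le> t" "t \<le> t1" "w t i > \<theta>" for t
    proof -
      have "deg i * w t i > deg i * \<theta>" using that dpos by simp
      moreover have "\<pi> j * C' * g / 2 > deg i * g" using mult_strict_right_mono[OF C'2 g] by simp
      ultimately show ?thesis using avg[OF that(1,2)] \<theta> by linarith
    qed
    show "w t i \<le> \<pi> i * (c - C * g)" unfolding \<theta>_def[symmetric]
    proof (rule scheduled_descent_below[where act = act and a = "t0 + s" and b = t1 and \<delta> = "\<kappa> * g"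
          and q = q and L = L and f = "\<lambda>t. w t i"])
      show "\<exists>t\<in>{k..<k + L}. act t" for k using window .
      show "w (Suc t) i \<le> \<theta>" if "t0 + s \<le> t" "t < t1" "w t i \<le> \<theta>" for t
      proof (cases "deg i * w t i \<le> (\<Sum>l\<in>in_nbrs E i. w t l)")
        case True
        have "0 \<le> \<pi> j * C' * g / 2" using \<pi>_pos[of j] C'pos g by simp
        then have "deg i * w (Suc t) i \<le> deg i * \<theta>"
          using rise[OF True] avg[of t] \<theta> that by linarith
        then show ?thesis using dpos by simp
      next
        case False then show ?thesis using fall[of t i] that by linarith
      qed
      show "w (Suc t) i \<le> w t i" if "t0 + s \<le> t" "t < t1" "w t i > \<theta>" for t
      proof -
        have "0 \<le> deg i * g" using g by simp
        then show ?thesis using above[of t] that fall[of t i] by linarith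
      qed
      show "w (Suc t) i \<le> w t i - \<kappa> * g" if "t0 + s \<le> t" "t < t1" "w t i > \<theta>" "act t" for t
      proof -
        have \<gamma>t: "\<kappa> * g \<le> \<gamma> t" "\<gamma> t \<le> g" using \<gamma> that by auto
        have "deg i * \<gamma> t \<le> deg i * g" using \<gamma>t dpos by simp
        then have "w (Suc t) i = w t i - \<gamma> t"
          using above[of t] that by (intro full_fall) auto
        then show ?thesis using \<gamma>t by simp
      qed
      show "0 \<le> \<kappa> * g" using g \<open>\<kappa> > 0\<close> by simp
      have "w (t0 + s) i \<le> \<pi> i * c" using all by simp
      also have "\<dots> = \<theta> + \<pi> i * C * g" unfolding \<theta>_def by (simp add: algebra_simps)
      also have "\<dots> \<le> \<theta> + real q * (\<kappa> * g)"
        using mult_right_mono[OF q, of g] g by simp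
      finally show "w (t0 + s) i \<le> \<theta> + real q * (\<kappa> * g)" .
      show "t0 + s + L * q \<le> t" "t \<le> t1" using t by auto
    qed
  qed
qed

definition spread_top :: "nat \<Rightarrow> real" where "spread_top t = Max (range (\<lambda>i. w t i / \<pi> i))"
definition spread_bot :: "nat \<Rightarrow> real" where "spread_bot t = Min (range (\<lambda>i. w t i / \<pi> i))"

lemma le_spread_top: "w t i \<le> \<pi> i * spread_top t"
proof -
  have "w t i / \<pi> i \<le> spread_top t" unfolding spread_top_def by (intro Max_ge) auto
  then show ?thesis using \<pi>_pos[of i] by (simp add: pos_divide_le_eq mult.commute)
qed

lemma ge_spread_bot: "w t i \<ge> \<pi> i * spread_bot t"
proof -
  have "w t i / \<pi> i \<ge> spread_bot t" unfolding spread_bot_def by (intro Min_le) auto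
  then show ?thesis using \<pi>_pos[of i] by (simp add: pos_le_divide_eq mult.commute)
qed

lemma spread_top_leI: "(\<And>i. w t i \<le> \<pi> i * c) \<Longrightarrow> spread_top t \<le> c"
  unfolding spread_top_def using \<pi>_pos
  by (intro Max.boundedI) (auto simp: pos_divide_le_eq mult.commute)

lemma spread_bot_geI: "(\<And>i. w t i \<ge> \<pi> i * c) \<Longrightarrow> spread_bot t \<ge> c"
  unfolding spread_bot_def using \<pi>_pos
  by (intro Min.boundedI) (auto simp: pos_le_divide_eq mult.commute)

lemma spread_bot_attained: "\<exists>r. w t r = \<pi> r * spread_bot t"
proof -
  have "spread_bot t \<in> range (\<lambda>i. w t i / \<pi> i)" unfolding spread_bot_def by (intro Min_in) auto
  then obtain r where "spread_bot t = w t r / \<pi> r" by auto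
  then show ?thesis using \<pi>_pos[of r] by (intro exI[of _ r]) simp
qed

lemma spread_top_antimono: "t \<le> t' \<Longrightarrow> spread_top t' \<le> spread_top t"
  by (rule spread_top_leI, rule upper_preserved_from[OF le_spread_top])

lemma spread_bot_mono: "t \<le> t' \<Longrightarrow> spread_bot t \<le> spread_bot t'"
  by (rule spread_bot_geI, rule lower_preserved_from[OF ge_spread_bot])

lemma spread_bot_le_top: "spread_bot t \<le> spread_top t"
  using spread_bot_attained[of t] le_spread_top[of t] \<pi>_pos
  by (metis mult_le_cancel_left_pos)

text \<open>A node that attains the minimum stays low during a window of \<open>s\<close> steps, because it rises by at most
  \<open>g\<close> per step. If the spread is a large multiple of \<open>g\<close>, the gap at this node therefore reaches all
  nodes within the window.\<close>

lemma spread_contraction: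
  assumes "\<kappa> > 0"
  shows "\<exists>K s. K \<ge> 0 \<and> s > 0 \<and> (\<forall>g t0. 0 < g \<longrightarrow> (\<forall>t\<in>{t0..<t0 + s}. \<kappa> * g \<le> \<gamma> t \<and> \<gamma> t \<le> g) \<longrightarrow>
     spread_top t0 - spread_bot t0 > K * g \<longrightarrow> spread_top (t0 + s) \<le> spread_top t0 - g)"
proof -
  have "\<forall>p. \<exists>K s. \<forall>g t0 t1 c. 0 < g \<longrightarrow> (\<forall>t\<in>{t0..<t1}. \<kappa> * g \<le> \<gamma> t \<and> \<gamma> t \<le> g) \<longrightarrow>
     (\<forall>j. w t0 j \<le> \<pi> j * c) \<longrightarrow> (\<forall>t\<in>{t0..t1}. w t (fst p) \<le> \<pi> (fst p) * (c - K * g)) \<longrightarrow>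
     (\<forall>t\<in>{t0 + s..t1}. w t (snd p) \<le> \<pi> (snd p) * (c - 1 * g))"
    by (intro allI gap_propagates[OF assms connected]) simp
  then obtain K s where Ks: "\<And>r i g t0 t1 c. 0 < g \<Longrightarrow> (\<forall>t\<in>{t0..<t1}. \<kappa> * g \<le> \<gamma> t \<and> \<gamma> t \<le> g) \<Longrightarrow>
     (\<forall>j. w t0 j \<le> \<pi> j * c) \<Longrightarrow> (\<forall>t\<in>{t0..t1}. w t r \<le> \<pi> r * (c - K (r, i) * g)) \<Longrightarrow>
     (\<forall>t\<in>{t0 + s (r, i)..t1}. w t i \<le> \<pi> i * (c - 1 * g))"
    by (simp only: choice_iff) (metis fst_conv snd_conv)
  define S :: nat where "S = (\<Sum>p\<in>UNIV. s p) + 1"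
  define K1 where "K1 = (\<Sum>p\<in>UNIV. \<bar>K p\<bar>)"
  define P where "P = (\<Sum>i\<in>UNIV. 1 / \<pi> i)"
  have sS: "s p \<le> S" for p
    using member_le_sum[of p UNIV s] unfolding S_def by simp
  have KK: "K p \<le> K1" for p
    using member_le_sum[of p UNIV "\<lambda>p. \<bar>K p\<bar>"] unfolding K1_def by simp
  have PP: "1 / \<pi> i \<le> P" for i
    unfolding P_def by (rule member_le_sum) (auto intro: less_imp_le \<pi>_pos)
  have P0: "P \<ge> 0" unfolding P_def by (intro sum_nonneg) (auto intro: less_imp_le \<pi>_pos)
  have K10: "K1 \<ge> 0" unfolding K1_def by (intro sum_nonneg) auto
  define K' where "K' = K1 + real S * P"
  show ?thesis
  proof (rule exI[of _ K'], rule exI[of _ S], intro conjI allI impI)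
    show "K' \<ge> 0" unfolding K'_def using K10 P0 by simp
    show "S > 0" unfolding S_def by simp
    fix g :: real and t0
    assume g: "0 < g" and \<gamma>: "\<forall>t\<in>{t0..<t0 + S}. \<kappa> * g \<le> \<gamma> t \<and> \<gamma> t \<le> g"
      and gap: "spread_top t0 - spread_bot t0 > K' * g"
    obtain r where r: "w t0 r = \<pi> r * spread_bot t0" using spread_bot_attained by blast
    have drift: "w (t0 + n) r \<le> w t0 r + real n * g" if "n \<le> S" for n
      using that
    proof (induction n)
      case 0 then show ?case by simp
    next
      case (Suc n)
      have "\<gamma> (t0 + n) \<le> g" using \<gamma> Suc.prems by simp
      then show ?case using rise_le[of "t0 + n" r] Suc by (simp add: algebra_simps)
    qed
    have root: "w t r \<le> \<pi> r * (spread_top t0 - K1 * g)" if "t \<in> {t0..t0 + S}" for t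
    proof -
      have "w t r \<le> w t0 r + real (t - t0) * g" using drift[of "t - t0"] that by auto
      also have "\<dots> \<le> w t0 r + real S * g" using that g by (auto intro!: mult_right_mono)
      also have "\<dots> = \<pi> r * (spread_bot t0 + real S * (1 / \<pi> r) * g)"
        using r \<pi>_pos[of r] by (simp add: field_simps)
      also have "\<dots> \<le> \<pi> r * (spread_bot t0 + real S * P * g)"
        using PP[of r] \<pi>_pos[of r] g by (intro mult_left_mono add_left_mono mult_right_mono) auto
      also have "\<dots> \<le> \<pi> r * (spread_top t0 - K1 * g)"
        using gap \<pi>_pos[of r] unfolding K'_def by (intro mult_left_mono) (auto simp: algebra_simps)
      finally show ?thesis .
    qed
    show "spread_top (t0 + S) \<le> spread_top t0 - g"
    proof (rule spread_top_leI)
      fix i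
      have "\<forall>t\<in>{t0..t0 + S}. w t r \<le> \<pi> r * (spread_top t0 - K (r, i) * g)"
      proof
        fix t assume "t \<in> {t0..t0 + S}"
        then have "w t r \<le> \<pi> r * (spread_top t0 - K1 * g)" by (rule root)
        also have "\<dots> \<le> \<pi> r * (spread_top t0 - K (r, i) * g)"
          using KK[of "(r, i)"] g \<pi>_pos[of r] by (intro mult_left_mono diff_left_mono mult_right_mono) auto
        finally show "w t r \<le> \<pi> r * (spread_top t0 - K (r, i) * g)" .
      qed
      then have "\<forall>t\<in>{t0 + s (r, i)..t0 + S}. w t i \<le> \<pi> i * (spread_top t0 - 1 * g)"
        using Ks[of g t0 "t0 + S" "spread_top t0" r i] g \<gamma> le_spread_top by blast
      then show "w (t0 + S) i \<le> \<pi> i * (spread_top t0 - g)" using sS[of "(r, i)"] by simp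
    qed
  qed
qed

lemma imbalance_le_spread:
  "\<bar>(\<Sum>j\<in>in_nbrs E i. w t j) - deg i * w t i\<bar> \<le> deg i * \<pi> i * (spread_top t - spread_bot t)"
proof -
  have 1: "(\<Sum>j\<in>in_nbrs E i. w t j) \<le> (\<Sum>j\<in>in_nbrs E i. \<pi> j * spread_top t)"
    and 2: "(\<Sum>j\<in>in_nbrs E i. \<pi> j * spread_bot t) \<le> (\<Sum>j\<in>in_nbrs E i. w t j)"
    by (intro sum_mono le_spread_top ge_spread_bot)+
  have 3: "(\<Sum>j\<in>in_nbrs E i. \<pi> j * z) = deg i * \<pi> i * z" for z
    by (simp add: sum_distrib_right[symmetric] \<pi>_balanced[symmetric])
  have 4: "deg i * w t i \<le> deg i * \<pi> i * spread_top t" "deg i * \<pi> i * spread_bot t \<le> deg i * w t i"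
    using mult_left_mono[OF le_spread_top[of t i], of "deg i"]
      mult_left_mono[OF ge_spread_bot[of i t], of "deg i"] deg_pos[of i]
    by (simp_all add: mult.assoc)
  show ?thesis using 1 2 4 unfolding 3 by (simp add: abs_le_iff right_diff_distrib)
qed

text \<open>For \<open>k \<ge> s\<close> the steps within the window from \<open>k\<close> to \<open>k + s\<close> agree up to the constant factor
  \<open>2 * A / a\<close>, whatever \<open>s\<close> is. So \<open>\<kappa>\<close> can be chosen before the window length.\<close>

theorem imbalance_harmonic_decay:
  assumes "a > 0" and \<gamma>_bounds: "\<And>k. a / real (k + 1) \<le> \<gamma> k \<and> \<gamma> k \<le> A / real (k + 1)"
  shows "\<exists>C>0. \<forall>k i. \<bar>(\<Sum>j\<in>in_nbrs E i. w k j) - deg i * w k i\<bar> \<le> C / real (k + 1)"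
proof -
  have A: "A > 0" using \<gamma>_bounds[of 0] \<open>a > 0\<close> by simp
  define \<kappa> where "\<kappa> = a / (2 * A)"
  have "\<kappa> > 0" unfolding \<kappa>_def using A \<open>a > 0\<close> by simp
  from spread_contraction[OF this] obtain K s where Ks: "K \<ge> 0" "s > 0"
    "\<And>g t0. 0 < g \<Longrightarrow> (\<forall>t\<in>{t0..<t0 + s}. \<kappa> * g \<le> \<gamma> t \<and> \<gamma> t \<le> g) \<Longrightarrow>
     spread_top t0 - spread_bot t0 > K * g \<Longrightarrow> spread_top (t0 + s) \<le> spread_top t0 - g" by blast
  define D where "D k = spread_top k - spread_bot k" for k
  have "\<exists>C>0. \<forall>k. D k \<le> C / real (k + 1)"
  proof (rule harmonic_rate_from_decrements[where c = A and K = "K * A" and s = s])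
    show "0 \<le> D k" for k unfolding D_def using spread_bot_le_top by simp
    show "D (Suc k) \<le> D k" for k
      unfolding D_def using spread_bot_mono[of k "Suc k"] spread_top_antimono[of k "Suc k"] by simp
    show "A > 0" "s > 0" "K * A \<ge> 0" using A Ks by auto
    fix k assume k: "s \<le> k"
    define g where "g = A / real (k + 1)"
    have g: "g > 0" unfolding g_def using A by simp
    have \<gamma>: "\<forall>t\<in>{k..<k + s}. \<kappa> * g \<le> \<gamma> t \<and> \<gamma> t \<le> g"
    proof
      fix t assume t: "t \<in> {k..<k + s}"
      have "\<kappa> * g = a / (2 * real (k + 1))" unfolding \<kappa>_def g_def using A by simp
      also have "\<dots> \<le> a / real (t + 1)" using t k \<open>a > 0\<close> by (intro divide_left_mono) auto
      also have "\<dots> \<le> \<gamma> t" using \<gamma>_bounds[of t] by simp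
      finally have 1: "\<kappa> * g \<le> \<gamma> t" .
      have "\<gamma> t \<le> A / real (t + 1)" using \<gamma>_bounds[of t] by simp
      also have "\<dots> \<le> g" unfolding g_def using t A by (intro divide_left_mono) auto
      finally show "\<kappa> * g \<le> \<gamma> t \<and> \<gamma> t \<le> g" using 1 by simp
    qed
    show "D k \<le> K * A / real (k + 1) \<or> D (k + s) \<le> D k - A / real (k + 1)"
    proof (cases "D k > K * g")
      case True
      then have "spread_top (k + s) \<le> spread_top k - g" using Ks(3)[OF g \<gamma>] unfolding D_def by simp
      moreover have "spread_bot k \<le> spread_bot (k + s)" by (intro spread_bot_mono) simp
      ultimately show ?thesis unfolding D_def g_def by linarith
    next
      case False then show ?thesis unfolding g_def by simp
    qed
  qed
  then obtain C where C: "C > 0" "\<And>k. D k \<le> C / real (k + 1)" by blast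
  define T where "T = (\<Sum>i\<in>UNIV. deg i * \<pi> i)"
  have T: "deg i * \<pi> i \<le> T" for i
    unfolding T_def using \<pi>_pos deg_pos
    by (intro member_le_sum mult_nonneg_nonneg) (auto intro: less_imp_le)
  have Tpos: "T > 0" unfolding T_def using \<pi>_pos deg_pos by (intro sum_pos) auto
  show ?thesis
  proof (intro exI[of _ "T * C"] conjI allI)
    show "T * C > 0" using Tpos C by simp
    fix k i
    have "\<bar>(\<Sum>j\<in>in_nbrs E i. w k j) - deg i * w k i\<bar> \<le> deg i * \<pi> i * D k"
      unfolding D_def by (rule imbalance_le_spread)
    also have "\<dots> \<le> T * (C / real (k + 1))"
      using T[of i] C(2)[of k] Tpos spread_bot_le_top[of k] unfolding D_def
      by (intro mult_mono) auto
    finally show "\<bar>(\<Sum>j\<in>in_nbrs E i. w k j) - deg i * w k i\<bar> \<le> T * C / real (k + 1)" by simp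
  qed
qed

end


section \<open>The weight-balancing iteration\<close>

text \<open>The bound \<open>(c1\<^sup>n - 1) c2 \<le> k \<le> (c1\<^sup>n\<^sup>+\<^sup>1 - 1) c2 - 1\<close> says that \<open>c1\<^sup>n\<close> is comparable to \<open>k + 1\<close>.\<close>

lemma weight_steps_bounds:
  assumes "weight_steps \<gamma>"
  shows "\<exists>a A. a > 0 \<and> (\<forall>k. a / real (k + 1) \<le> \<gamma> k \<and> \<gamma> k \<le> A / real (k + 1))"
proof -
  obtain c1 :: nat and c2 :: real where c: "c1 \<ge> 2" "c2 > 0" and
    ex: "\<And>k. \<exists>n. (real c1 ^ n - 1) * c2 \<le> real k \<and> real k \<le> (real c1 ^ (n + 1) - 1) * c2 - 1 \<and>
                 \<gamma> k = 1 / real c1 ^ n"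
    using assms unfolding weight_steps_def by blast
  define a where "a = min 1 c2"
  have a: "a > 0" "a \<le> 1" "a \<le> c2" unfolding a_def using c by auto
  have "a / real (k + 1) \<le> \<gamma> k \<and> \<gamma> k \<le> real c1 * c2 / real (k + 1)" for k
  proof -
    obtain n where n: "(real c1 ^ n - 1) * c2 \<le> real k"
      "real k \<le> (real c1 ^ (n + 1) - 1) * c2 - 1" "\<gamma> k = 1 / real c1 ^ n" using ex by blast
    have p1: "real c1 ^ n \<ge> 1" using c by simp
    have "(real c1 ^ n - 1) * a \<le> (real c1 ^ n - 1) * c2" using p1 a by (intro mult_left_mono) auto
    then have "a * real c1 ^ n \<le> real (k + 1)" using n(1) a by (simp add: algebra_simps)
    moreover have p0: "real c1 ^ n > 0" using p1 by linarith
    ultimately have "a / real (k + 1) \<le> \<gamma> k" using n(3)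
      by (simp add: pos_divide_le_eq pos_le_divide_eq mult.commute)
    moreover have "real (k + 1) \<le> real c1 * c2 * real c1 ^ n" using n(2) c by (simp add: algebra_simps)
    then have "\<gamma> k \<le> real c1 * c2 / real (k + 1)" using n(3) p0
      by (simp add: pos_divide_le_eq pos_le_divide_eq mult.commute)
    ultimately show ?thesis by simp
  qed
  then show ?thesis using a by blast
qed

text \<open>A node increments the weights of all its outgoing edges by the same amount, and they all start at
  \<open>1\<close>; one number per node describes them.\<close>

primrec node_weight ::
  "('n::finite \<times> 'n) set \<Rightarrow> (nat \<Rightarrow> 'n \<Rightarrow> nat) \<Rightarrow> (nat \<Rightarrow> real) \<Rightarrow> nat \<Rightarrow> 'n \<Rightarrow> real"
where
  "node_weight E Bw \<gamma> 0 = (\<lambda>j. 1)"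
| "node_weight E Bw \<gamma> (Suc k) = (\<lambda>j. node_weight E Bw \<gamma> k j + \<gamma> k * weight_increment E Bw \<gamma> k j)"

definition edge_matrix :: "('n::finite \<times> 'n) set \<Rightarrow> ('n \<Rightarrow> real) \<Rightarrow> 'n \<Rightarrow> 'n \<Rightarrow> real" where
  "edge_matrix E u i j = (if (j, i) \<in> E then u j else 0)"

definition node_imbalance :: "('n::finite \<times> 'n) set \<Rightarrow> ('n \<Rightarrow> real) \<Rightarrow> 'n \<Rightarrow> real" where
  "node_imbalance E u i = (\<Sum>j\<in>in_nbrs E i. u j) - real (out_degree E i) * u i"

lemma weight_eq_edge_matrix:
  "weight E Bw \<gamma> k = edge_matrix E (node_weight E Bw \<gamma> k)"
  by (induction k) (auto simp: init_weight_def edge_matrix_def fun_eq_iff)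

lemma imbalance_eq_node_imbalance:
  "imbalance E Bw \<gamma> k i = node_imbalance E (node_weight E Bw \<gamma> k) i"
proof (induction k arbitrary: i)
  case 0
  show ?case by (simp add: init_weight_def node_imbalance_def out_degree_def)
next
  case (Suc k)
  have "imbalance E Bw \<gamma> (Suc k) i = imbalance E Bw \<gamma> k i
      - \<gamma> k * real (out_degree E i) * weight_increment E Bw \<gamma> k i
      + \<gamma> k * (\<Sum>j\<in>in_nbrs E i. weight_increment E Bw \<gamma> k j)"
    by (simp add: weight_increment_def Let_def)
  then show ?case
    unfolding Suc by (simp add: node_imbalance_def sum.distrib sum_distrib_left algebra_simps)
qed

lemma weight_balancing_flow:
  fixes E :: "('n::finite \<times> 'n) set"
  assumes "CARD('n) \<ge> 2" "strongly_connected_digraph E" "weight_bits Bw" "weight_steps \<gamma>"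
  shows "\<exists>\<pi> act L. balancing_flow E \<pi> (node_weight E Bw \<gamma>) \<gamma> act L"
proof -
  obtain \<pi> where \<pi>: "\<And>i. \<pi> i > 0"
    "\<And>i. real (out_degree E i) * \<pi> i = (\<Sum>j\<in>in_nbrs E i. \<pi> j)"
    using balanced_vector_exists assms by blast
  obtain F W Bmax where F: "active_schedule F W"
    "\<And>k i. if F k = 1 then 1 \<le> Bw k i \<and> Bw k i \<le> Bmax else Bw k i = 0"
    using assms(3) unfolding weight_bits_def by blast
  obtain a A where a: "a > 0" "\<And>k. a / real (k + 1) \<le> \<gamma> k"
    using weight_steps_bounds[OF assms(4)] by blast
  have \<gamma>: "\<gamma> k > 0" for k
  proof -
    have "0 < a / real (k + 1)" using a by simp
    then show ?thesis using a(2)[of k] by linarith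
  qed
  have deg: "out_degree E i \<ge> 1" for i using out_degree_pos assms by blast
  let ?w = "node_weight E Bw \<gamma>" and ?b = "imbalance E Bw \<gamma>" and ?n = "weight_increment E Bw \<gamma>"
  let ?d = "\<lambda>i. real (out_degree E i)"
  have b: "(\<Sum>j\<in>in_nbrs E i. ?w t j) = ?b t i + ?d i * ?w t i" for t i
    by (simp add: imbalance_eq_node_imbalance node_imbalance_def)
  have sign: "?n t i = sgn (?b t i) * \<bar>?n t i\<bar>" for t i
    unfolding weight_increment_def by (rule quantized_imbalance_same_sign[OF \<gamma> deg])
  have le1: "\<bar>?n t i\<bar> \<le> 1" for t i
    unfolding weight_increment_def by (rule quantized_imbalance_le_1[OF \<gamma> deg])
  have shoot: "?d i * \<gamma> t * \<bar>?n t i\<bar> \<le> \<bar>?b t i\<bar>" for t i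
    unfolding weight_increment_def by (rule quantized_imbalance_no_overshoot[OF \<gamma> deg])
  have "balancing_flow E \<pi> ?w \<gamma> (\<lambda>t. F t = 1) (2 * W)"
  proof
    show "(i, j) \<in> E\<^sup>*" for i j using assms(2) by (simp add: strongly_connected_digraph_def)
    show "\<exists>t\<in>{k..<k + 2 * W}. F t = 1" for k by (rule active_schedule_window[OF F(1)])
    fix t i
    show "?w (Suc t) i \<le> ?w t i + \<gamma> t" using mult_left_mono[of "?n t i" 1 "\<gamma> t"] le1[of t i] \<gamma>[of t]
      by (simp add: abs_le_iff)
    show "?w t i \<le> ?w (Suc t) i \<and> ?d i * ?w (Suc t) i \<le> (\<Sum>j\<in>in_nbrs E i. ?w t j)"
      if "?d i * ?w t i \<le> (\<Sum>j\<in>in_nbrs E i. ?w t j)"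
    proof -
      have b0: "?b t i \<ge> 0" using that b[of t i] by linarith
      then have "?n t i \<ge> 0" using sign[of t i] by (smt (verit) mult_nonneg_nonneg sgn_if)
      then show ?thesis using shoot[of i t] b0 \<gamma>[of t] unfolding b by (simp add: algebra_simps)
    qed
    show "?w t i \<ge> ?w (Suc t) i \<and> ?d i * ?w (Suc t) i \<ge> (\<Sum>j\<in>in_nbrs E i. ?w t j)"
      if "?d i * ?w t i \<ge> (\<Sum>j\<in>in_nbrs E i. ?w t j)"
    proof -
      have b0: "?b t i \<le> 0" using that b[of t i] by linarith
      then have "?n t i \<le> 0" using sign[of t i] by (smt (verit) mult_nonpos_nonneg sgn_if abs_ge_zero)
      then show ?thesis using shoot[of i t] b0 \<gamma>[of t] unfolding b
        by (simp add: algebra_simps mult_nonneg_nonpos)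
    qed
    show "?w (Suc t) i = ?w t i - \<gamma> t"
      if "F t = 1" "?d i * ?w t i - (\<Sum>j\<in>in_nbrs E i. ?w t j) > ?d i * \<gamma> t"
    proof -
      have "0 < ?d i * \<gamma> t" using deg[of i] \<gamma>[of t] by simp
      then have bneg: "?b t i < 0" and big: "\<bar>?b t i\<bar> > ?d i * \<gamma> t"
        using that(2) unfolding b by linarith+
      have "Bw t i \<ge> 1" using F(2)[of t i] that(1) by simp
      then have "\<bar>?n t i\<bar> = 1"
        unfolding weight_increment_def using quantized_imbalance_saturated[OF \<gamma> deg] big by blast
      then have "?n t i = -1" using sign[of t i] bneg by simp
      then show ?thesis by simp
    qed
  qed (use \<gamma> deg \<pi> in auto)
  then show ?thesis by blast
qed

theorem node_weight_bounds:
  fixes E :: "('n::finite \<times> 'n) set"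
  assumes "CARD('n) \<ge> 2" "strongly_connected_digraph E" "weight_bits Bw" "weight_steps \<gamma>"
  shows "\<exists>a A. a > 0 \<and> (\<forall>k i. a \<le> node_weight E Bw \<gamma> k i \<and> node_weight E Bw \<gamma> k i \<le> A)"
proof -
  obtain \<pi> act L where "balancing_flow E \<pi> (node_weight E Bw \<gamma>) \<gamma> act L"
    using weight_balancing_flow[OF assms] by blast
  then interpret balancing_flow E \<pi> "node_weight E Bw \<gamma>" \<gamma> act L .
  define lo where "lo = Min (range \<pi>)"
  define hi where "hi = Max (range \<pi>)"
  have lo: "lo \<le> \<pi> i" and hi: "\<pi> i \<le> hi" for i unfolding lo_def hi_def by auto
  have "lo \<in> range \<pi>" unfolding lo_def by (intro Min_in) auto
  then have lop: "lo > 0" using \<pi>_pos by auto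
  then have hip: "hi > 0" using lo hi by (meson less_le_trans)
  have up: "node_weight E Bw \<gamma> k i \<le> \<pi> i * (1 / lo)" for k i
    by (rule upper_preserved_from[where ?t0.0 = 0]) (use lo lop in \<open>simp_all add: pos_le_divide_eq\<close>)
  have low: "node_weight E Bw \<gamma> k i \<ge> \<pi> i * (1 / hi)" for k i
    by (rule lower_preserved_from[where ?t0.0 = 0]) (use hi hip in \<open>simp_all add: pos_divide_le_eq\<close>)
  have "lo / hi \<le> node_weight E Bw \<gamma> k i \<and> node_weight E Bw \<gamma> k i \<le> hi / lo" for k i
  proof
    have "lo / hi \<le> \<pi> i * (1 / hi)" using lo hip by (simp add: divide_right_mono)
    then show "lo / hi \<le> node_weight E Bw \<gamma> k i" using low[of i k] by linarith
    have "\<pi> i * (1 / lo) \<le> hi / lo" using hi lop by (simp add: divide_right_mono)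
    then show "node_weight E Bw \<gamma> k i \<le> hi / lo" using up[of k i] by linarith
  qed
  then show ?thesis using lop hip by (intro exI[of _ "lo / hi"] exI[of _ "hi / lo"]) auto
qed

theorem imbalance_decay:
  fixes E :: "('n::finite \<times> 'n) set"
  assumes "CARD('n) \<ge> 2" "strongly_connected_digraph E" "weight_bits Bw" "weight_steps \<gamma>"
  shows "\<exists>C>0. \<forall>k i. \<bar>imbalance E Bw \<gamma> k i\<bar> \<le> C / real (k + 1)"
proof -
  obtain \<pi> act L where "balancing_flow E \<pi> (node_weight E Bw \<gamma>) \<gamma> act L"
    using weight_balancing_flow[OF assms] by blast
  then interpret balancing_flow E \<pi> "node_weight E Bw \<gamma>" \<gamma> act L .
  show ?thesis
    using weight_steps_bounds[OF assms(4)] imbalance_harmonic_decay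
    unfolding imbalance_eq_node_imbalance node_imbalance_def by blast
qed


section \<open>The clipped Laplacian form\<close>

lemma edge_matrix_out_sum: "(\<Sum>l\<in>out_nbrs E i. edge_matrix E u l i) = real (out_degree E i) * u i"
  by (simp add: edge_matrix_def out_degree_def)

lemma edge_matrix_row_sum:
  fixes E :: "('n::finite \<times> 'n) set"
  shows "(\<Sum>j\<in>UNIV. edge_matrix E u i j * z j) = (\<Sum>j\<in>in_nbrs E i. u j * z j)"
  by (simp add: edge_matrix_def in_nbrs_def if_distrib[of "\<lambda>c. c * _"] sum.If_cases cong: if_cong)

lemma out_laplacian_mult:
  fixes E :: "('n::finite \<times> 'n) set"
  shows "(out_laplacian E (edge_matrix E u) *v z) $ i =
    real (out_degree E i) * u i * z $ i - (\<Sum>j\<in>in_nbrs E i. u j * z $ j)"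
proof -
  have "(out_laplacian E (edge_matrix E u) *v z) $ i =
    (\<Sum>j\<in>UNIV. (if i = j then real (out_degree E i) * u i * z $ j else 0) - edge_matrix E u i j * z $ j)"
    unfolding matrix_vector_mult_def out_laplacian_def
    by (auto simp: edge_matrix_out_sum left_diff_distrib intro!: sum.cong)
  then show ?thesis by (simp add: sum_subtractf edge_matrix_row_sum)
qed

text \<open>Grouped by edges, the form depends on \<open>y\<close> only through differences along edges: this is where the
  zero column sums enter.\<close>

lemma inner_out_laplacian:
  fixes E :: "('n::finite \<times> 'n) set"
  shows "y \<bullet> (out_laplacian E (edge_matrix E u) *v z) =
    (\<Sum>j\<in>UNIV. \<Sum>i\<in>out_nbrs E j. u j * z $ j * (y $ j - y $ i))"
proof -
  have "y \<bullet> (out_laplacian E (edge_matrix E u) *v z) =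
      (\<Sum>j\<in>UNIV. real (out_degree E j) * (u j * z $ j * y $ j)) -
      (\<Sum>i\<in>UNIV. \<Sum>j\<in>in_nbrs E i. u j * z $ j * y $ i)"
    by (simp add: inner_vec_def out_laplacian_mult right_diff_distrib sum_subtractf
        sum_distrib_left mult_ac)
  also have "(\<Sum>i\<in>UNIV. \<Sum>j\<in>in_nbrs E i. u j * z $ j * y $ i) =
      (\<Sum>j\<in>UNIV. \<Sum>i\<in>out_nbrs E j. u j * z $ j * y $ i)"
    by (rule sum_in_nbrs_swap)
  finally show ?thesis
    by (simp add: right_diff_distrib sum_subtractf out_degree_def)
qed

lemma sum_out_laplacian:
  fixes E :: "('n::finite \<times> 'n) set"
  shows "(\<Sum>i\<in>UNIV. (out_laplacian E (edge_matrix E u) *v z) $ i) = 0"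
  using inner_out_laplacian[of "\<chi> i. 1" E u z] by (simp add: inner_vec_def)

text \<open>A primitive of the clipping function, up to an additive constant.\<close>

definition clip_potential :: "real \<Rightarrow> real \<Rightarrow> real \<Rightarrow> real" where
  "clip_potential qmin qmax t = clip qmin qmax t * t - (clip qmin qmax t)\<^sup>2 / 2"

text \<open>The potential is convex and its derivative is monotone and \<open>1\<close>-Lipschitz. The inequality is the
  resulting lower bound on its Bregman divergence; the slack is the product of
  \<open>clip t - clip v\<close> and \<open>t - clip t\<close>, nonnegative because clipping is a projection.\<close>

lemma clip_bregman:
  assumes "qmin \<le> qmax"
  shows "clip qmin qmax v * (v - t) \<ge>
    clip_potential qmin qmax v - clip_potential qmin qmax t + (clip qmin qmax t - clip qmin qmax v)\<^sup>2 / 2"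
proof -
  have "(clip qmin qmax t - clip qmin qmax v) * (t - clip qmin qmax t) \<ge> 0"
    using assms unfolding clip_def by (auto simp: min_def max_def zero_le_mult_iff)
  then show ?thesis
    unfolding clip_potential_def power2_eq_square by (simp add: field_simps)
qed

definition edge_energy :: "('n::finite \<times> 'n) set \<Rightarrow> ('n \<Rightarrow> real) \<Rightarrow> real" where
  "edge_energy E v = (\<Sum>j\<in>UNIV. \<Sum>i\<in>out_nbrs E j. (v i - v j)\<^sup>2)"

lemma edge_le_edge_energy: "(j, i) \<in> E \<Longrightarrow> (v i - v j)\<^sup>2 \<le> edge_energy E v"
proof -
  assume e: "(j, i) \<in> E"
  have "(v i - v j)\<^sup>2 \<le> (\<Sum>i\<in>out_nbrs E j. (v i - v j)\<^sup>2)"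
    using e by (intro member_le_sum[of i "out_nbrs E j" "\<lambda>i. (v i - v j)\<^sup>2"]) auto
  also have "\<dots> \<le> edge_energy E v" unfolding edge_energy_def
    by (intro member_le_sum[of j UNIV "\<lambda>j. \<Sum>i\<in>out_nbrs E j. (v i - v j)\<^sup>2"]) (auto intro: sum_nonneg)
  finally show ?thesis .
qed

lemma edge_energy_nonneg: "edge_energy E v \<ge> 0"
  unfolding edge_energy_def by (intro sum_nonneg) auto

text \<open>Along a path, \<open>(a + b)\<^sup>2 \<le> 2 * a\<^sup>2 + 2 * b\<^sup>2\<close> doubles the constant at every edge.\<close>

lemma difference_le_edge_energy:
  fixes E :: "('n::finite \<times> 'n) set"
  assumes "strongly_connected_digraph E"
  shows "\<exists>C>0. \<forall>v p q. (v p - v q)\<^sup>2 \<le> C * edge_energy E v"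
proof -
  have one: "\<exists>C\<ge>0. \<forall>v. (v q - v p)\<^sup>2 \<le> C * edge_energy E v" for p q
  proof -
    have "(p, q) \<in> E\<^sup>*" using assms by (simp add: strongly_connected_digraph_def)
    then show ?thesis
    proof (induction rule: rtrancl_induct)
      case base then show ?case by (intro exI[of _ 0]) simp
    next
      case (step j i)
      then obtain C where C: "C \<ge> 0" "\<And>v. (v j - v p)\<^sup>2 \<le> C * edge_energy E v" by blast
      have "(v i - v p)\<^sup>2 \<le> (2 * C + 2) * edge_energy E v" for v
      proof -
        have "(v i - v p)\<^sup>2 \<le> 2 * (v j - v p)\<^sup>2 + 2 * (v i - v j)\<^sup>2"
          using zero_le_power2[of "(v j - v p) - (v i - v j)"]
          by (simp add: power2_eq_square algebra_simps)
        then show ?thesis using C(2)[of v] edge_le_edge_energy[OF step.hyps(2), of v]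
          by (simp add: algebra_simps)
      qed
      then show ?case using C(1) by (intro exI[of _ "2 * C + 2"]) auto
    qed
  qed
  have "\<forall>p q. \<exists>C. C \<ge> 0 \<and> (\<forall>v. (v q - v p)\<^sup>2 \<le> C * edge_energy E v)"
    using one by blast
  then obtain C where C: "\<And>p q. C p q \<ge> 0" "\<And>p q v. (v q - v p)\<^sup>2 \<le> C p q * edge_energy E v"
    by (simp only: choice_iff) blast
  define S where "S = (\<Sum>p\<in>UNIV. \<Sum>q\<in>UNIV. C p q) + 1"
  have "C p q \<le> S" for p q
  proof -
    have "C p q \<le> (\<Sum>q\<in>UNIV. C p q)" using C(1) by (intro member_le_sum[of q UNIV "C p"]) auto
    also have "\<dots> \<le> (\<Sum>p\<in>UNIV. \<Sum>q\<in>UNIV. C p q)"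
      using C(1) by (intro member_le_sum[of p UNIV "\<lambda>p. \<Sum>q\<in>UNIV. C p q"]) (auto intro: sum_nonneg)
    finally show ?thesis unfolding S_def by simp
  qed
  then have "(v q - v p)\<^sup>2 \<le> S * edge_energy E v" for p q v
    using C(2)[where v = v and p = p and q = q] mult_right_mono[of "C p q" S "edge_energy E v"] edge_energy_nonneg[of E v]
    by (meson order_trans)
  moreover have "S > 0" unfolding S_def using C(1) by (simp add: sum_nonneg add_nonneg_pos)
  ultimately show ?thesis by blast
qed

text \<open>The differences of potentials, weighted by \<open>u\<close>, telescope at every node to the out-weight minus
  the in-weight. Only the imbalance prevents them from cancelling.\<close>

lemma clipped_form_ge_edge_energy:
  fixes E :: "('n::finite \<times> 'n) set"
  assumes "qmin \<le> qmax" and a: "a \<ge> 0" "\<And>i. a \<le> u i"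
    and F: "\<And>i. \<bar>clip_potential qmin qmax (y $ i)\<bar> \<le> Fm"
  shows "y \<bullet> (out_laplacian E (edge_matrix E u) *v clip_vec qmin qmax y) \<ge>
    a / 2 * edge_energy E (\<lambda>i. clip qmin qmax (y $ i)) - Fm * (\<Sum>i\<in>UNIV. \<bar>node_imbalance E u i\<bar>)"
proof -
  let ?c = "\<lambda>i. clip qmin qmax (y $ i)" and ?F = "\<lambda>i. clip_potential qmin qmax (y $ i)"
  have u0: "0 \<le> u j" for j using a(1) a(2)[of j] by linarith
  have "y \<bullet> (out_laplacian E (edge_matrix E u) *v clip_vec qmin qmax y) =
      (\<Sum>j\<in>UNIV. \<Sum>i\<in>out_nbrs E j. u j * (?c j * (y $ j - y $ i)))"
    unfolding inner_out_laplacian by (simp add: clip_vec_def mult.assoc)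
  also have "\<dots> \<ge> (\<Sum>j\<in>UNIV. \<Sum>i\<in>out_nbrs E j. u j * (?F j - ?F i) + a / 2 * (?c i - ?c j)\<^sup>2)"
  proof (intro sum_mono)
    fix j i
    have "a / 2 * (?c i - ?c j)\<^sup>2 \<le> u j * ((?c i - ?c j)\<^sup>2 / 2)"
      using a(2)[of j] mult_right_mono[of a "u j" "(?c i - ?c j)\<^sup>2 / 2"] by simp
    then have "u j * (?F j - ?F i) + a / 2 * (?c i - ?c j)\<^sup>2 \<le> u j * (?F j - ?F i + (?c i - ?c j)\<^sup>2 / 2)"
      by (simp add: distrib_left)
    also have "\<dots> \<le> u j * (?c j * (y $ j - y $ i))"
      by (intro mult_left_mono clip_bregman assms u0)
    finally show "u j * (?F j - ?F i) + a / 2 * (?c i - ?c j)\<^sup>2 \<le> u j * (?c j * (y $ j - y $ i))" .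
  qed
  also have "(\<Sum>j\<in>UNIV. \<Sum>i\<in>out_nbrs E j. u j * (?F j - ?F i) + a / 2 * (?c i - ?c j)\<^sup>2) =
      (\<Sum>j\<in>UNIV. \<Sum>i\<in>out_nbrs E j. u j * (?F j - ?F i)) + a / 2 * edge_energy E ?c"
    by (simp add: edge_energy_def sum.distrib sum_distrib_left)
  also have "(\<Sum>j\<in>UNIV. \<Sum>i\<in>out_nbrs E j. u j * (?F j - ?F i)) = - (\<Sum>i\<in>UNIV. node_imbalance E u i * ?F i)"
  proof -
    have "(\<Sum>j\<in>UNIV. \<Sum>i\<in>out_nbrs E j. u j * ?F i) = (\<Sum>i\<in>UNIV. \<Sum>j\<in>in_nbrs E i. u j * ?F i)"
      by (rule sum_in_nbrs_swap[symmetric])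
    then show ?thesis
      by (simp add: node_imbalance_def right_diff_distrib left_diff_distrib sum_subtractf
          out_degree_def sum_distrib_right mult.assoc)
  qed
  finally have 1: "y \<bullet> (out_laplacian E (edge_matrix E u) *v clip_vec qmin qmax y) \<ge>
      a / 2 * edge_energy E ?c - (\<Sum>i\<in>UNIV. node_imbalance E u i * ?F i)" by simp
  have "(\<Sum>i\<in>UNIV. node_imbalance E u i * ?F i) \<le> (\<Sum>i\<in>UNIV. Fm * \<bar>node_imbalance E u i\<bar>)"
  proof (rule sum_mono)
    fix i
    have "node_imbalance E u i * ?F i \<le> \<bar>node_imbalance E u i\<bar> * \<bar>?F i\<bar>"
      by (metis abs_ge_self abs_mult)
    also have "\<dots> \<le> \<bar>node_imbalance E u i\<bar> * Fm" by (intro mult_left_mono F) simp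
    finally show "node_imbalance E u i * ?F i \<le> Fm * \<bar>node_imbalance E u i\<bar>" by (simp add: mult.commute)
  qed
  then show ?thesis using 1 by (simp add: sum_distrib_left)
qed

lemma opposite_deviation:
  fixes d :: "'n::finite \<Rightarrow> real"
  assumes "(\<Sum>i\<in>UNIV. d i) = 0" "d i \<ge> 0"
  shows "\<exists>j. d j \<le> - d i / real CARD('n)"
proof (rule ccontr)
  assume "\<not> ?thesis"
  then have *: "d j > - d i / real CARD('n)" for j by (simp add: not_le)
  have N: "real CARD('n) > 0" by simp
  have "(\<Sum>j\<in>UNIV - {i}. - d i / real CARD('n)) \<le> (\<Sum>j\<in>UNIV - {i}. d j)"
    using * by (intro sum_mono less_imp_le)
  moreover have "(\<Sum>j\<in>UNIV. d j) = d i + (\<Sum>j\<in>UNIV - {i}. d j)" by (simp add: sum.remove)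
  moreover have "(\<Sum>j\<in>UNIV - {i}. - d i / real CARD('n)) = d i / real CARD('n) - d i"
    by (simp add: card_Diff_singleton of_nat_diff field_simps)
  ultimately have "d i / real CARD('n) \<le> 0" using assms(1) by linarith
  then have "d i = 0" using N assms(2) by (simp add: divide_le_0_iff)
  then show False using *[of i] by simp
qed

text \<open>Clipping at \<open>qmin\<close> or \<open>qmax\<close> shrinks a difference across \<open>m \<in> {qmin..qmax}\<close> by at most a constant
  factor: if both points are cut off, the whole range \<open>qmax - qmin\<close> remains, and this is
  comparable to \<open>e\<close> because \<open>e \<le> R\<close>.\<close>

lemma clip_gap_above:
  assumes "qmin < qmax" "qmin \<le> m" "m \<le> qmax" "e \<ge> 0" "e \<le> R" "R > 0" "N \<ge> 1"
    and "t = m + e" "s \<le> m - e / N"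
  shows "clip qmin qmax t - clip qmin qmax s \<ge> min (1 / N) ((qmax - qmin) / R) * e"
proof -
  let ?c = "min (1 / N) ((qmax - qmin) / R)"
  have c1: "?c * e \<le> e / N" using mult_right_mono[of ?c "1 / N" e] assms by simp
  have c2: "?c * e \<le> qmax - qmin"
  proof -
    have "?c * e \<le> (qmax - qmin) / R * e" using assms by (intro mult_right_mono) auto
    also have "\<dots> \<le> (qmax - qmin) / R * R" using assms by (intro mult_left_mono) auto
    finally show ?thesis using assms by simp
  qed
  have "e / N \<le> e / 1" using assms by (intro divide_left_mono) auto
  then have eN: "e / N \<le> e" "0 \<le> e / N" using assms by auto
  show ?thesis using c1 c2 eN assms unfolding clip_def by (auto simp: min_def max_def)
qed

lemma clip_gap_below:
  assumes "qmin < qmax" "qmin \<le> m" "m \<le> qmax" "e \<ge> 0" "e \<le> R" "R > 0" "N \<ge> 1"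
    and "t = m - e" "s \<ge> m + e / N"
  shows "clip qmin qmax s - clip qmin qmax t \<ge> min (1 / N) ((qmax - qmin) / R) * e"
proof -
  have "clip qmin qmax z = - clip (-qmax) (-qmin) (-z)" for z
    using assms(1) unfolding clip_def by (auto simp: min_def max_def)
  then show ?thesis
    using clip_gap_above[of "-qmax" "-qmin" "-m" e R N "-t" "-s"] assms by simp
qed

text \<open>A node that deviates by \<open>e\<close> from the mean has a counterpart deviating by at least \<open>e/N\<close> in the
  other direction, and the clipped values of the two still differ by a multiple of \<open>e\<close>.\<close>

lemma sq_dev_le_clipped_energy:
  fixes E :: "('n::finite \<times> 'n) set"
  assumes "strongly_connected_digraph E" "qmin < qmax" "R > 0"
  shows "\<exists>c>0. \<forall>(y :: real^'n) m. vec_mean y = m \<longrightarrow> m \<in> {qmin..qmax} \<longrightarrow> (\<forall>i. \<bar>y $ i - m\<bar> \<le> R) \<longrightarrow>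
    c * (norm (y - vec m))\<^sup>2 \<le> edge_energy E (\<lambda>i. clip qmin qmax (y $ i))"
proof -
  obtain C where C: "C > 0" "\<And>v p q. (v p - v q)\<^sup>2 \<le> C * edge_energy E v"
    using difference_le_edge_energy[OF assms(1)] by blast
  define N where "N = real CARD('n)"
  have "0 < CARD('n)" by simp
  then have N: "N \<ge> 1" unfolding N_def by linarith
  define \<kappa> where "\<kappa> = min (1 / N) ((qmax - qmin) / R)"
  have \<kappa>: "\<kappa> > 0" unfolding \<kappa>_def using assms N by simp
  have "\<kappa>\<^sup>2 / (N * C) * (norm (y - vec m))\<^sup>2 \<le> edge_energy E (\<lambda>i. clip qmin qmax (y $ i))"
    if mean: "vec_mean y = m" and m: "m \<in> {qmin..qmax}" and R: "\<And>i. \<bar>y $ i - m\<bar> \<le> R"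
    for y :: "real^'n" and m
  proof -
    let ?c = "\<lambda>i. clip qmin qmax (y $ i)"
    have sum0: "(\<Sum>i\<in>UNIV. y $ i - m) = 0"
      using mean unfolding vec_mean_def by (simp add: sum_subtractf field_simps)
    have each: "(\<kappa> * (y $ i - m))\<^sup>2 \<le> C * edge_energy E ?c" for i
    proof (cases "y $ i - m \<ge> 0")
      case True
      obtain j where j: "y $ j - m \<le> - (y $ i - m) / N"
        using opposite_deviation[of "\<lambda>i. y $ i - m", OF sum0 True] unfolding N_def by blast
      then have j': "y $ j \<le> m - (y $ i - m) / N" by (simp add: diff_divide_distrib)
      have "\<kappa> * (y $ i - m) \<le> ?c i - ?c j" unfolding \<kappa>_def
        by (rule clip_gap_above[where m = m]) (use True j' R[of i] m N assms in auto)
      then have "(\<kappa> * (y $ i - m))\<^sup>2 \<le> (?c i - ?c j)\<^sup>2" using True \<kappa> by (intro power_mono) auto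
      then show ?thesis using C(2)[where v = ?c and p = i and q = j] by linarith
    next
      case False
      have "(\<Sum>i\<in>UNIV. - (y $ i - m)) = 0" using sum0 by (simp only: sum_negf)
      then obtain j where j: "- (y $ j - m) \<le> - (- (y $ i - m)) / N"
        using opposite_deviation[of "\<lambda>i. - (y $ i - m)" i] False unfolding N_def by fastforce
      have "\<kappa> * (m - y $ i) \<le> ?c j - ?c i" unfolding \<kappa>_def
        by (rule clip_gap_below[where m = m]) (use False j R[of i] m N assms in \<open>auto simp: diff_divide_distrib\<close>)
      then have "(\<kappa> * (m - y $ i))\<^sup>2 \<le> (?c j - ?c i)\<^sup>2" using False \<kappa> by (intro power_mono) auto
      moreover have "(\<kappa> * (m - y $ i))\<^sup>2 = (\<kappa> * (y $ i - m))\<^sup>2"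
        by (simp add: power_mult_distrib power2_commute)
      ultimately show ?thesis using C(2)[where v = ?c and p = j and q = i] by linarith
    qed
    have "\<kappa>\<^sup>2 * (norm (y - vec m))\<^sup>2 = (\<Sum>i\<in>UNIV. (\<kappa> * (y $ i - m))\<^sup>2)"
      by (simp add: norm_vec_def L2_set_def real_sqrt_pow2 sum_nonneg sum_distrib_left power_mult_distrib)
    also have "\<dots> \<le> (\<Sum>i\<in>(UNIV::'n set). C * edge_energy E ?c)" by (intro sum_mono each)
    also have "\<dots> = N * C * edge_energy E ?c" unfolding N_def by simp
    finally show ?thesis using N C(1) by (simp add: pos_divide_le_eq mult.commute)
  qed
  moreover have "\<kappa>\<^sup>2 / (N * C) > 0" using \<kappa> N C by simp
  ultimately show ?thesis by blast
qed

text \<open>The left-hand side grows only linearly in \<open>y\<close>, the squared error quadratically; this is why the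
  constants depend on the bound \<open>R\<close>.\<close>

theorem clipped_laplacian_coercive:
  fixes E :: "('n::finite \<times> 'n) set"
  assumes "strongly_connected_digraph E" "qmin < qmax" "R > 0" "a > 0"
  shows "\<exists>\<xi>1>0. \<exists>\<xi>2>0. \<forall>u (y :: real^'n) m. (\<forall>i. a \<le> u i) \<longrightarrow>
    vec_mean y = m \<longrightarrow> m \<in> {qmin..qmax} \<longrightarrow> (\<forall>i. \<bar>y $ i - m\<bar> \<le> R) \<longrightarrow>
    y \<bullet> (out_laplacian E (edge_matrix E u) *v clip_vec qmin qmax y) \<ge>
      \<xi>1 * (norm (y - vec m))\<^sup>2 - \<xi>2 * (\<Sum>i\<in>UNIV. \<bar>node_imbalance E u i\<bar>)"
proof -
  obtain c where c: "c > 0" "\<And>(y :: real^'n) m. vec_mean y = m \<Longrightarrow> m \<in> {qmin..qmax} \<Longrightarrow>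
    (\<forall>i. \<bar>y $ i - m\<bar> \<le> R) \<Longrightarrow>
    c * (norm (y - vec m))\<^sup>2 \<le> edge_energy E (\<lambda>i. clip qmin qmax (y $ i))"
    using sq_dev_le_clipped_energy[OF assms(1-3)] by blast
  define Q where "Q = max \<bar>qmin\<bar> \<bar>qmax\<bar>"
  define Fm where "Fm = Q * (Q + R) + Q\<^sup>2 + 1"
  have Q: "Q \<ge> 0" unfolding Q_def by simp
  have clipQ: "\<bar>clip qmin qmax t\<bar> \<le> Q" for t using assms(2) unfolding clip_def Q_def by auto
  have main: "y \<bullet> (out_laplacian E (edge_matrix E u) *v clip_vec qmin qmax y) \<ge>
      a / 2 * c * (norm (y - vec m))\<^sup>2 - Fm * (\<Sum>i\<in>UNIV. \<bar>node_imbalance E u i\<bar>)"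
    if u: "\<And>i. a \<le> u i" and mean: "vec_mean y = m" "m \<in> {qmin..qmax}"
      and R: "\<forall>i. \<bar>y $ i - m\<bar> \<le> R" for u and y :: "real^'n" and m
  proof -
    have F: "\<bar>clip_potential qmin qmax (y $ i)\<bar> \<le> Fm" for i
    proof -
      have m: "\<bar>m\<bar> \<le> Q" using mean(2) unfolding Q_def by auto
      have "\<bar>y $ i\<bar> \<le> \<bar>m\<bar> + \<bar>y $ i - m\<bar>" by arith
      then have y: "\<bar>y $ i\<bar> \<le> Q + R" using m R[rule_format, of i] by linarith
      have "\<bar>clip qmin qmax (y $ i) * y $ i\<bar> \<le> Q * (Q + R)"
        unfolding abs_mult using y clipQ Q by (intro mult_mono) auto
      moreover have "(clip qmin qmax (y $ i))\<^sup>2 \<le> Q\<^sup>2"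
        using clipQ Q by (simp add: abs_le_square_iff[symmetric])
      ultimately have "clip_potential qmin qmax (y $ i) \<le> Fm" "- clip_potential qmin qmax (y $ i) \<le> Fm"
        unfolding clip_potential_def Fm_def
        using zero_le_power2[of "clip qmin qmax (y $ i)"] zero_le_power2[of Q] by linarith+
      then show ?thesis by (simp add: abs_le_iff)
    qed
    have "y \<bullet> (out_laplacian E (edge_matrix E u) *v clip_vec qmin qmax y) \<ge>
      a / 2 * edge_energy E (\<lambda>i. clip qmin qmax (y $ i)) - Fm * (\<Sum>i\<in>UNIV. \<bar>node_imbalance E u i\<bar>)"
      by (rule clipped_form_ge_edge_energy) (use assms u F in auto)
    moreover have "a / 2 * (c * (norm (y - vec m))\<^sup>2) \<le> a / 2 * edge_energy E (\<lambda>i. clip qmin qmax (y $ i))"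
      using c(2)[OF mean R] assms by (intro mult_left_mono) auto
    ultimately show ?thesis by simp
  qed
  have "a / 2 * c > 0" using assms c by simp
  moreover have "Fm > 0" unfolding Fm_def using Q assms(3)
    by (intro add_nonneg_pos add_nonneg_nonneg mult_nonneg_nonneg) auto
  ultimately show ?thesis using main by blast
qed


section \<open>The random quantizer\<close>

definition quant_grid :: "real \<Rightarrow> real \<Rightarrow> nat \<Rightarrow> real set" where
  "quant_grid qmin qmax B = (\<lambda>l. qmin + real l * quant_step qmin qmax B) ` {..2 ^ B - 1}"

context
  fixes qmin qmax :: real and B :: nat
  assumes q: "qmin < qmax" and B: "B > 0"
begin

lemma pow_minus_1_pos: "(2::real) ^ B - 1 > 0"
  using one_less_power[of "2::real" B] B by simp

lemma quant_step_pos: "quant_step qmin qmax B > 0"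
  using q pow_minus_1_pos unfolding quant_step_def by simp

lemma top_level: "qmin + (2 ^ B - 1) * quant_step qmin qmax B = qmax"
  using pow_minus_1_pos unfolding quant_step_def by simp

lemma quant_level_eq: "qmin + quant_level qmin qmax B t * quant_step qmin qmax B = clip qmin qmax t"
  using quant_step_pos unfolding quant_level_def by simp

lemma quant_level_bounds: "0 \<le> quant_level qmin qmax B t" "quant_level qmin qmax B t \<le> 2 ^ B - 1"
proof -
  have c: "qmin \<le> clip qmin qmax t" "clip qmin qmax t \<le> qmax" using q by (auto simp: clip_def)
  show "0 \<le> quant_level qmin qmax B t"
    unfolding quant_level_def using c quant_step_pos by simp
  have "clip qmin qmax t - qmin \<le> (2 ^ B - 1) * quant_step qmin qmax B" using c top_level by linarith
  then show "quant_level qmin qmax B t \<le> 2 ^ B - 1"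
    unfolding quant_level_def using quant_step_pos by (simp add: pos_divide_le_eq)
qed

lemma grid_point:
  assumes "0 \<le> z" "z \<le> 2 ^ B - 1"
  shows "qmin + real_of_int z * quant_step qmin qmax B \<in> quant_grid qmin qmax B"
proof -
  have "nat z \<le> 2 ^ B - 1" using assms by (simp add: nat_le_iff of_nat_diff)
  then show ?thesis unfolding quant_grid_def using assms(1) by (intro image_eqI[of _ _ "nat z"]) auto
qed

lemma quant_values_in_grid:
  "quant_up qmin qmax B t \<in> quant_grid qmin qmax B" "quant_down qmin qmax B t \<in> quant_grid qmin qmax B"
proof -
  have "real_of_int (2 ^ B - 1) = 2 ^ B - 1" by simp
  then have le: "quant_level qmin qmax B t \<le> real_of_int (2 ^ B - 1)" using quant_level_bounds(2)[of t] by simp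
  then have "\<lceil>quant_level qmin qmax B t\<rceil> \<le> 2 ^ B - 1" by (simp only: ceiling_le_iff)
  moreover have "\<lfloor>quant_level qmin qmax B t\<rfloor> \<le> \<lceil>quant_level qmin qmax B t\<rceil>"
    by (rule floor_le_ceiling)
  moreover have "0 \<le> \<lfloor>quant_level qmin qmax B t\<rfloor>" using quant_level_bounds(1) by simp
  ultimately show "quant_up qmin qmax B t \<in> quant_grid qmin qmax B"
    "quant_down qmin qmax B t \<in> quant_grid qmin qmax B"
    unfolding quant_up_def quant_down_def by (intro grid_point; linarith)+
qed

lemma quant_grid_subset: "quant_grid qmin qmax B \<subseteq> {qmin..qmax}"
proof -
  have "real l * quant_step qmin qmax B \<le> qmax - qmin" if "l \<le> 2 ^ B - 1" for l
  proof -
    have "l + 1 \<le> 2 ^ B" using that by (subst (asm) le_diff_conv2) auto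
    then have "real (l + 1) \<le> real (2 ^ B)" by (simp only: of_nat_le_iff)
    then have "real l \<le> 2 ^ B - 1" by simp
    then have "real l * quant_step qmin qmax B \<le> (2 ^ B - 1) * quant_step qmin qmax B"
      using quant_step_pos by (intro mult_right_mono) auto
    then show ?thesis using top_level by linarith
  qed
  then show ?thesis unfolding quant_grid_def using quant_step_pos by (auto simp: add.commute le_diff_eq)
qed

lemma quant_mean:
  "quant_prob qmin qmax B t * quant_up qmin qmax B t +
    (1 - quant_prob qmin qmax B t) * quant_down qmin qmax B t = clip qmin qmax t"
proof -
  let ?l = "quant_level qmin qmax B t"
  have "quant_prob qmin qmax B t * real_of_int \<lceil>?l\<rceil> + (1 - quant_prob qmin qmax B t) * real_of_int \<lfloor>?l\<rfloor> = ?l"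
  proof (cases "?l \<in> \<int>")
    case True
    then show ?thesis by (auto simp: quant_prob_def elim!: Ints_cases)
  next
    case False
    then have "\<lceil>?l\<rceil> = \<lfloor>?l\<rfloor> + 1" by (simp add: ceiling_altdef) (metis Ints_of_int)
    then show ?thesis unfolding quant_prob_def by (simp add: algebra_simps)
  qed
  moreover have "p * (m + c * s) + (1 - p) * (m + f * s) = m + (p * c + (1 - p) * f) * s" for p m c f s :: real
    by (simp add: algebra_simps)
  ultimately show ?thesis unfolding quant_up_def quant_down_def by (simp add: quant_level_eq)
qed

lemma quant_saturated_top:
  assumes "t \<ge> qmax"
  shows "quant_prob qmin qmax B t = 0" "quant_down qmin qmax B t = qmax"
proof -
  have "clip qmin qmax t = qmax" using assms q by (simp add: clip_def)
  then have "quant_level qmin qmax B t * quant_step qmin qmax B = (2 ^ B - 1) * quant_step qmin qmax B"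
    using quant_level_eq[of t] top_level by linarith
  then have l: "quant_level qmin qmax B t = real_of_int (2 ^ B - 1)" using quant_step_pos by simp
  show "quant_prob qmin qmax B t = 0" unfolding quant_prob_def l by (simp only: floor_of_int diff_self)
  show "quant_down qmin qmax B t = qmax"
    unfolding quant_down_def l floor_of_int using top_level by simp
qed

lemma quant_saturated_bot:
  assumes "t \<le> qmin"
  shows "quant_prob qmin qmax B t = 0" "quant_down qmin qmax B t = qmin"
proof -
  have "clip qmin qmax t = qmin" using assms q by (simp add: clip_def)
  then have l: "quant_level qmin qmax B t = 0" by (simp add: quant_level_def)
  show "quant_prob qmin qmax B t = 0" "quant_down qmin qmax B t = qmin"
    unfolding quant_prob_def quant_down_def l by simp_all
qed

end

lemma finite_quant_grid [simp]: "finite (quant_grid qmin qmax B)"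
  by (simp add: quant_grid_def)


section \<open>Consequences of a conditional two-point law\<close>

text \<open>The value \<open>u\<close> has conditional probability \<open>p\<close> and \<open>d\<close> has \<open>1 - p\<close>, stated through Borel sets
  so that \<open>u = d\<close> is covered.\<close>

locale two_point_law = prob_space M + finite_measure_subalgebra M H for M H :: "'w measure" +
  fixes X p u d :: "'w \<Rightarrow> real"
  assumes X_measurable [measurable]: "X \<in> borel_measurable M"
    and law: "\<And>S. S \<in> sets borel \<Longrightarrow> AE \<omega> in M. real_cond_exp M H (\<lambda>\<omega>. indicator S (X \<omega>)) \<omega> =
      p \<omega> * indicator S (u \<omega>) + (1 - p \<omega>) * indicator S (d \<omega>)"
begin

text \<open>On an event of the conditioning \<open>\<sigma>\<close>-algebra that forces the law into \<open>S\<close>, the expected mass outside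
  \<open>S\<close> vanishes.\<close>

lemma law_support:
  assumes S [measurable]: "S \<in> sets borel" and Q: "{\<omega> \<in> space M. Q \<omega>} \<in> sets H"
    and sure: "\<And>\<omega>. \<omega> \<in> space M \<Longrightarrow> Q \<omega> \<Longrightarrow> p \<omega> * indicator S (u \<omega>) + (1 - p \<omega>) * indicator S (d \<omega>) = (1::real)"
  shows "AE \<omega> in M. Q \<omega> \<longrightarrow> X \<omega> \<in> S"
proof -
  let ?A = "{\<omega> \<in> space M. Q \<omega>}"
  have A [measurable]: "?A \<in> sets M" using Q subalg by (auto simp: subalgebra_def)
  have intA: "integrable M (indicator ?A :: 'w \<Rightarrow> real)"
    by (rule integrable_const_bound[of _ 1]) (auto simp: indicator_def)
  have int: "integrable M (\<lambda>\<omega>. indicator ?A \<omega> * (indicator S (X \<omega>) :: real))"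
    by (rule integrable_const_bound[of _ 1]) (auto simp: indicator_def)
  have "(\<integral>\<omega>. indicator ?A \<omega> * indicator S (X \<omega>) \<partial>M) =
      (\<integral>\<omega>. indicator ?A \<omega> * real_cond_exp M H (\<lambda>\<omega>. indicator S (X \<omega>)) \<omega> \<partial>M)"
    by (rule real_cond_exp_intg(2)[symmetric, OF int]) (use Q in auto)
  also have "\<dots> = (\<integral>\<omega>. indicator ?A \<omega> \<partial>M)"
    by (rule integral_cong_AE) (use law[OF S] sure in \<open>auto simp: indicator_def split: if_splits\<close>)
  finally have "(\<integral>\<omega>. indicator ?A \<omega> - indicator ?A \<omega> * indicator S (X \<omega>) \<partial>M) = (0::real)"
    using int intA by (subst Bochner_Integration.integral_diff) auto
  then have "AE \<omega> in M. indicator ?A \<omega> - indicator ?A \<omega> * indicator S (X \<omega>) = (0::real)"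
    by (subst (asm) integral_nonneg_eq_0_iff_AE[OF Bochner_Integration.integrable_diff[OF intA int]])
      (auto simp: indicator_def)
  then show ?thesis by (rule AE_mp) (auto simp: indicator_def split: if_splits)
qed

text \<open>As \<open>X\<close> takes almost surely finitely many values, it is a linear combination of indicators, to which
  the law applies one at a time.\<close>

lemma law_mean:
  assumes G: "finite G" "\<And>\<omega>. \<omega> \<in> space M \<Longrightarrow> u \<omega> \<in> G" "\<And>\<omega>. \<omega> \<in> space M \<Longrightarrow> d \<omega> \<in> G"
    and m: "\<And>\<omega>. \<omega> \<in> space M \<Longrightarrow> p \<omega> * u \<omega> + (1 - p \<omega>) * d \<omega> = m \<omega>"
    and m_meas [measurable]: "m \<in> borel_measurable M"
    and Z: "Z \<in> borel_measurable H" "AE \<omega> in M. \<bar>Z \<omega>\<bar> \<le> c"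
  shows "(\<integral>\<omega>. Z \<omega> * X \<omega> \<partial>M) = (\<integral>\<omega>. Z \<omega> * m \<omega> \<partial>M)"
proof -
  have [measurable]: "Z \<in> borel_measurable M" using Z(1) subalg by (rule measurable_from_subalg[rotated])
  have "AE \<omega> in M. True \<longrightarrow> X \<omega> \<in> G"
  proof (rule law_support)
    show "G \<in> sets borel" using G(1) by (simp add: borel_closed finite_imp_closed)
    have "space H = space M" using subalg by (simp add: subalgebra_def)
    then show "{\<omega> \<in> space M. True} \<in> sets H" by (metis Collect_mem_eq sets.top simp_thms(21))
  qed (use G in \<open>auto simp: indicator_def\<close>)
  then have XG: "AE \<omega> in M. X \<omega> \<in> G" by simp
  let ?e = "\<lambda>g. real_cond_exp M H (\<lambda>\<omega>. indicator {g} (X \<omega>))"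
  have int: "integrable M (\<lambda>\<omega>. Z \<omega> * (indicator {g} (X \<omega>) :: real))" for g
    by (rule integrable_const_bound[of _ "\<bar>c\<bar>"]) (use Z(2) in \<open>auto simp: indicator_def elim!: AE_mp\<close>)
  have e: "integrable M (\<lambda>\<omega>. Z \<omega> * ?e g \<omega>)"
      "(\<integral>\<omega>. Z \<omega> * ?e g \<omega> \<partial>M) = (\<integral>\<omega>. Z \<omega> * indicator {g} (X \<omega>) \<partial>M)" for g
    by (rule real_cond_exp_intg[OF int Z(1)]; simp)+
  have "(\<integral>\<omega>. Z \<omega> * X \<omega> \<partial>M) = (\<integral>\<omega>. (\<Sum>g\<in>G. g * (Z \<omega> * indicator {g} (X \<omega>))) \<partial>M)"
  proof (rule integral_cong_AE)
    show "AE \<omega> in M. Z \<omega> * X \<omega> = (\<Sum>g\<in>G. g * (Z \<omega> * indicator {g} (X \<omega>)))"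
      using XG
    proof eventually_elim
      case (elim \<omega>)
      have "(\<Sum>g\<in>G. g * (Z \<omega> * indicator {g} (X \<omega>))) = (\<Sum>g\<in>G. if g = X \<omega> then g * Z \<omega> else 0)"
        by (intro sum.cong) (auto simp: indicator_def)
      then show ?case using G(1) elim by (simp add: mult.commute)
    qed
  qed measurable
  also have "\<dots> = (\<Sum>g\<in>G. g * (\<integral>\<omega>. Z \<omega> * indicator {g} (X \<omega>) \<partial>M))"
    using int by (subst Bochner_Integration.integral_sum) auto
  also have "\<dots> = (\<Sum>g\<in>G. g * (\<integral>\<omega>. Z \<omega> * ?e g \<omega> \<partial>M))" by (simp only: e)
  also have "\<dots> = (\<integral>\<omega>. (\<Sum>g\<in>G. g * (Z \<omega> * ?e g \<omega>)) \<partial>M)"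
    using e by (subst Bochner_Integration.integral_sum) auto
  also have "\<dots> = (\<integral>\<omega>. Z \<omega> * m \<omega> \<partial>M)"
  proof (rule integral_cong_AE)
    have "AE \<omega> in M. \<forall>g\<in>G. ?e g \<omega> = p \<omega> * indicator {g} (u \<omega>) + (1 - p \<omega>) * indicator {g} (d \<omega>)"
      using G(1) law by (subst AE_finite_all) auto
    then show "AE \<omega> in M. (\<Sum>g\<in>G. g * (Z \<omega> * ?e g \<omega>)) = Z \<omega> * m \<omega>"
      using AE_space
    proof eventually_elim
      case (elim \<omega>)
      have "(\<Sum>g\<in>G. g * (Z \<omega> * ?e g \<omega>)) =
        (\<Sum>g\<in>G. (if g = u \<omega> then g * p \<omega> * Z \<omega> else 0) + (if g = d \<omega> then g * (1 - p \<omega>) * Z \<omega> else 0))"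
      proof (intro sum.cong refl)
        fix g assume "g \<in> G"
        then have "?e g \<omega> = p \<omega> * indicator {g} (u \<omega>) + (1 - p \<omega>) * indicator {g} (d \<omega>)"
          using elim(1) by blast
        then show "g * (Z \<omega> * ?e g \<omega>) =
          (if g = u \<omega> then g * p \<omega> * Z \<omega> else 0) + (if g = d \<omega> then g * (1 - p \<omega>) * Z \<omega> else 0)"
          by (simp only:) (auto simp: indicator_def algebra_simps)
      qed
      also have "\<dots> = Z \<omega> * (p \<omega> * u \<omega> + (1 - p \<omega>) * d \<omega>)"
        using G elim by (simp add: sum.distrib algebra_simps)
      finally show ?case using m[OF elim(2)] by simp
    qed
  qed measurable
  finally show ?thesis .
qed

end

lemma measurable_history:
  fixes y :: "nat \<Rightarrow> 'w \<Rightarrow> real^'n::finite"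
  assumes "j \<le> k"
  shows "y j \<in> borel_measurable (history M y k)"
proof (rule measurableI)
  show "y j x \<in> space borel" for x by simp
  fix S :: "(real^'n) set" assume "S \<in> sets borel"
  then have "y j -` S \<inter> space M \<in> {y j -` S \<inter> space M | j S. j \<le> k \<and> S \<in> sets borel}" using assms by blast
  moreover have "space (history M y k) = space M" unfolding history_def by (rule space_measure_of) auto
  ultimately show "y j -` S \<inter> space (history M y k) \<in> sets (history M y k)"
    unfolding history_def by (subst sets_measure_of) (auto intro: sigma_sets.Basic)
qed

lemma history_subalgebra:
  fixes y :: "nat \<Rightarrow> 'w \<Rightarrow> real^'n::finite"
  assumes "\<And>j. y j \<in> borel_measurable M"
  shows "subalgebra M (history M y k)"
proof -
  have "space (history M y k) = space M" unfolding history_def by (rule space_measure_of) auto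
  moreover have "sets (history M y k) \<subseteq> sets M"
    unfolding history_def using assms
    by (subst sets_measure_of) (auto intro!: sets.sigma_sets_subset measurable_sets)
  ultimately show ?thesis by (simp add: subalgebra_def)
qed

section \<open>Nonnegative supermartingales with vanishing expectation\<close>

text \<open>The process \<open>Z\<close> is \<open>U\<close> until the first time in \<open>{n..}\<close> at which \<open>U \<ge> \<epsilon>\<close>, and the constant \<open>\<epsilon>\<close>
  from then on. Its expectation is nonincreasing, since passing from \<open>U\<close> to \<open>\<epsilon>\<close> only lowers it, and
  it dominates \<open>\<epsilon>\<close> times the probability of having stopped.\<close>

lemma supermartingale_maximal_inequality:
  fixes U :: "nat \<Rightarrow> 'w \<Rightarrow> real"
  assumes "prob_space M" and sub: "\<And>m. subalgebra M (H m)"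
    and adapted: "\<And>j m. j \<le> m \<Longrightarrow> U j \<in> borel_measurable (H m)"
    and nonneg: "\<And>j \<omega>. \<omega> \<in> space M \<Longrightarrow> U j \<omega> \<ge> 0" and int: "\<And>j. integrable M (U j)"
    and super: "\<And>m A. A \<in> sets (H m) \<Longrightarrow>
      (\<integral>\<omega>. indicator A \<omega> * U (Suc m) \<omega> \<partial>M) \<le> (\<integral>\<omega>. indicator A \<omega> * U m \<omega> \<partial>M)"
    and \<epsilon>: "\<epsilon> > 0" and "n \<le> m"
  shows "\<epsilon> * measure M {\<omega> \<in> space M. \<exists>j\<in>{n..m}. U j \<omega> \<ge> \<epsilon>} \<le> (\<integral>\<omega>. U n \<omega> \<partial>M)"
proof -
  interpret prob_space M by fact
  have [measurable]: "U j \<in> borel_measurable M" for j using int by auto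
  define A where "A m = {\<omega> \<in> space M. \<forall>j\<in>{n..m}. U j \<omega> < \<epsilon>}" for m
  have AH: "A m \<in> sets (H m)" for m
  proof -
    have sp: "space (H m) = space M" using sub by (simp add: subalgebra_def)
    have "{\<omega> \<in> space (H m). \<forall>j\<in>{n..m}. U j \<omega> < \<epsilon>} \<in> sets (H m)"
      by (intro sets.sets_Collect_finite_All borel_measurable_less adapted) auto
    then show ?thesis unfolding A_def sp .
  qed
  then have [measurable]: "A m \<in> sets M" for m using sub by (auto simp: subalgebra_def)
  define Z where "Z m \<omega> = (if \<omega> \<in> A m then U m \<omega> else \<epsilon>)" for m \<omega>
  have intA: "integrable M (\<lambda>\<omega>. indicator (A m) \<omega> * U j \<omega>)" for m j
    using integrable_real_mult_indicator[OF _ int[of j], of "A m"] by (simp add: mult.commute)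
  have Zeq: "Z m \<omega> = indicator (A m) \<omega> * U m \<omega> + \<epsilon> * indicator (space M - A m) \<omega>" if "\<omega> \<in> space M" for m \<omega>
    using that by (auto simp: Z_def indicator_def)
  have intC: "integrable M (\<lambda>\<omega>. \<epsilon> * indicator (space M - A m) \<omega>)" for m
    by (rule integrable_const_bound[of _ \<epsilon>]) (use \<epsilon> in \<open>auto simp: indicator_def\<close>)
  have intZ: "integrable M (Z m)" for m
    using Bochner_Integration.integrable_add[OF intA intC]
    by (subst Bochner_Integration.integrable_cong[OF refl Zeq]) auto
  have "(\<integral>\<omega>. Z m \<omega> \<partial>M) \<le> (\<integral>\<omega>. U n \<omega> \<partial>M)"
    using \<open>n \<le> m\<close>
  proof (induction rule: dec_induct)
    case base
    show ?case by (intro integral_mono intZ int) (auto simp: Z_def A_def)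
  next
    case (step m)
    have "(\<integral>\<omega>. Z (Suc m) \<omega> \<partial>M) \<le>
        (\<integral>\<omega>. indicator (A m) \<omega> * U (Suc m) \<omega> + \<epsilon> * indicator (space M - A m) \<omega> \<partial>M)"
    proof (intro integral_mono intZ)
      show "integrable M (\<lambda>\<omega>. indicator (A m) \<omega> * U (Suc m) \<omega> + \<epsilon> * indicator (space M - A m) \<omega>)"
        by (rule Bochner_Integration.integrable_add[OF intA intC])
      fix \<omega> assume "\<omega> \<in> space M"
      then show "Z (Suc m) \<omega> \<le> indicator (A m) \<omega> * U (Suc m) \<omega> + \<epsilon> * indicator (space M - A m) \<omega>"
        using step.hyps \<epsilon> by (auto simp: Z_def A_def indicator_def le_Suc_eq not_less)
    qed
    also have "\<dots> = (\<integral>\<omega>. indicator (A m) \<omega> * U (Suc m) \<omega> \<partial>M) + (\<integral>\<omega>. \<epsilon> * indicator (space M - A m) \<omega> \<partial>M)"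
      by (rule Bochner_Integration.integral_add[OF intA intC])
    also have "\<dots> \<le> (\<integral>\<omega>. indicator (A m) \<omega> * U m \<omega> \<partial>M) + (\<integral>\<omega>. \<epsilon> * indicator (space M - A m) \<omega> \<partial>M)"
      using super[OF AH] by simp
    also have "\<dots> = (\<integral>\<omega>. indicator (A m) \<omega> * U m \<omega> + \<epsilon> * indicator (space M - A m) \<omega> \<partial>M)"
      by (rule Bochner_Integration.integral_add[OF intA intC, symmetric])
    also have "\<dots> = (\<integral>\<omega>. Z m \<omega> \<partial>M)" by (intro Bochner_Integration.integral_cong refl Zeq[symmetric])
    finally show ?case using step.IH by linarith
  qed
  moreover have "\<epsilon> * measure M (space M - A m) \<le> (\<integral>\<omega>. Z m \<omega> \<partial>M)"
  proof -
    have "\<epsilon> * measure M (space M - A m) = (\<integral>\<omega>. \<epsilon> * indicator (space M - A m) \<omega> \<partial>M)" by simp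
    also have "\<dots> \<le> (\<integral>\<omega>. Z m \<omega> \<partial>M)"
      using nonneg by (intro integral_mono intZ intC) (auto simp: Z_def indicator_def)
    finally show ?thesis .
  qed
  moreover have "space M - A m = {\<omega> \<in> space M. \<exists>j\<in>{n..m}. U j \<omega> \<ge> \<epsilon>}"
    by (auto simp: A_def not_less)
  ultimately show ?thesis by simp
qed

text \<open>Letting the horizon grow, the probability that \<open>U\<close> ever reaches \<open>\<epsilon>\<close> after time \<open>n\<close> is at most
  \<open>E[U n] / \<epsilon>\<close>, which vanishes as \<open>n\<close> grows.\<close>

theorem supermartingale_AE_tendsto_zero:
  fixes U :: "nat \<Rightarrow> 'w \<Rightarrow> real"
  assumes "prob_space M" and sub: "\<And>m. subalgebra M (H m)"
    and adapted: "\<And>j m. j \<le> m \<Longrightarrow> U j \<in> borel_measurable (H m)"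
    and nonneg: "\<And>j \<omega>. \<omega> \<in> space M \<Longrightarrow> U j \<omega> \<ge> 0" and int: "\<And>j. integrable M (U j)"
    and super: "\<And>m A. A \<in> sets (H m) \<Longrightarrow>
      (\<integral>\<omega>. indicator A \<omega> * U (Suc m) \<omega> \<partial>M) \<le> (\<integral>\<omega>. indicator A \<omega> * U m \<omega> \<partial>M)"
    and lim: "(\<lambda>n. \<integral>\<omega>. U n \<omega> \<partial>M) \<longlonglongrightarrow> 0"
  shows "AE \<omega> in M. (\<lambda>n. U n \<omega>) \<longlonglongrightarrow> 0"
proof -
  interpret prob_space M by fact
  have [measurable]: "U j \<in> borel_measurable M" for j using int by auto
  have ev: "AE \<omega> in M. \<exists>n. \<forall>j\<ge>n. U j \<omega> < \<epsilon>" if \<epsilon>: "\<epsilon> > 0" for \<epsilon>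
  proof -
    define B where "B n = {\<omega> \<in> space M. \<exists>j\<ge>n. U j \<omega> \<ge> \<epsilon>}" for n
    have [measurable]: "B n \<in> sets M" for n unfolding B_def by measurable
    have Bn: "measure M (B n) \<le> (\<integral>\<omega>. U n \<omega> \<partial>M) / \<epsilon>" for n
    proof -
      define C where "C m = {\<omega> \<in> space M. \<exists>j\<in>{n..n + m}. U j \<omega> \<ge> \<epsilon>}" for m
      have [measurable]: "C m \<in> sets M" for m unfolding C_def by measurable
      have "incseq C" unfolding C_def by (intro incseq_SucI) (auto intro!: bexI)
      then have "(\<lambda>m. measure M (C m)) \<longlonglongrightarrow> measure M (\<Union>m. C m)"
        by (intro finite_Lim_measure_incseq) auto
      moreover have "(\<Union>m. C m) = B n"
      proof
        show "B n \<subseteq> (\<Union>m. C m)"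
        proof
          fix \<omega> assume "\<omega> \<in> B n"
          then obtain j where "j \<ge> n" "U j \<omega> \<ge> \<epsilon>" "\<omega> \<in> space M" unfolding B_def by auto
          then have "\<omega> \<in> C (j - n)" unfolding C_def by auto
          then show "\<omega> \<in> (\<Union>m. C m)" by blast
        qed
      qed (auto simp: B_def C_def)
      moreover have "measure M (C m) \<le> (\<integral>\<omega>. U n \<omega> \<partial>M) / \<epsilon>" for m
        using supermartingale_maximal_inequality[where U = U and H = H and M = M and n = n and m = "n + m",
            OF \<open>prob_space M\<close> sub adapted nonneg int super \<epsilon>]
          \<epsilon> unfolding C_def by (simp add: pos_le_divide_eq mult.commute)
      ultimately show ?thesis by (intro LIMSEQ_le_const2) auto
    qed
    have "measure M (\<Inter>n. B n) \<le> 0"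
    proof (rule LIMSEQ_le_const)
      show "(\<lambda>n. (\<integral>\<omega>. U n \<omega> \<partial>M) / \<epsilon>) \<longlonglongrightarrow> 0" using tendsto_divide[OF lim tendsto_const[of \<epsilon>]] \<epsilon> by simp
      have "measure M (\<Inter>n. B n) \<le> measure M (B n)" for n by (intro finite_measure_mono) auto
      then show "\<exists>N. \<forall>n\<ge>N. measure M (\<Inter>n. B n) \<le> (\<integral>\<omega>. U n \<omega> \<partial>M) / \<epsilon>"
        using Bn by (meson order_trans)
    qed
    then have "emeasure M (\<Inter>n. B n) = 0" by (simp add: emeasure_eq_measure measure_le_0_iff)
    then have "(\<Inter>n. B n) \<in> null_sets M" by (intro null_setsI) auto
    then show ?thesis
      by (rule AE_I') (auto simp: B_def not_less)
  qed
  have "AE \<omega> in M. \<forall>l. \<exists>n. \<forall>j\<ge>n. U j \<omega> < 1 / real (Suc l)"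
    unfolding AE_all_countable by (intro allI ev) simp
  then show ?thesis using AE_space
  proof eventually_elim
    case (elim \<omega>)
    show ?case
    proof (rule LIMSEQ_I)
      fix r :: real assume "r > 0"
      then obtain l where "1 / real (Suc l) < r" by (rule nat_approx_posE)
      moreover obtain n where "\<And>j. j \<ge> n \<Longrightarrow> U j \<omega> < 1 / real (Suc l)" using elim(1) by blast
      ultimately show "\<exists>n. \<forall>j\<ge>n. norm (U j \<omega> - 0) < r"
        using nonneg[OF elim(2)] by (intro exI[of _ n]) (auto intro: less_trans)
    qed
  qed
qed


section \<open>Perturbed contractions along a schedule\<close>

text \<open>Each window contains an active time, and \<open>\<alpha>\<close> at the end of the window is at most \<open>\<alpha>\<close> there; so
  \<open>\<alpha>\<close> is dominated by finitely many shifts of its active part.\<close>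

lemma summable_from_schedule:
  fixes \<alpha> :: "nat \<Rightarrow> real"
  assumes window: "\<And>k. \<exists>t\<in>{k..<k + L}. act t"
    and \<alpha>: "\<And>k. \<alpha> k \<ge> 0" "\<And>k. \<alpha> (Suc k) \<le> \<alpha> k"
    and summ: "summable (\<lambda>k. if act k then \<alpha> k else 0)"
  shows "summable \<alpha>"
proof -
  let ?g = "\<lambda>k. if act k then \<alpha> k else 0"
  have dec: "\<alpha> n \<le> \<alpha> m" if "m \<le> n" for m n
    using that \<alpha>(2) by (rule lift_Suc_antimono_le[rotated])
  have "summable (\<lambda>k. \<alpha> (k + L))"
  proof (rule summable_comparison_test'[where N = 0])
    show "summable (\<lambda>k. \<Sum>i<L. ?g (k + i))"
      using summable_ignore_initial_segment[OF summ] by (intro summable_sum) auto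
    fix k :: nat
    obtain t where t: "t \<in> {k..<k + L}" "act t" using window by blast
    have "\<alpha> (k + L) \<le> ?g (k + (t - k))" using t dec[of t "k + L"] by simp
    also have "\<dots> \<le> (\<Sum>i<L. ?g (k + i))"
      using t \<alpha>(1) by (intro member_le_sum[of "t - k" "{..<L}" "\<lambda>i. ?g (k + i)"]) auto
    finally show "norm (\<alpha> (k + L)) \<le> (\<Sum>i<L. ?g (k + i))" using \<alpha>(1) by simp
  qed
  then show ?thesis by (subst (asm) summable_iff_shift)
qed

text \<open>Minus the accumulated perturbations, \<open>V\<close> is nonincreasing, hence \<open>V\<close> converges. A positive limit
  would make the total decrease at least a multiple of the sum of \<open>\<alpha>\<close> over active times.\<close>

lemma perturbed_contraction_tendsto_zero:
  fixes V e \<alpha> :: "nat \<Rightarrow> real"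
  assumes window: "\<And>k. \<exists>t\<in>{k..<k + L}. act t"
    and \<alpha>: "\<And>k. \<alpha> k \<ge> 0" "\<And>k. \<alpha> (Suc k) \<le> \<alpha> k" "\<not> summable \<alpha>"
    and c: "c > 0" and e: "summable e" "\<And>k. e k \<ge> 0"
    and V: "\<And>k. V k \<ge> 0" "\<And>k. V (Suc k) \<le> V k + e k"
    and contr: "\<And>k. act k \<Longrightarrow> V (Suc k) \<le> (1 - c * \<alpha> k) * V k + e k"
  shows "V \<longlonglongrightarrow> 0"
proof -
  define T where "T k = V k - (\<Sum>j<k. e j)" for k
  have "decseq T" unfolding T_def using V(2) by (intro decseq_SucI) (simp add: algebra_simps)
  moreover have "- suminf e \<le> T k" for k
    using sum_le_suminf[OF e(1), of "{..<k}"] e(2) V(1)[of k] unfolding T_def by simp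
  ultimately obtain l where l: "T \<longlonglongrightarrow> l" using decseq_convergent by blast
  have "(\<lambda>k. T k + (\<Sum>j<k. e j)) \<longlonglongrightarrow> l + suminf e"
    using l summable_LIMSEQ[OF e(1)] by (rule tendsto_add)
  then have lim: "V \<longlonglongrightarrow> l + suminf e" unfolding T_def by simp
  have "l + suminf e = 0"
  proof (rule ccontr)
    define v where "v = l + suminf e"
    assume "l + suminf e \<noteq> 0"
    moreover have "v \<ge> 0" using lim V(1) unfolding v_def by (intro LIMSEQ_le_const) auto
    ultimately have v: "v > 0" unfolding v_def by simp
    have "summable (\<lambda>k. T k - T (Suc k))" by (rule telescope_summable'[OF l])
    then have s: "summable (\<lambda>k. (2 / (c * v)) * (T k - T (Suc k)))" by (rule summable_mult)
    have ev: "\<forall>\<^sub>F k in sequentially. V k > v / 2"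
      using lim v unfolding v_def[symmetric] by (intro order_tendstoD(1)) auto
    have "summable (\<lambda>k. if act k then \<alpha> k else 0)"
    proof (rule summable_comparison_test_ev[OF _ s])
      show "\<forall>\<^sub>F k in sequentially. norm (if act k then \<alpha> k else 0) \<le> (2 / (c * v)) * (T k - T (Suc k))"
        using ev
      proof eventually_elim
        case (elim k)
        have diff: "T k - T (Suc k) = V k - V (Suc k) + e k" unfolding T_def by simp
        show ?case
        proof (cases "act k")
          case True
          have "\<alpha> k * (c * v / 2) \<le> \<alpha> k * (c * V k)"
            using elim c \<alpha>(1)[of k] by (intro mult_left_mono) auto
          also have "\<dots> \<le> T k - T (Suc k)" using contr[OF True] unfolding diff by (simp add: algebra_simps)
          finally have "(2 / (c * v)) * (\<alpha> k * (c * v / 2)) \<le> (2 / (c * v)) * (T k - T (Suc k))"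
            using c v by (intro mult_left_mono) auto
          then show ?thesis using True c v \<alpha>(1)[of k] by simp
        next
          case False
          have "0 \<le> T k - T (Suc k)" using V(2)[of k] unfolding diff by simp
          then show ?thesis using False c v by simp
        qed
      qed
    qed
    from summable_from_schedule[OF window \<alpha>(1,2) this] \<alpha>(3) show False by simp
  qed
  then show ?thesis using lim by simp
qed

lemma one_minus_mult_le_powr:
  fixes x \<sigma> :: real
  assumes "x \<ge> 0" "\<sigma> \<ge> 0"
  shows "1 - \<sigma> * x \<le> (1 + x) powr (- \<sigma>)"
proof -
  have "\<sigma> * ln (1 + x) \<le> \<sigma> * x" using assms by (intro mult_left_mono ln_add_one_self_le_self) auto
  then have "1 - \<sigma> * x \<le> 1 + (- \<sigma>) * ln (1 + x)" by simp
  also have "\<dots> \<le> exp ((- \<sigma>) * ln (1 + x))" by (rule exp_ge_add_one_self)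
  also have "\<dots> = (1 + x) powr (- \<sigma>)" using assms by (simp add: powr_def)
  finally show ?thesis .
qed

text \<open>One window contracts by \<open>1 - 2 L \<sigma> / (k + L)\<close>, whereas \<open>(k + 1) powr -\<sigma>\<close> loses only the factor
  \<open>1 - L \<sigma> / (k + 1)\<close>. The surplus, about half of the contraction, absorbs the perturbation
  \<open>G / (k + 1)\<^sup>2\<close>, because \<open>\<sigma> \<le> 1\<close> makes \<open>(k + 1) powr -\<sigma>\<close> at least \<open>1 / (k + 1)\<close>.\<close>

lemma perturbed_contraction_rate:
  fixes V e \<alpha> :: "nat \<Rightarrow> real"
  assumes window: "\<And>k. \<exists>t\<in>{k..<k + L}. act t"
    and \<alpha>: "\<And>k. \<alpha> k \<ge> m / (real k + 1)"
    and \<sigma>: "0 < \<sigma>" "\<sigma> \<le> 1" "2 * real L * \<sigma> \<le> c * m" and c: "c > 0"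
    and e: "\<And>k. e k \<ge> 0" "\<forall>\<^sub>F k in sequentially. e k \<le> G / (real k + 1)\<^sup>2"
    and V: "\<And>k. V k \<ge> 0" "\<And>k. V (Suc k) \<le> V k + e k"
    and contr: "\<And>k. act k \<Longrightarrow> V (Suc k) \<le> (1 - c * \<alpha> k) * V k + e k"
  shows "\<exists>K. \<forall>\<^sub>F k in sequentially. V k \<le> K * (real k + 1) powr (- \<sigma>)"
proof -
  have L: "L > 0" using window[of 0] by auto
  obtain k1 where k1: "\<And>k. k \<ge> k1 \<Longrightarrow> e k \<le> G / (real k + 1)\<^sup>2"
    using e(2) by (auto simp: eventually_sequentially)
  have G: "G \<ge> 0"
    using order_trans[OF e(1) k1[of k1]] by (simp add: zero_le_divide_iff)
  have drift: "V (k + n) \<le> V k + (\<Sum>i<n. e (k + i))" for k n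
  proof (induction n)
    case (Suc n)
    then show ?case using V(2)[of "k + n"] by simp
  qed simp
  have step: "V (k + L) \<le> (1 - 2 * real L * \<sigma> / (real k + real L)) * V k + real L * G / (real k + 1)\<^sup>2"
    if k: "k \<ge> k1" "k \<ge> 2 * L" for k
  proof -
    obtain t where t: "k \<le> t" "t < k + L" "act t" using window[of k] by auto
    define a where "a = 1 - 2 * real L * \<sigma> / (real k + real L)"
    have "2 * real L * \<sigma> \<le> 2 * real L * 1" using \<sigma> by (intro mult_left_mono) auto
    also have "\<dots> \<le> real k + real L" using k by linarith
    finally have "2 * real L * \<sigma> / (real k + real L) \<le> 1" using L by (simp add: pos_divide_le_eq)
    then have a: "0 \<le> a" "a \<le> 1" unfolding a_def using \<sigma> by auto
    have "2 * real L * \<sigma> / (real k + real L) \<le> 2 * real L * \<sigma> / (real t + 1)"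
      using t \<sigma> by (intro divide_left_mono) auto
    also have "\<dots> \<le> c * m / (real t + 1)" using \<sigma>(3) by (intro divide_right_mono) auto
    also have "\<dots> \<le> c * \<alpha> t" using mult_left_mono[OF \<alpha>[of t], of c] c by simp
    finally have coef: "1 - c * \<alpha> t \<le> a" unfolding a_def by simp
    define S where "S = (\<Sum>i<t - k. e (k + i))"
    have S: "S \<ge> 0" unfolding S_def using e(1) by (intro sum_nonneg) auto
    have Vt: "V t \<le> V k + S" using drift[of k "t - k"] t unfolding S_def by simp
    have "V (Suc t) \<le> a * V t + e t"
      using contr[OF t(3)] mult_right_mono[OF coef V(1)[of t]] by linarith
    also have "\<dots> \<le> a * (V k + S) + e t" using Vt a by (simp add: mult_left_mono)
    also have "\<dots> \<le> a * V k + S + e t" using mult_right_mono[OF a(2) S] by (simp add: distrib_left)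
    finally have Vt1: "V (Suc t) \<le> a * V k + (\<Sum>i<Suc t - k. e (k + i))"
      using t unfolding S_def by (simp add: Suc_diff_le)
    have "V (k + L) \<le> V (Suc t) + (\<Sum>i<k + L - Suc t. e (Suc t + i))"
      using drift[of "Suc t" "k + L - Suc t"] t by simp
    also have "(\<Sum>i<k + L - Suc t. e (Suc t + i)) = (\<Sum>i=Suc t - k..<L. e (k + i))"
      using t by (intro sum.reindex_bij_witness[of _ "\<lambda>i. k + i - Suc t" "\<lambda>i. Suc t + i - k"]) auto
    finally have "V (k + L) \<le> a * V k + ((\<Sum>i<Suc t - k. e (k + i)) + (\<Sum>i=Suc t - k..<L. e (k + i)))"
      using Vt1 by linarith
    also have "(\<Sum>i<Suc t - k. e (k + i)) + (\<Sum>i=Suc t - k..<L. e (k + i)) = (\<Sum>i<L. e (k + i))"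
      unfolding lessThan_atLeast0 using t by (intro sum.atLeastLessThan_concat) auto
    also have "(\<Sum>i<L. e (k + i)) \<le> (\<Sum>i<L. G / (real k + 1)\<^sup>2)"
    proof (rule sum_mono)
      fix i
      have "e (k + i) \<le> G / (real (k + i) + 1)\<^sup>2" using k1[of "k + i"] k by simp
      also have "\<dots> \<le> G / (real k + 1)\<^sup>2" using G by (intro divide_left_mono power_mono) auto
      finally show "e (k + i) \<le> G / (real k + 1)\<^sup>2" .
    qed
    finally show ?thesis unfolding a_def by simp
  qed
  define k0 where "k0 = max k1 (3 * L)"
  define K where "K = 2 * G / \<sigma> + (\<Sum>k<k0 + L. V k * (real k + 1) powr \<sigma>)"
  have K1: "2 * G / \<sigma> \<le> K" unfolding K_def using V(1) by (simp add: sum_nonneg)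
  have K0: "K \<ge> 0" using K1 G \<sigma> by (meson divide_nonneg_pos mult_nonneg_nonneg order_trans zero_le_numeral)
  have bound: "V k \<le> K * (real k + 1) powr (- \<sigma>)" if "k \<ge> k0" for k
    using that
  proof (induction k rule: less_induct)
    case (less k)
    show ?case
    proof (cases "k < k0 + L")
      case True
      have "V k * (real k + 1) powr \<sigma> \<le> (\<Sum>k<k0 + L. V k * (real k + 1) powr \<sigma>)"
        using True V(1) by (intro member_le_sum[of k _ "\<lambda>k. V k * (real k + 1) powr \<sigma>"]) auto
      also have "\<dots> \<le> K" unfolding K_def using G \<sigma> by simp
      finally show ?thesis by (simp add: powr_minus_divide pos_le_divide_eq)
    next
      case False
      define j where "j = k - L"
      have j: "k = j + L" "j \<ge> k0" "j < k" using False L unfolding j_def by auto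
      then have j3: "j \<ge> k1" "j \<ge> 3 * L" unfolding k0_def by auto
      define P where "P = (real j + 1) powr (- \<sigma>)"
      define s where "s = real j + 1"
      have s: "s > 0" "s \<ge> 1" unfolding s_def by auto
      have P: "P \<ge> 1 / s"
      proof -
        have "s powr (- 1) \<le> s powr (- \<sigma>)" using s \<sigma> by (intro powr_mono) auto
        then show ?thesis unfolding P_def s_def[symmetric] using s by (simp add: powr_minus_divide)
      qed
      have P0: "P \<ge> 0" unfolding P_def by simp
      have IH: "V j \<le> K * P" using less.IH[of j] j unfolding P_def by simp
      have coef0: "0 \<le> 1 - 2 * real L * \<sigma> / (real j + real L)"
      proof -
        have "2 * real L * \<sigma> \<le> 2 * real L * 1" using \<sigma> by (intro mult_left_mono) auto
        also have "\<dots> \<le> real j + real L" using j3 by linarith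
        finally show ?thesis using L by (simp add: pos_divide_le_eq)
      qed
      have half: "2 * real L * \<sigma> / (real j + real L) \<ge> real L * \<sigma> * (3 / 2) / s"
      proof -
        have "real (3 * L) \<le> real j" using j3 by (simp only: of_nat_le_iff)
        then have "3 * (real j + real L) \<le> 4 * s" unfolding s_def by simp
        then have "(3 / 2) / s \<le> 2 / (real j + real L)" using s L by (simp add: field_simps)
        then have "real L * \<sigma> * ((3 / 2) / s) \<le> real L * \<sigma> * (2 / (real j + real L))"
          using \<sigma> by (intro mult_left_mono) auto
        then show ?thesis by (simp add: mult_ac)
      qed
      have gain: "real L * G / s\<^sup>2 \<le> K * P * (real L * \<sigma> / (2 * s))"
      proof -
        have "2 * G \<le> K * \<sigma>" using K1 \<sigma> by (simp add: pos_divide_le_eq)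
        then have "real L * (2 * G) / (2 * s\<^sup>2) \<le> real L * (K * \<sigma>) / (2 * s\<^sup>2)"
          by (intro divide_right_mono mult_left_mono) auto
        then have "real L * G / s\<^sup>2 \<le> K * (1 / s) * (real L * \<sigma> / (2 * s))"
          by (simp add: power2_eq_square mult_ac)
        also have "\<dots> \<le> K * P * (real L * \<sigma> / (2 * s))"
          using P K0 \<sigma> s by (intro mult_right_mono mult_left_mono) auto
        finally show ?thesis .
      qed
      have "V k \<le> (1 - 2 * real L * \<sigma> / (real j + real L)) * V j + real L * G / s\<^sup>2"
        using step[of j] j j3 unfolding s_def by simp
      also have "\<dots> \<le> (1 - 2 * real L * \<sigma> / (real j + real L)) * (K * P) + real L * G / s\<^sup>2"
        using mult_left_mono[OF IH coef0] by simp
      also have "\<dots> \<le> (1 - real L * \<sigma> * (3 / 2) / s) * (K * P) + real L * G / s\<^sup>2"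
        using half K0 P0 by (intro add_right_mono mult_right_mono) auto
      also have "\<dots> \<le> (1 - real L * \<sigma> * (3 / 2) / s) * (K * P) + K * P * (real L * \<sigma> / (2 * s))"
        using gain by simp
      also have "\<dots> = (1 - \<sigma> * (real L / s)) * (K * P)" using s by (simp add: field_simps)
      also have "\<dots> \<le> (1 + real L / s) powr (- \<sigma>) * (K * P)"
        using s \<sigma> K0 P0 by (intro mult_right_mono one_minus_mult_le_powr) auto
      also have "\<dots> = K * ((1 + real L / s) * s) powr (- \<sigma>)"
        unfolding P_def s_def[symmetric] using s by (simp add: powr_mult)
      also have "(1 + real L / s) * s = real k + 1" using s j(1) unfolding s_def by (simp add: field_simps)
      finally show ?thesis .
    qed
  qed
  then show ?thesis by (auto simp: eventually_sequentially)
qed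


section \<open>The quantized consensus iteration\<close>

text \<open>The consensus algorithm, with the outcome of the weight balancing (weights between \<open>wmin\<close> and
  \<open>wmax\<close>, imbalance at most \<open>Cb / (k + 1)\<close>) and the times \<open>act\<close> at which states are transmitted.\<close>

locale quantized_average_consensus =
  fixes E :: "('n::finite \<times> 'n) set"
    and Bw Bc :: "nat \<Rightarrow> 'n \<Rightarrow> nat"
    and \<gamma> \<alpha> :: "nat \<Rightarrow> real"
    and qmin qmax :: real
    and y0 :: "real^'n"
    and M :: "'w measure"
    and x y :: "nat \<Rightarrow> 'w \<Rightarrow> real^'n"
    and act :: "nat \<Rightarrow> bool" and L :: nat
    and wmin wmax Cb :: real
  assumes connected: "strongly_connected_digraph E"
    and qlt: "qmin < qmax" and mean_range: "vec_mean y0 \<in> {qmin..qmax}"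
    and steps: "consensus_steps \<alpha>"
    and algorithm: "quantized_consensus M E Bw \<gamma> Bc \<alpha> qmin qmax y0 x y"
    and act_window: "\<And>k. \<exists>t\<in>{k..<k + L}. act t"
    and act_bits: "\<And>k i. act k \<Longrightarrow> Bc k i > 0" "\<And>k i. \<not> act k \<Longrightarrow> Bc k i = 0"
    and wmin: "wmin > 0"
    and w_bounds: "\<And>k i. wmin \<le> node_weight E Bw \<gamma> k i" "\<And>k i. node_weight E Bw \<gamma> k i \<le> wmax"
    and Cb: "Cb > 0" "\<And>k i. \<bar>imbalance E Bw \<gamma> k i\<bar> \<le> Cb / real (k + 1)"
begin

sublocale prob_space M
  using algorithm by (simp add: quantized_consensus_def)

abbreviation lap :: "nat \<Rightarrow> real^'n^'n" where
  "lap k \<equiv> out_laplacian E (weight E Bw \<gamma> k)"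

abbreviation "ybar \<equiv> vec_mean y0"
abbreviation "w \<equiv> node_weight E Bw \<gamma>"
abbreviation "b \<equiv> imbalance E Bw \<gamma>"
abbreviation "H \<equiv> history M y"

lemma \<alpha>_pos: "\<alpha> k > 0" and \<alpha>_dec: "\<alpha> (Suc k) \<le> \<alpha> k"
  using steps by (auto simp: consensus_steps_def)

lemma \<alpha>_sq_summable: "summable (\<lambda>k. (\<alpha> k)\<^sup>2)"
  using steps summable_iff_shift[of "\<lambda>k. (\<alpha> k)\<^sup>2" 1] by (simp add: consensus_steps_def)

lemma \<alpha>_not_summable: "\<not> summable \<alpha>"
proof
  assume s: "summable \<alpha>"
  have le: "(\<Sum>k = 1..n. \<alpha> k) \<le> suminf \<alpha>" for n
    using sum_le_suminf[OF s, of "{1..n}"] \<alpha>_pos by (auto intro: less_imp_le)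
  have "\<forall>\<^sub>F n in sequentially. (\<Sum>k = 1..n. \<alpha> k) > suminf \<alpha>"
    using steps unfolding consensus_steps_def by (auto simp: filterlim_at_top_dense)
  then obtain n where "(\<Sum>k = 1..n. \<alpha> k) > suminf \<alpha>"
    using eventually_happens'[OF sequentially_bot] by blast
  then show False using le[of n] by linarith
qed

lemma \<alpha>_le_0: "\<alpha> k \<le> \<alpha> 0"
  using \<alpha>_dec by (rule lift_Suc_antimono_le) simp

text \<open>By the inequality of arithmetic and geometric means with the two square-summable factors.\<close>

lemma \<alpha>_harmonic_summable: "summable (\<lambda>k. \<alpha> k * (1 / real (k + 1)))"
proof (rule summable_comparison_test'[where N = 0])
  have "summable (\<lambda>k. 1 / (real k)\<^sup>2)" using inverse_power_summable[of 2, where 'a = real] by (simp add: divide_inverse)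
  then have "summable (\<lambda>k. 1 / (real (k + 1))\<^sup>2)" by (subst summable_iff_shift[of "\<lambda>k. 1 / (real k)\<^sup>2" 1])
  then show "summable (\<lambda>k. (\<alpha> k)\<^sup>2 + 1 / (real (k + 1))\<^sup>2)" by (intro summable_add \<alpha>_sq_summable)
  fix k :: nat
  have "2 * (\<alpha> k * (1 / real (k + 1))) \<le> (\<alpha> k)\<^sup>2 + (1 / real (k + 1))\<^sup>2"
    using zero_le_power2[of "\<alpha> k - 1 / real (k + 1)"] unfolding power2_diff by linarith
  moreover have "0 \<le> \<alpha> k * (1 / real (k + 1))" using \<alpha>_pos[of k] by simp
  ultimately show "norm (\<alpha> k * (1 / real (k + 1))) \<le> (\<alpha> k)\<^sup>2 + 1 / (real (k + 1))\<^sup>2"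
    by (simp add: power_one_over)
qed

lemma y_0: "\<omega> \<in> space M \<Longrightarrow> y 0 \<omega> = y0"
  using algorithm by (simp add: quantized_consensus_def)

lemma x_inactive: "\<omega> \<in> space M \<Longrightarrow> \<not> act k \<Longrightarrow> x k \<omega> $ i = 0"
  using algorithm act_bits(2) by (auto simp: quantized_consensus_def)

lemma y_update: "\<omega> \<in> space M \<Longrightarrow> y (Suc k) \<omega> $ i =
    y k \<omega> $ i + \<alpha> k * (b k i * x k \<omega> $ i + (\<Sum>j\<in>in_nbrs E i. w k j * (x k \<omega> $ j - x k \<omega> $ i)))"
  using algorithm unfolding quantized_consensus_def weight_eq_edge_matrix
  by (simp add: edge_matrix_def algebra_simps)

lemma lap_eq_increment:
  "(lap k *v v) $ i = - (b k i * v $ i + (\<Sum>j\<in>in_nbrs E i. w k j * (v $ j - v $ i)))"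
  unfolding weight_eq_edge_matrix out_laplacian_mult imbalance_eq_node_imbalance node_imbalance_def
  by (simp add: algebra_simps sum_subtractf sum_distrib_left)

lemma y_step: "\<omega> \<in> space M \<Longrightarrow> y (Suc k) \<omega> = y k \<omega> - \<alpha> k *\<^sub>R (lap k *v x k \<omega>)"
  by (simp add: vec_eq_iff y_update lap_eq_increment right_diff_distrib distrib_left)

lemma x_measurable [measurable]: "x k \<in> borel_measurable M"
  using algorithm by (simp add: quantized_consensus_def)

lemma y_measurable [measurable]: "y k \<in> borel_measurable M"
proof (induction k)
  case 0
  show ?case using y_0 by (subst measurable_cong[where g = "\<lambda>_. y0"]) auto
next
  case (Suc k)
  note [measurable] = Suc
  have "continuous_on UNIV (\<lambda>v. lap k *v v)"
    by (intro linear_continuous_on matrix_vector_mul_bounded_linear)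
  then have [measurable]: "(\<lambda>\<omega>. lap k *v x k \<omega>) \<in> borel_measurable M"
    by (rule borel_measurable_continuous_on) simp
  show ?case
    by (subst measurable_cong[where g = "\<lambda>\<omega>. y k \<omega> - \<alpha> k *\<^sub>R (lap k *v x k \<omega>)"]) (auto simp: y_step)
qed

lemma H_sub: "subalgebra M (H k)"
  by (rule history_subalgebra) measurable

lemma y_H: "j \<le> k \<Longrightarrow> y j \<in> borel_measurable (H k)"
  by (rule measurable_history)

lemma comp_measurable: "f \<in> borel_measurable N \<Longrightarrow> (\<lambda>\<omega>. f \<omega> $ i) \<in> borel_measurable N"
  for f :: "'z \<Rightarrow> real^'n"
  by (rule borel_measurable_continuous_on[of "\<lambda>v. v $ i"]) (auto intro: continuous_intros)

lemma clip_measurable: "f \<in> borel_measurable N \<Longrightarrow> (\<lambda>\<omega>. clip qmin qmax (f \<omega>)) \<in> borel_measurable N"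
  unfolding clip_def by measurable

lemma mean_preserved: "\<omega> \<in> space M \<Longrightarrow> vec_mean (y k \<omega>) = ybar"
proof (induction k)
  case 0 then show ?case by (simp add: y_0)
next
  case (Suc k)
  have "(\<Sum>i\<in>UNIV. y (Suc k) \<omega> $ i) = (\<Sum>i\<in>UNIV. y k \<omega> $ i) - \<alpha> k * (\<Sum>i\<in>UNIV. (lap k *v x k \<omega>) $ i)"
    unfolding y_step[OF Suc.prems] by (simp add: sum_subtractf sum_distrib_left)
  then show ?case using Suc unfolding weight_eq_edge_matrix sum_out_laplacian by (simp add: vec_mean_def)
qed

lemma two_point:
  assumes "act k"
  shows "two_point_law M (H k) (\<lambda>\<omega>. x k \<omega> $ i) (\<lambda>\<omega>. quant_prob qmin qmax (Bc k i) (y k \<omega> $ i))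
    (\<lambda>\<omega>. quant_up qmin qmax (Bc k i) (y k \<omega> $ i)) (\<lambda>\<omega>. quant_down qmin qmax (Bc k i) (y k \<omega> $ i))"
proof
  show "subalgebra M (H k)" by (rule H_sub)
  show "(\<lambda>\<omega>. x k \<omega> $ i) \<in> borel_measurable M" by (rule comp_measurable) measurable
  show "AE \<omega> in M. real_cond_exp M (H k) (\<lambda>\<omega>. indicat_real S (x k \<omega> $ i)) \<omega> =
       quant_prob qmin qmax (Bc k i) (y k \<omega> $ i) * indicat_real S (quant_up qmin qmax (Bc k i) (y k \<omega> $ i)) +
       (1 - quant_prob qmin qmax (Bc k i) (y k \<omega> $ i)) * indicat_real S (quant_down qmin qmax (Bc k i) (y k \<omega> $ i))"
    if "S \<in> sets borel" for S
    using algorithm act_bits(1)[OF assms] that unfolding quantized_consensus_def by blast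
qed

lemma x_values_at:
  assumes k: "act k"
  shows "AE \<omega> in M. x k \<omega> $ i \<in> {qmin..qmax} \<and>
    (qmax \<le> y k \<omega> $ i \<longrightarrow> x k \<omega> $ i = qmax) \<and> (y k \<omega> $ i \<le> qmin \<longrightarrow> x k \<omega> $ i = qmin)"
proof -
  interpret X: two_point_law M "H k" "\<lambda>\<omega>. x k \<omega> $ i" "\<lambda>\<omega>. quant_prob qmin qmax (Bc k i) (y k \<omega> $ i)"
    "\<lambda>\<omega>. quant_up qmin qmax (Bc k i) (y k \<omega> $ i)" "\<lambda>\<omega>. quant_down qmin qmax (Bc k i) (y k \<omega> $ i)"
    by (rule two_point[OF k])
  note B = act_bits(1)[OF k, of i]
  have sp: "space (H k) = space M" using H_sub by (simp add: subalgebra_def)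
  have [measurable]: "(\<lambda>\<omega>. y k \<omega> $ i) \<in> borel_measurable (H k)" by (intro comp_measurable y_H) simp
  have 1: "AE \<omega> in M. True \<longrightarrow> x k \<omega> $ i \<in> {qmin..qmax}"
  proof (rule X.law_support)
    show "{\<omega> \<in> space M. True} \<in> sets (H k)" using sets.top[of "H k"] unfolding sp by simp
    show "quant_prob qmin qmax (Bc k i) (y k \<omega> $ i) * indicat_real {qmin..qmax} (quant_up qmin qmax (Bc k i) (y k \<omega> $ i)) +
       (1 - quant_prob qmin qmax (Bc k i) (y k \<omega> $ i)) * indicat_real {qmin..qmax} (quant_down qmin qmax (Bc k i) (y k \<omega> $ i)) = 1" for \<omega>
      using quant_values_in_grid[OF qlt B, of "y k \<omega> $ i"] quant_grid_subset[OF qlt B]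
      by (auto simp: indicator_def subset_eq)
  qed simp
  have 2: "AE \<omega> in M. qmax \<le> y k \<omega> $ i \<longrightarrow> x k \<omega> $ i \<in> {qmax}"
  proof (rule X.law_support)
    have "{\<omega> \<in> space (H k). qmax \<le> y k \<omega> $ i} \<in> sets (H k)" by measurable
    then show "{\<omega> \<in> space M. qmax \<le> y k \<omega> $ i} \<in> sets (H k)" unfolding sp .
  qed (auto simp: quant_saturated_top[OF qlt B])
  have 3: "AE \<omega> in M. y k \<omega> $ i \<le> qmin \<longrightarrow> x k \<omega> $ i \<in> {qmin}"
  proof (rule X.law_support)
    have "{\<omega> \<in> space (H k). y k \<omega> $ i \<le> qmin} \<in> sets (H k)" by measurable
    then show "{\<omega> \<in> space M. y k \<omega> $ i \<le> qmin} \<in> sets (H k)" unfolding sp .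
  qed (auto simp: quant_saturated_bot[OF qlt B])
  show ?thesis using 1 2 3 by eventually_elim auto
qed

text \<open>The almost sure event on which every quantized value lies in the range and saturates together with
  its state.\<close>

definition regular :: "'w \<Rightarrow> bool" where
  "regular \<omega> \<longleftrightarrow> \<omega> \<in> space M \<and> (\<forall>k i. act k \<longrightarrow> x k \<omega> $ i \<in> {qmin..qmax} \<and>
    (qmax \<le> y k \<omega> $ i \<longrightarrow> x k \<omega> $ i = qmax) \<and> (y k \<omega> $ i \<le> qmin \<longrightarrow> x k \<omega> $ i = qmin))"

lemma AE_regular: "AE \<omega> in M. regular \<omega>"
proof -
  have "AE \<omega> in M. act k \<longrightarrow> x k \<omega> $ i \<in> {qmin..qmax} \<and>
    (qmax \<le> y k \<omega> $ i \<longrightarrow> x k \<omega> $ i = qmax) \<and> (y k \<omega> $ i \<le> qmin \<longrightarrow> x k \<omega> $ i = qmin)" for k i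
    using x_values_at[of k i] by (cases "act k") auto
  then have "AE \<omega> in M. \<forall>k. \<forall>i\<in>UNIV. act k \<longrightarrow> x k \<omega> $ i \<in> {qmin..qmax} \<and>
    (qmax \<le> y k \<omega> $ i \<longrightarrow> x k \<omega> $ i = qmax) \<and> (y k \<omega> $ i \<le> qmin \<longrightarrow> x k \<omega> $ i = qmin)"
    by (subst AE_all_countable, intro allI, subst AE_finite_all) auto
  then show ?thesis using AE_space by eventually_elim (simp add: regular_def)
qed

text \<open>Up to time \<open>k\<close> a state stays within \<open>level_bound + creep k\<close>: the first term is what it can reach in
  one step from inside the range (or initially), the second one bounds all later pushes outwards
  by the imbalance term. The total creep is finite, so \<open>R\<close> bounds every deviation from the mean.\<close>

definition "Q = max \<bar>qmin\<bar> \<bar>qmax\<bar>"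
definition "incr_bound = Cb * Q + real CARD('n) * (wmax * (2 * Q))"
definition "level_bound = (\<Sum>i\<in>UNIV. \<bar>y0 $ i\<bar>) + Q + \<alpha> 0 * incr_bound"
definition "creep k = Cb * Q * (\<Sum>t<k. \<alpha> t * (1 / real (t + 1)))"
definition "R = level_bound + Cb * Q * (\<Sum>t. \<alpha> t * (1 / real (t + 1))) + Q + 1"

lemma Q_nonneg: "Q \<ge> 0" and Q_abs: "t \<in> {qmin..qmax} \<Longrightarrow> \<bar>t\<bar> \<le> Q"
  unfolding Q_def by auto

lemma w_pos: "w k i > 0" and wmax_pos: "wmax > 0"
  using w_bounds(1)[of k i] w_bounds(1)[of 0 undefined] w_bounds(2)[of 0 undefined] wmin by linarith+

lemma x_abs: "regular \<omega> \<Longrightarrow> \<bar>x k \<omega> $ i\<bar> \<le> Q"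
proof (cases "act k")
  case False
  assume "regular \<omega>"
  then show ?thesis using x_inactive[of \<omega> k i] False Q_nonneg by (simp add: regular_def)
qed (auto simp: regular_def intro: Q_abs)

lemma b_x_abs: "regular \<omega> \<Longrightarrow> \<bar>b k i * x k \<omega> $ i\<bar> \<le> Cb * Q * (1 / real (k + 1))"
  using mult_mono[OF Cb(2)[of k i] x_abs[of \<omega> k i]] Cb(1) by (simp add: abs_mult)

lemma increment_abs:
  assumes "regular \<omega>"
  shows "\<bar>b k i * x k \<omega> $ i + (\<Sum>j\<in>in_nbrs E i. w k j * (x k \<omega> $ j - x k \<omega> $ i))\<bar> \<le> incr_bound"
proof -
  have "\<bar>\<Sum>j\<in>in_nbrs E i. w k j * (x k \<omega> $ j - x k \<omega> $ i)\<bar> \<le>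
      (\<Sum>j\<in>in_nbrs E i. \<bar>w k j * (x k \<omega> $ j - x k \<omega> $ i)\<bar>)" by (rule sum_abs)
  also have "\<dots> \<le> (\<Sum>j\<in>in_nbrs E i. wmax * (2 * Q))"
  proof (rule sum_mono)
    fix j
    have "\<bar>x k \<omega> $ j - x k \<omega> $ i\<bar> \<le> 2 * Q" using x_abs[OF assms, of k j] x_abs[OF assms, of k i] by linarith
    then show "\<bar>w k j * (x k \<omega> $ j - x k \<omega> $ i)\<bar> \<le> wmax * (2 * Q)"
      unfolding abs_mult using w_bounds(2)[of k j] w_pos[of k j] wmax_pos by (intro mult_mono) auto
  qed
  also have "\<dots> \<le> real CARD('n) * (wmax * (2 * Q))"
    using wmax_pos Q_nonneg card_mono[of UNIV "in_nbrs E i"] by (simp add: mult_right_mono)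
  finally have 1: "\<bar>\<Sum>j\<in>in_nbrs E i. w k j * (x k \<omega> $ j - x k \<omega> $ i)\<bar> \<le> real CARD('n) * (wmax * (2 * Q))" .
  have "Cb * Q * (1 / real (k + 1)) \<le> Cb * Q * 1" using Cb(1) Q_nonneg by (intro mult_left_mono) auto
  then show ?thesis using 1 b_x_abs[OF assms, of k i] unfolding incr_bound_def by linarith
qed

lemma creep_Suc: "creep (Suc k) = creep k + \<alpha> k * (Cb * Q * (1 / real (k + 1)))"
  unfolding creep_def by (simp add: algebra_simps)

lemma creep_nonneg: "creep k \<ge> 0"
  unfolding creep_def using Cb(1) Q_nonneg \<alpha>_pos by (intro mult_nonneg_nonneg sum_nonneg) (auto intro: less_imp_le)

lemma creep_le: "creep k \<le> Cb * Q * (\<Sum>t. \<alpha> t * (1 / real (t + 1)))"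
  unfolding creep_def using Cb(1) Q_nonneg \<alpha>_pos
  by (intro mult_left_mono sum_le_suminf \<alpha>_harmonic_summable) (auto intro: less_imp_le)

lemma incr_bound_nonneg: "incr_bound \<ge> 0"
  unfolding incr_bound_def using Cb(1) Q_nonneg wmax_pos by simp

text \<open>A state above \<open>qmax\<close> transmits the largest possible value, so its differences to the neighbours pull
  it down and only the imbalance term can push it up.\<close>

lemma y_upper:
  assumes "regular \<omega>"
  shows "y k \<omega> $ i \<le> level_bound + creep k"
proof (induction k)
  case 0
  have "y0 $ i \<le> (\<Sum>i\<in>UNIV. \<bar>y0 $ i\<bar>)"
    using member_le_sum[of i UNIV "\<lambda>i. \<bar>y0 $ i\<bar>"] by simp
  then show ?case using assms y_0[of \<omega>] Q_nonneg incr_bound_nonneg \<alpha>_pos[of 0] creep_nonneg[of 0]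
    unfolding level_bound_def regular_def by (simp add: add_nonneg_nonneg) (smt (verit) mult_nonneg_nonneg)
next
  case (Suc k)
  have \<omega>: "\<omega> \<in> space M" using assms by (simp add: regular_def)
  let ?S = "\<Sum>j\<in>in_nbrs E i. w k j * (x k \<omega> $ j - x k \<omega> $ i)"
  show ?case
  proof (cases "qmax \<le> y k \<omega> $ i")
    case True
    have "?S \<le> 0"
    proof (cases "act k")
      case a: True
      have "x k \<omega> $ j \<le> x k \<omega> $ i" for j using assms a True by (auto simp: regular_def)
      then show ?thesis using w_pos[of k] by (intro sum_nonpos) (simp add: mult_nonneg_nonpos less_imp_le)
    next
      case False
      then show ?thesis using x_inactive[OF \<omega> False] by simp
    qed
    then have "b k i * x k \<omega> $ i + ?S \<le> Cb * Q * (1 / real (k + 1))"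
      using b_x_abs[OF assms, of k i] by linarith
    then have "\<alpha> k * (b k i * x k \<omega> $ i + ?S) \<le> \<alpha> k * (Cb * Q * (1 / real (k + 1)))"
      using \<alpha>_pos[of k] by (intro mult_left_mono) auto
    then show ?thesis using Suc unfolding y_update[OF \<omega>] creep_Suc by linarith
  next
    case False
    have "\<alpha> k * (b k i * x k \<omega> $ i + ?S) \<le> \<alpha> k * incr_bound"
      using increment_abs[OF assms, of k i] \<alpha>_pos[of k] by (intro mult_left_mono) auto
    also have "\<dots> \<le> \<alpha> 0 * incr_bound" using \<alpha>_le_0 incr_bound_nonneg by (intro mult_right_mono) auto
    finally have "y (Suc k) \<omega> $ i \<le> qmax + \<alpha> 0 * incr_bound" using False unfolding y_update[OF \<omega>] by linarith
    moreover have "qmax \<le> Q" unfolding Q_def by auto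
    moreover have "0 \<le> (\<Sum>i\<in>UNIV. \<bar>y0 $ i\<bar>)" by (intro sum_nonneg) auto
    ultimately show ?thesis using creep_nonneg[of "Suc k"] unfolding level_bound_def by linarith
  qed
qed

text \<open>The mirror image, with the smallest value transmitted below \<open>qmin\<close>.\<close>

lemma y_lower:
  assumes "regular \<omega>"
  shows "- (level_bound + creep k) \<le> y k \<omega> $ i"
proof (induction k)
  case 0
  have "- y0 $ i \<le> (\<Sum>i\<in>UNIV. \<bar>y0 $ i\<bar>)"
    using member_le_sum[of i UNIV "\<lambda>i. \<bar>y0 $ i\<bar>"] by simp
  then show ?case using assms y_0[of \<omega>] Q_nonneg incr_bound_nonneg \<alpha>_pos[of 0] creep_nonneg[of 0]
    unfolding level_bound_def regular_def by (simp add: add_nonneg_nonneg) (smt (verit) mult_nonneg_nonneg)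
next
  case (Suc k)
  have \<omega>: "\<omega> \<in> space M" using assms by (simp add: regular_def)
  let ?S = "\<Sum>j\<in>in_nbrs E i. w k j * (x k \<omega> $ j - x k \<omega> $ i)"
  show ?case
  proof (cases "y k \<omega> $ i \<le> qmin")
    case True
    have "?S \<ge> 0"
    proof (cases "act k")
      case a: True
      have "x k \<omega> $ j \<ge> x k \<omega> $ i" for j using assms a True by (auto simp: regular_def)
      then show ?thesis using w_pos[of k] by (intro sum_nonneg) (simp add: less_imp_le)
    next
      case False
      then show ?thesis using x_inactive[OF \<omega> False] by simp
    qed
    then have "- (b k i * x k \<omega> $ i + ?S) \<le> Cb * Q * (1 / real (k + 1))"
      using b_x_abs[OF assms, of k i] by linarith
    then have "\<alpha> k * - (b k i * x k \<omega> $ i + ?S) \<le> \<alpha> k * (Cb * Q * (1 / real (k + 1)))"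
      using \<alpha>_pos[of k] by (intro mult_left_mono) auto
    then show ?thesis using Suc unfolding y_update[OF \<omega>] creep_Suc by linarith
  next
    case False
    have "\<alpha> k * - (b k i * x k \<omega> $ i + ?S) \<le> \<alpha> k * incr_bound"
      using increment_abs[OF assms, of k i] \<alpha>_pos[of k] by (intro mult_left_mono) auto
    also have "\<dots> \<le> \<alpha> 0 * incr_bound" using \<alpha>_le_0 incr_bound_nonneg by (intro mult_right_mono) auto
    finally have "y (Suc k) \<omega> $ i \<ge> qmin - \<alpha> 0 * incr_bound" using False unfolding y_update[OF \<omega>] by linarith
    moreover have "- qmin \<le> Q" unfolding Q_def by auto
    moreover have "0 \<le> (\<Sum>i\<in>UNIV. \<bar>y0 $ i\<bar>)" by (intro sum_nonneg) auto
    ultimately show ?thesis using creep_nonneg[of "Suc k"] unfolding level_bound_def by linarith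
  qed
qed

lemma R_pos: "R > 0"
proof -
  have "0 \<le> creep 0" by (rule creep_nonneg)
  also have "creep 0 \<le> Cb * Q * (\<Sum>t. \<alpha> t * (1 / real (t + 1)))" by (rule creep_le)
  finally have "0 \<le> Cb * Q * (\<Sum>t. \<alpha> t * (1 / real (t + 1)))" .
  moreover have "0 \<le> (\<Sum>i\<in>UNIV. \<bar>y0 $ i\<bar>)" by (intro sum_nonneg) auto
  moreover have "0 \<le> \<alpha> 0 * incr_bound" using \<alpha>_pos[of 0] incr_bound_nonneg by simp
  ultimately show ?thesis unfolding R_def level_bound_def using Q_nonneg by linarith
qed

lemma deviation_bound:
  assumes "regular \<omega>"
  shows "\<bar>y k \<omega> $ i - ybar\<bar> \<le> R"
  using y_upper[OF assms, of k i] y_lower[OF assms, of k i] creep_le[of k] Q_abs[OF mean_range]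
  unfolding R_def by (simp add: abs_le_iff)

lemma norm_deviation_bound:
  assumes "regular \<omega>"
  shows "norm (y k \<omega> - vec ybar) \<le> real CARD('n) * R"
proof -
  have "norm (y k \<omega> - vec ybar) \<le> (\<Sum>i\<in>UNIV. \<bar>(y k \<omega> - vec ybar) $ i\<bar>)" by (rule norm_le_l1_cart)
  also have "\<dots> \<le> (\<Sum>i\<in>(UNIV :: 'n set). R)" using deviation_bound[OF assms] by (intro sum_mono) simp
  finally show ?thesis by simp
qed

lemma sq_error_measurable [measurable]: "(\<lambda>\<omega>. sq_error y0 (y k \<omega>)) \<in> borel_measurable M"
  unfolding sq_error_def by measurable

lemma sq_error_bound: "regular \<omega> \<Longrightarrow> sq_error y0 (y k \<omega>) \<le> (real CARD('n) * R)\<^sup>2"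
  unfolding sq_error_def by (intro power_mono norm_deviation_bound) auto

lemma sq_error_nonneg: "sq_error y0 v \<ge> 0"
  by (simp add: sq_error_def)

lemma sq_error_integrable: "integrable M (\<lambda>\<omega>. sq_error y0 (y k \<omega>))"
  by (rule integrable_const_bound[of _ "(real CARD('n) * R)\<^sup>2"])
    (use AE_regular in \<open>auto elim!: eventually_mono simp: sq_error_nonneg sq_error_bound\<close>)

section \<open>The drift of the mean square error\<close>

lemma bounded_integrable:
  assumes "f \<in> borel_measurable M" "\<And>\<omega>. regular \<omega> \<Longrightarrow> \<bar>f \<omega>\<bar> \<le> c"
  shows "integrable M (f :: 'w \<Rightarrow> real)"
  by (rule integrable_const_bound[of _ c]) (use assms AE_regular in \<open>auto elim!: eventually_mono\<close>)

lemma inner_lap: "u \<bullet> (lap k *v v) = (\<Sum>j\<in>UNIV. \<Sum>i\<in>out_nbrs E j. w k j * v $ j * (u $ j - u $ i))"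
  unfolding weight_eq_edge_matrix by (rule inner_out_laplacian)

lemma norm_lap_bound:
  assumes "regular \<omega>"
  shows "(norm (lap k *v x k \<omega>))\<^sup>2 \<le> (real CARD('n) * incr_bound)\<^sup>2"
proof -
  have "norm (lap k *v x k \<omega>) \<le> (\<Sum>i\<in>UNIV. \<bar>(lap k *v x k \<omega>) $ i\<bar>)" by (rule norm_le_l1_cart)
  also have "\<dots> \<le> (\<Sum>i\<in>(UNIV :: 'n set). incr_bound)"
    using increment_abs[OF assms, of k] by (intro sum_mono) (simp only: lap_eq_increment abs_minus_cancel)
  finally show ?thesis by (intro power_mono) auto
qed

lemma sq_error_step:
  assumes "\<omega> \<in> space M"
  shows "sq_error y0 (y (Suc k) \<omega>) =
    sq_error y0 (y k \<omega>) - 2 * \<alpha> k * (y k \<omega> \<bullet> (lap k *v x k \<omega>)) + (\<alpha> k)\<^sup>2 * (norm (lap k *v x k \<omega>))\<^sup>2"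
proof -
  define z where "z = lap k *v x k \<omega>"
  have z0: "vec ybar \<bullet> z = 0"
    unfolding z_def inner_lap by simp
  have "y (Suc k) \<omega> - vec ybar = (y k \<omega> - vec ybar) - \<alpha> k *\<^sub>R z"
    unfolding y_step[OF assms] z_def by simp
  moreover have "(norm (u - a *\<^sub>R z))\<^sup>2 = (norm u)\<^sup>2 - 2 * a * (u \<bullet> z) + a\<^sup>2 * (norm z)\<^sup>2" for u :: "real^'n" and a
    unfolding power2_norm_eq_inner
    by (simp add: inner_diff_left inner_diff_right inner_commute power2_eq_square algebra_simps)
  ultimately have "sq_error y0 (y (Suc k) \<omega>) =
      sq_error y0 (y k \<omega>) - 2 * \<alpha> k * ((y k \<omega> - vec ybar) \<bullet> z) + (\<alpha> k)\<^sup>2 * (norm z)\<^sup>2"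
    unfolding sq_error_def by (simp only:)
  then show ?thesis unfolding z_def[symmetric] inner_diff_left z0 by simp
qed

lemma history_sets_measurable: "A \<in> sets (H k) \<Longrightarrow> A \<in> sets M"
  using H_sub by (auto simp: subalgebra_def)

text \<open>The form below is linear in \<open>x\<close>, so its expectation involves one component of \<open>x\<close> at a time,
  multiplied by a difference of states that the history determines.\<close>

lemma quantizer_unbiased:
  assumes k: "act k" and A: "A \<in> sets (H k)"
  shows "(\<integral>\<omega>. indicator A \<omega> * (y k \<omega> $ j - y k \<omega> $ i) * x k \<omega> $ j \<partial>M) =
    (\<integral>\<omega>. indicator A \<omega> * (y k \<omega> $ j - y k \<omega> $ i) * clip qmin qmax (y k \<omega> $ j) \<partial>M)"
proof -
  interpret X: two_point_law M "H k" "\<lambda>\<omega>. x k \<omega> $ j" "\<lambda>\<omega>. quant_prob qmin qmax (Bc k j) (y k \<omega> $ j)"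
    "\<lambda>\<omega>. quant_up qmin qmax (Bc k j) (y k \<omega> $ j)" "\<lambda>\<omega>. quant_down qmin qmax (Bc k j) (y k \<omega> $ j)"
    by (rule two_point[OF k])
  note B = act_bits(1)[OF k, of j]
  have [measurable]: "(\<lambda>\<omega>. y k \<omega> $ i) \<in> borel_measurable (H k)" for i by (intro comp_measurable y_H) simp
  have [measurable]: "A \<in> sets (H k)" by fact
  show ?thesis
  proof (rule X.law_mean[where G = "quant_grid qmin qmax (Bc k j)" and c = "2 * R"])
    show "(\<lambda>\<omega>. clip qmin qmax (y k \<omega> $ j)) \<in> borel_measurable M"
      by (intro clip_measurable comp_measurable y_measurable)
    show "(\<lambda>\<omega>. indicator A \<omega> * (y k \<omega> $ j - y k \<omega> $ i)) \<in> borel_measurable (H k)" by measurable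
    show "AE \<omega> in M. \<bar>indicator A \<omega> * (y k \<omega> $ j - y k \<omega> $ i)\<bar> \<le> 2 * R"
      using AE_regular
    proof eventually_elim
      case (elim \<omega>)
      then show ?case using deviation_bound[OF elim, of k i] deviation_bound[OF elim, of k j] R_pos
        by (auto simp: indicator_def)
    qed
  qed (use quant_values_in_grid[OF qlt B] quant_mean[OF qlt B] in auto)
qed

lemma form_unbiased:
  assumes k: "act k" and A: "A \<in> sets (H k)"
  shows "(\<integral>\<omega>. indicator A \<omega> * (y k \<omega> \<bullet> (lap k *v x k \<omega>)) \<partial>M) =
      (\<integral>\<omega>. indicator A \<omega> * (y k \<omega> \<bullet> (lap k *v clip_vec qmin qmax (y k \<omega>))) \<partial>M)"
    and "integrable M (\<lambda>\<omega>. indicator A \<omega> * (y k \<omega> \<bullet> (lap k *v x k \<omega>)))"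
    and "integrable M (\<lambda>\<omega>. indicator A \<omega> * (y k \<omega> \<bullet> (lap k *v clip_vec qmin qmax (y k \<omega>))))"
proof -
  have [measurable]: "A \<in> sets M" using A by (rule history_sets_measurable)
  have [measurable]: "(\<lambda>\<omega>. y k \<omega> $ i) \<in> borel_measurable M" "(\<lambda>\<omega>. x k \<omega> $ i) \<in> borel_measurable M"
    "(\<lambda>\<omega>. clip qmin qmax (y k \<omega> $ i)) \<in> borel_measurable M" for i
    by (intro comp_measurable clip_measurable y_measurable x_measurable)+
  have bnd: "\<bar>indicator A \<omega> * (y k \<omega> $ j - y k \<omega> $ i) * v\<bar> \<le> 2 * R * Q" if "regular \<omega>" "\<bar>v\<bar> \<le> Q" for \<omega> i j and v :: real
  proof -
    have "\<bar>indicator A \<omega> * (y k \<omega> $ j - y k \<omega> $ i)\<bar> \<le> 2 * R"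
      using deviation_bound[OF that(1), of k i] deviation_bound[OF that(1), of k j] R_pos
      by (auto simp: indicator_def)
    then show ?thesis using that(2) R_pos Q_nonneg unfolding abs_mult[of _ v] by (intro mult_mono) auto
  qed
  have i1: "integrable M (\<lambda>\<omega>. indicator A \<omega> * (y k \<omega> $ j - y k \<omega> $ i) * x k \<omega> $ j)" for i j
    by (rule bounded_integrable[of _ "2 * R * Q"]) (measurable, intro bnd x_abs)
  have i2: "integrable M (\<lambda>\<omega>. indicator A \<omega> * (y k \<omega> $ j - y k \<omega> $ i) * clip qmin qmax (y k \<omega> $ j))" for i j
  proof (rule bounded_integrable[of _ "2 * R * Q"])
    show "\<bar>indicator A \<omega> * (y k \<omega> $ j - y k \<omega> $ i) * clip qmin qmax (y k \<omega> $ j)\<bar> \<le> 2 * R * Q" if "regular \<omega>" for \<omega>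
      using that by (rule bnd) (use qlt in \<open>auto intro!: Q_abs simp: clip_def\<close>)
  qed measurable
  have e1: "indicator A \<omega> * (y k \<omega> \<bullet> (lap k *v x k \<omega>)) =
      (\<Sum>j\<in>UNIV. \<Sum>i\<in>out_nbrs E j. w k j * (indicator A \<omega> * (y k \<omega> $ j - y k \<omega> $ i) * x k \<omega> $ j))" for \<omega>
    unfolding inner_lap by (simp add: sum_distrib_left mult_ac)
  have e2: "indicator A \<omega> * (y k \<omega> \<bullet> (lap k *v clip_vec qmin qmax (y k \<omega>))) =
      (\<Sum>j\<in>UNIV. \<Sum>i\<in>out_nbrs E j. w k j * (indicator A \<omega> * (y k \<omega> $ j - y k \<omega> $ i) * clip qmin qmax (y k \<omega> $ j)))" for \<omega>
    unfolding inner_lap by (simp add: sum_distrib_left mult_ac clip_vec_def)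
  show "integrable M (\<lambda>\<omega>. indicator A \<omega> * (y k \<omega> \<bullet> (lap k *v x k \<omega>)))"
    unfolding e1 by (intro Bochner_Integration.integrable_sum integrable_mult_right i1)
  show "integrable M (\<lambda>\<omega>. indicator A \<omega> * (y k \<omega> \<bullet> (lap k *v clip_vec qmin qmax (y k \<omega>))))"
    unfolding e2 by (intro Bochner_Integration.integrable_sum integrable_mult_right i2)
  have "(\<integral>\<omega>. indicator A \<omega> * (y k \<omega> \<bullet> (lap k *v x k \<omega>)) \<partial>M) =
      (\<Sum>j\<in>UNIV. \<Sum>i\<in>out_nbrs E j. w k j * (\<integral>\<omega>. indicator A \<omega> * (y k \<omega> $ j - y k \<omega> $ i) * x k \<omega> $ j \<partial>M))"
    unfolding e1 using i1 by (simp add: Bochner_Integration.integral_sum)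
  also have "\<dots> = (\<Sum>j\<in>UNIV. \<Sum>i\<in>out_nbrs E j. w k j *
      (\<integral>\<omega>. indicator A \<omega> * (y k \<omega> $ j - y k \<omega> $ i) * clip qmin qmax (y k \<omega> $ j) \<partial>M))"
    by (simp only: quantizer_unbiased[OF k A])
  also have "\<dots> = (\<integral>\<omega>. indicator A \<omega> * (y k \<omega> \<bullet> (lap k *v clip_vec qmin qmax (y k \<omega>))) \<partial>M)"
    unfolding e2 using i2 by (simp add: Bochner_Integration.integral_sum)
  finally show "(\<integral>\<omega>. indicator A \<omega> * (y k \<omega> \<bullet> (lap k *v x k \<omega>)) \<partial>M) =
      (\<integral>\<omega>. indicator A \<omega> * (y k \<omega> \<bullet> (lap k *v clip_vec qmin qmax (y k \<omega>))) \<partial>M)" .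
qed

definition coercive :: "real \<Rightarrow> real \<Rightarrow> bool" where
  "coercive \<xi>1 \<xi>2 \<longleftrightarrow> \<xi>1 > 0 \<and> \<xi>2 > 0 \<and> (\<forall>k \<omega>. regular \<omega> \<longrightarrow>
     y k \<omega> \<bullet> (lap k *v clip_vec qmin qmax (y k \<omega>)) \<ge>
       \<xi>1 * sq_error y0 (y k \<omega>) - \<xi>2 * (\<Sum>i\<in>UNIV. \<bar>b k i\<bar>))"

lemma coercive_exists: "\<exists>\<xi>1 \<xi>2. coercive \<xi>1 \<xi>2"
proof -
  obtain \<xi>1 \<xi>2 where \<xi>: "\<xi>1 > 0" "\<xi>2 > 0" "\<And>u (z :: real^'n) m. (\<forall>i. wmin \<le> u i) \<Longrightarrow>
    vec_mean z = m \<Longrightarrow> m \<in> {qmin..qmax} \<Longrightarrow> (\<forall>i. \<bar>z $ i - m\<bar> \<le> R) \<Longrightarrow>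
    z \<bullet> (out_laplacian E (edge_matrix E u) *v clip_vec qmin qmax z) \<ge>
      \<xi>1 * (norm (z - vec m))\<^sup>2 - \<xi>2 * (\<Sum>i\<in>UNIV. \<bar>node_imbalance E u i\<bar>)"
    using clipped_laplacian_coercive[OF connected qlt R_pos wmin] by blast
  have "coercive \<xi>1 \<xi>2"
    unfolding coercive_def sq_error_def weight_eq_edge_matrix imbalance_eq_node_imbalance
    using \<xi> w_bounds(1) mean_range deviation_bound mean_preserved by (auto simp: regular_def)
  then show ?thesis by blast
qed

text \<open>The first summand comes from the imbalance in the coercivity bound, the second one from the squared
  length of the step.\<close>

definition noise :: "real \<Rightarrow> nat \<Rightarrow> real" where
  "noise \<xi>2 k = 2 * \<xi>2 * real CARD('n) * Cb * (\<alpha> k * (1 / real (k + 1))) + (real CARD('n) * incr_bound)\<^sup>2 * (\<alpha> k)\<^sup>2"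

lemma noise_nonneg: "\<xi>2 > 0 \<Longrightarrow> noise \<xi>2 k \<ge> 0"
  unfolding noise_def using Cb(1) \<alpha>_pos[of k] by simp

lemma noise_summable: "summable (noise \<xi>2)"
  unfolding noise_def by (intro summable_add summable_mult \<alpha>_harmonic_summable \<alpha>_sq_summable)

text \<open>Expanding the square gives the cross term \<open>-2 \<alpha> y\<^sup>T L\<^sup>+ x\<close>; in expectation over an event of the
  history, \<open>x\<close> may be replaced by the clipped state, and coercivity applies.\<close>

lemma drift_active:
  assumes \<xi>: "coercive \<xi>1 \<xi>2" and k: "act k" and A: "A \<in> sets (H k)"
  shows "(\<integral>\<omega>. indicator A \<omega> * sq_error y0 (y (Suc k) \<omega>) \<partial>M) \<le>
    (1 - 2 * \<xi>1 * \<alpha> k) * (\<integral>\<omega>. indicator A \<omega> * sq_error y0 (y k \<omega>) \<partial>M) + noise \<xi>2 k * measure M A"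
proof -
  have [measurable]: "A \<in> sets M" using A by (rule history_sets_measurable)
  define G where "G = (real CARD('n) * incr_bound)\<^sup>2"
  define \<beta> where "\<beta> = (\<Sum>i\<in>UNIV. \<bar>b k i\<bar>)"
  let ?V = "\<lambda>k \<omega>. indicator A \<omega> * sq_error y0 (y k \<omega>)"
  let ?x = "\<lambda>\<omega>. indicator A \<omega> * (y k \<omega> \<bullet> (lap k *v x k \<omega>))"
  let ?c = "\<lambda>\<omega>. indicator A \<omega> * (y k \<omega> \<bullet> (lap k *v clip_vec qmin qmax (y k \<omega>)))"
  note form = form_unbiased[OF k A]
  have intV: "integrable M (?V k)" for k
  proof (rule bounded_integrable[of _ "(real CARD('n) * R)\<^sup>2"])
    show "\<bar>?V k \<omega>\<bar> \<le> (real CARD('n) * R)\<^sup>2" if "regular \<omega>" for \<omega>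
      using sq_error_bound[OF that] sq_error_nonneg by (auto simp: indicator_def)
  qed measurable
  have intA: "integrable M (indicator A :: 'w \<Rightarrow> real)"
    by (rule bounded_integrable[of _ 1]) (auto simp: indicator_def)
  have meas: "(\<integral>\<omega>. indicator A \<omega> \<partial>M) = measure M A"
    using sets.sets_into_space[of A M] by (simp add: Int_absorb2)
  have "(\<integral>\<omega>. ?V (Suc k) \<omega> \<partial>M) \<le> (\<integral>\<omega>. ?V k \<omega> - 2 * \<alpha> k * ?x \<omega> + (\<alpha> k)\<^sup>2 * G * indicator A \<omega> \<partial>M)"
  proof (rule integral_mono_AE)
    show "integrable M (\<lambda>\<omega>. ?V k \<omega> - 2 * \<alpha> k * ?x \<omega> + (\<alpha> k)\<^sup>2 * G * indicator A \<omega>)"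
      by (intro Bochner_Integration.integrable_add Bochner_Integration.integrable_diff
          integrable_mult_right intV form intA)
    show "AE \<omega> in M. ?V (Suc k) \<omega> \<le> ?V k \<omega> - 2 * \<alpha> k * ?x \<omega> + (\<alpha> k)\<^sup>2 * G * indicator A \<omega>"
      using AE_regular
    proof eventually_elim
      case (elim \<omega>)
      have "(\<alpha> k)\<^sup>2 * (norm (lap k *v x k \<omega>))\<^sup>2 \<le> (\<alpha> k)\<^sup>2 * G"
        unfolding G_def by (intro mult_left_mono norm_lap_bound elim) auto
      then show ?case using elim sq_error_step[of \<omega> k] by (auto simp: indicator_def regular_def)
    qed
  qed (rule intV)
  also have "\<dots> = (\<integral>\<omega>. ?V k \<omega> \<partial>M) - 2 * \<alpha> k * (\<integral>\<omega>. ?x \<omega> \<partial>M) + (\<alpha> k)\<^sup>2 * G * measure M A"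
    using intV[of k] form(2) intA meas
    by (simp only: Bochner_Integration.integral_add Bochner_Integration.integral_diff
        Bochner_Integration.integrable_diff integrable_mult_right integral_mult_right_zero)
  finally have 1: "(\<integral>\<omega>. ?V (Suc k) \<omega> \<partial>M) \<le>
    (\<integral>\<omega>. ?V k \<omega> \<partial>M) - 2 * \<alpha> k * (\<integral>\<omega>. ?c \<omega> \<partial>M) + (\<alpha> k)\<^sup>2 * G * measure M A"
    unfolding form(1) .
  have "\<xi>1 * (\<integral>\<omega>. ?V k \<omega> \<partial>M) - \<xi>2 * \<beta> * measure M A = (\<integral>\<omega>. \<xi>1 * ?V k \<omega> - \<xi>2 * \<beta> * indicator A \<omega> \<partial>M)"
    using intV[of k] intA meas
    by (simp only: Bochner_Integration.integral_diff integrable_mult_right integral_mult_right_zero)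
  also have "\<dots> \<le> (\<integral>\<omega>. ?c \<omega> \<partial>M)"
  proof (rule integral_mono_AE)
    show "integrable M (\<lambda>\<omega>. \<xi>1 * ?V k \<omega> - \<xi>2 * \<beta> * indicator A \<omega>)"
      by (intro Bochner_Integration.integrable_diff integrable_mult_right intV intA)
    show "AE \<omega> in M. \<xi>1 * ?V k \<omega> - \<xi>2 * \<beta> * indicator A \<omega> \<le> ?c \<omega>"
      using AE_regular
      by eventually_elim (use \<xi> in \<open>auto simp: coercive_def \<beta>_def indicator_def\<close>)
  qed (rule form)
  finally have "\<xi>1 * (\<integral>\<omega>. ?V k \<omega> \<partial>M) - \<xi>2 * \<beta> * measure M A \<le> (\<integral>\<omega>. ?c \<omega> \<partial>M)" .
  then have 2: "2 * \<alpha> k * (\<xi>1 * (\<integral>\<omega>. ?V k \<omega> \<partial>M) - \<xi>2 * \<beta> * measure M A) \<le> 2 * \<alpha> k * (\<integral>\<omega>. ?c \<omega> \<partial>M)"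
    using \<alpha>_pos[of k] by (intro mult_left_mono) auto
  have "\<beta> \<le> (\<Sum>i\<in>(UNIV :: 'n set). Cb / real (k + 1))" unfolding \<beta>_def by (intro sum_mono Cb(2))
  then have "\<beta> \<le> real CARD('n) * (Cb / real (k + 1))" by simp
  then have "2 * \<alpha> k * \<xi>2 * measure M A * \<beta> \<le> 2 * \<alpha> k * \<xi>2 * measure M A * (real CARD('n) * (Cb / real (k + 1)))"
    using \<alpha>_pos[of k] \<xi> by (intro mult_left_mono) (auto simp: coercive_def)
  then have 3: "2 * \<alpha> k * (\<xi>2 * \<beta> * measure M A) + (\<alpha> k)\<^sup>2 * G * measure M A \<le> noise \<xi>2 k * measure M A"
    unfolding noise_def G_def by (simp add: algebra_simps)
  show ?thesis using 1 2 3 by (simp add: algebra_simps)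
qed

lemma y_inactive: "\<omega> \<in> space M \<Longrightarrow> \<not> act k \<Longrightarrow> y (Suc k) \<omega> = y k \<omega>"
  by (simp add: vec_eq_iff y_update x_inactive)

lemma drift:
  assumes \<xi>: "coercive \<xi>1 \<xi>2" and A: "A \<in> sets (H k)"
  shows "(\<integral>\<omega>. indicator A \<omega> * sq_error y0 (y (Suc k) \<omega>) \<partial>M) \<le>
    (\<integral>\<omega>. indicator A \<omega> * sq_error y0 (y k \<omega>) \<partial>M) + noise \<xi>2 k * measure M A"
proof (cases "act k")
  case True
  have "0 \<le> 2 * \<xi>1 * \<alpha> k * (\<integral>\<omega>. indicator A \<omega> * sq_error y0 (y k \<omega>) \<partial>M)"
    using \<xi> \<alpha>_pos[of k] sq_error_nonneg
    by (intro mult_nonneg_nonneg Bochner_Integration.integral_nonneg) (auto simp: coercive_def less_imp_le)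
  then show ?thesis using drift_active[OF \<xi> True A] by (simp add: algebra_simps)
next
  case False
  have "(\<integral>\<omega>. indicator A \<omega> * sq_error y0 (y (Suc k) \<omega>) \<partial>M) = (\<integral>\<omega>. indicator A \<omega> * sq_error y0 (y k \<omega>) \<partial>M)"
    using False by (intro Bochner_Integration.integral_cong) (auto simp: y_inactive)
  then show ?thesis using \<xi> noise_nonneg[of \<xi>2 k] by (simp add: coercive_def)
qed

definition mse :: "nat \<Rightarrow> real" where
  "mse k = (\<integral>\<omega>. sq_error y0 (y k \<omega>) \<partial>M)"

lemma mse_nonneg: "mse k \<ge> 0"
  unfolding mse_def by (intro Bochner_Integration.integral_nonneg sq_error_nonneg)

lemma mse_eq: "(\<integral>\<omega>. indicator (space M) \<omega> * sq_error y0 (y k \<omega>) \<partial>M) = mse k"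
  unfolding mse_def by (intro Bochner_Integration.integral_cong) auto

lemma space_H: "space M \<in> sets (H k)"
  using H_sub[of k] sets.top[of "H k"] by (simp add: subalgebra_def)

lemma mse_drift:
  assumes "coercive \<xi>1 \<xi>2"
  shows "mse (Suc k) \<le> mse k + noise \<xi>2 k"
    and "act k \<Longrightarrow> mse (Suc k) \<le> (1 - 2 * \<xi>1 * \<alpha> k) * mse k + noise \<xi>2 k"
  using drift[OF assms space_H[of k]] drift_active[OF assms _ space_H[of k]]
  unfolding mse_eq by (simp_all add: prob_space)

section \<open>Convergence and rates\<close>

lemma mse_tendsto_zero: "mse \<longlonglongrightarrow> 0"
proof -
  obtain \<xi>1 \<xi>2 where \<xi>: "coercive \<xi>1 \<xi>2" using coercive_exists by blast
  show ?thesis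
  proof (rule perturbed_contraction_tendsto_zero[where \<alpha> = \<alpha> and c = "2 * \<xi>1" and e = "noise \<xi>2"])
    show "\<exists>t\<in>{k..<k + L}. act t" for k by (rule act_window)
    show "mse (Suc k) \<le> mse k + noise \<xi>2 k" for k by (rule mse_drift(1)[OF \<xi>])
    show "mse (Suc k) \<le> (1 - 2 * \<xi>1 * \<alpha> k) * mse k + noise \<xi>2 k" if "act k" for k
      by (rule mse_drift(2)[OF \<xi> that])
  qed (use \<xi> in \<open>auto simp: coercive_def \<alpha>_dec \<alpha>_not_summable noise_summable noise_nonneg mse_nonneg
      intro: less_imp_le[OF \<alpha>_pos]\<close>)
qed

text \<open>Adding the noise still to come turns the squared error into a supermartingale whose expectation
  vanishes.\<close>

theorem AE_consensus: "AE \<omega> in M. (\<lambda>k. y k \<omega>) \<longlonglongrightarrow> vec ybar"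
proof -
  obtain \<xi>1 \<xi>2 where \<xi>: "coercive \<xi>1 \<xi>2" using coercive_exists by blast
  define rest where "rest k = suminf (noise \<xi>2) - (\<Sum>j<k. noise \<xi>2 j)" for k
  define U where "U k \<omega> = sq_error y0 (y k \<omega>) + rest k" for k \<omega>
  have n0: "noise \<xi>2 k \<ge> 0" for k using \<xi> noise_nonneg by (simp add: coercive_def)
  have rest0: "rest k \<ge> 0" for k
    unfolding rest_def using sum_le_suminf[OF noise_summable, of "{..<k}"] n0 by simp
  have restlim: "rest \<longlonglongrightarrow> 0"
    unfolding rest_def
    using tendsto_diff[OF tendsto_const[of "suminf (noise \<xi>2)"] summable_LIMSEQ[OF noise_summable[of \<xi>2]]] by simp
  have restSuc: "rest k = rest (Suc k) + noise \<xi>2 k" for k unfolding rest_def by simp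
  have "AE \<omega> in M. (\<lambda>k. U k \<omega>) \<longlonglongrightarrow> 0"
  proof (rule supermartingale_AE_tendsto_zero[where H = H])
    show "prob_space M" by (rule prob_space_axioms)
    show "subalgebra M (H m)" for m by (rule H_sub)
    show "U j \<in> borel_measurable (H m)" if "j \<le> m" for j m
    proof -
      note [measurable] = y_H[OF that]
      show ?thesis unfolding U_def sq_error_def by measurable
    qed
    show "U j \<omega> \<ge> 0" for j \<omega> unfolding U_def using sq_error_nonneg rest0 by simp
    show int: "integrable M (U j)" for j
      unfolding U_def by (intro Bochner_Integration.integrable_add sq_error_integrable) simp
    have "(\<integral>\<omega>. U n \<omega> \<partial>M) = mse n + rest n" for n
      unfolding U_def mse_def using sq_error_integrable by (simp add: prob_space)
    then show "(\<lambda>n. \<integral>\<omega>. U n \<omega> \<partial>M) \<longlonglongrightarrow> 0"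
      using tendsto_add[OF mse_tendsto_zero restlim] by simp
    fix m A assume A: "A \<in> sets (H m)"
    then have Am [measurable]: "A \<in> sets M" by (rule history_sets_measurable)
    have *: "(\<integral>\<omega>. indicator A \<omega> * U k \<omega> \<partial>M) = (\<integral>\<omega>. indicator A \<omega> * sq_error y0 (y k \<omega>) \<partial>M) + rest k * measure M A" for k
    proof -
      have "integrable M (\<lambda>\<omega>. indicator A \<omega> * sq_error y0 (y k \<omega>))"
        using integrable_real_mult_indicator[OF Am sq_error_integrable[of k]] by (simp add: mult.commute)
      moreover have "integrable M (\<lambda>\<omega>. rest k * indicator A \<omega>)"
        by (rule bounded_integrable[of _ "rest k"]) (use rest0 in \<open>auto simp: indicator_def\<close>)
      ultimately have "(\<integral>\<omega>. indicator A \<omega> * sq_error y0 (y k \<omega>) + rest k * indicator A \<omega> \<partial>M) =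
          (\<integral>\<omega>. indicator A \<omega> * sq_error y0 (y k \<omega>) \<partial>M) + (\<integral>\<omega>. rest k * indicator A \<omega> \<partial>M)"
        by (rule Bochner_Integration.integral_add)
      moreover have "(\<integral>\<omega>. rest k * indicator A \<omega> \<partial>M) = rest k * measure M A"
        using sets.sets_into_space[OF Am] by (simp add: Int_absorb2)
      ultimately show ?thesis unfolding U_def by (simp add: distrib_left mult.commute)
    qed
    show "(\<integral>\<omega>. indicator A \<omega> * U (Suc m) \<omega> \<partial>M) \<le> (\<integral>\<omega>. indicator A \<omega> * U m \<omega> \<partial>M)"
      unfolding * using drift[OF \<xi> A] restSuc[of m] by (simp add: distrib_right)
  qed
  then show ?thesis
  proof eventually_elim
    case (elim \<omega>)
    have "(\<lambda>k. sqrt (U k \<omega> - rest k)) \<longlonglongrightarrow> sqrt (0 - 0)"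
      by (intro tendsto_real_sqrt tendsto_diff elim restlim)
    then have "(\<lambda>k. norm (y k \<omega> - vec ybar)) \<longlonglongrightarrow> 0" by (simp add: U_def sq_error_def)
    then show ?case using LIM_zero_cancel tendsto_norm_zero_iff by blast
  qed
qed

text \<open>The convergence event is measurable because its quantifiers can be restricted to countable sets.\<close>

theorem prob_consensus: "measure M {\<omega> \<in> space M. (\<lambda>k. y k \<omega>) \<longlonglongrightarrow> vec ybar} = 1"
proof -
  have "(\<lambda>k. y k \<omega>) \<longlonglongrightarrow> vec ybar \<longleftrightarrow> (\<forall>l. \<exists>n. \<forall>k\<ge>n. norm (y k \<omega> - vec ybar) < 1 / real (Suc l))" for \<omega>
    unfolding LIMSEQ_iff
    by (meson nat_approx_posE of_nat_0_less_iff zero_less_Suc zero_less_divide_1_iff less_trans)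
  moreover have "{\<omega> \<in> space M. \<forall>l. \<exists>n. \<forall>k\<ge>n. norm (y k \<omega> - vec ybar) < 1 / real (Suc l)} \<in> sets M" by measurable
  ultimately have "{\<omega> \<in> space M. (\<lambda>k. y k \<omega>) \<longlonglongrightarrow> vec ybar} \<in> sets M" by simp
  then show ?thesis using AE_consensus by (subst AE_in_set_eq_1[symmetric]) auto
qed

theorem exp_moments:
  "integrable M (\<lambda>\<omega>. exp (r * norm (y k \<omega> - vec ybar)))"
  "(\<lambda>k. \<integral>\<omega>. exp (r * norm (y k \<omega> - vec ybar)) \<partial>M) \<longlonglongrightarrow> 1"
proof -
  define c where "c = exp (\<bar>r\<bar> * (real CARD('n) * R))"
  have bnd: "\<bar>exp (r * norm (y k \<omega> - vec ybar))\<bar> \<le> c" if "regular \<omega>" for k \<omega>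
  proof -
    have "r * norm (y k \<omega> - vec ybar) \<le> \<bar>r\<bar> * norm (y k \<omega> - vec ybar)" by (intro mult_right_mono) auto
    also have "\<dots> \<le> \<bar>r\<bar> * (real CARD('n) * R)" by (intro mult_left_mono norm_deviation_bound that) auto
    finally show ?thesis unfolding c_def by simp
  qed
  show "integrable M (\<lambda>\<omega>. exp (r * norm (y k \<omega> - vec ybar)))"
    by (rule bounded_integrable[OF _ bnd]) measurable
  have "(\<lambda>k. \<integral>\<omega>. exp (r * norm (y k \<omega> - vec ybar)) \<partial>M) \<longlonglongrightarrow> (\<integral>\<omega>. 1 \<partial>M)"
  proof (rule integral_dominated_convergence[where w = "\<lambda>_. c"])
    show "AE \<omega> in M. (\<lambda>k. exp (r * norm (y k \<omega> - vec ybar))) \<longlonglongrightarrow> 1"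
      using AE_consensus
    proof eventually_elim
      case (elim \<omega>)
      have "(\<lambda>k. exp (r * norm (y k \<omega> - vec ybar))) \<longlonglongrightarrow> exp (r * norm (vec ybar - vec ybar :: real^'n))"
        by (intro tendsto_intros elim)
      then show ?case by simp
    qed
    show "AE \<omega> in M. norm (exp (r * norm (y k \<omega> - vec ybar))) \<le> c" for k
      using AE_regular by eventually_elim (use bnd in auto)
  qed measurable
  then show "(\<lambda>k. \<integral>\<omega>. exp (r * norm (y k \<omega> - vec ybar)) \<partial>M) \<longlonglongrightarrow> 1" by (simp add: prob_space)
qed

text \<open>Here \<open>\<sigma>\<close> is the target exponent, capped at \<open>1\<close> because the noise is of order \<open>1/k\<^sup>2\<close>.\<close>

lemma mse_rate:
  assumes \<xi>: "coercive \<xi>1 \<xi>2" and m: "m > 0" "\<alpha> \<in> O(\<lambda>k. 1 / real k)" "\<And>k. \<alpha> k \<ge> m / (real k + 1)"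
    and \<sigma>: "0 < \<sigma>" "\<sigma> \<le> 1" "2 * real L * \<sigma> \<le> 2 * \<xi>1 * m"
  shows "mse \<in> O(\<lambda>k. 1 / real k powr \<sigma>)"
proof -
  obtain D where D: "D > 0" "\<forall>\<^sub>F k in sequentially. norm (\<alpha> k) \<le> D * norm (1 / real k)"
    using m(2) by (elim landau_o.bigE)
  define N1 where "N1 = 2 * \<xi>2 * real CARD('n) * Cb"
  define N2 where "N2 = (real CARD('n) * incr_bound)\<^sup>2"
  have N: "N1 \<ge> 0" "N2 \<ge> 0" unfolding N1_def N2_def using \<xi> Cb(1) by (auto simp: coercive_def)
  have ev: "\<forall>\<^sub>F k in sequentially. noise \<xi>2 k \<le> (N1 * (2 * D) + N2 * (2 * D)\<^sup>2) / (real k + 1)\<^sup>2"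
    using D(2) eventually_gt_at_top[of 0]
  proof eventually_elim
    case (elim k)
    have "\<alpha> k \<le> D / real k" using elim \<alpha>_pos[of k] by simp
    also have "\<dots> \<le> 2 * D / (real k + 1)" using elim D(1) by (simp add: field_simps)
    finally have a: "\<alpha> k \<le> 2 * D / (real k + 1)" .
    have "N1 * (\<alpha> k * (1 / real (k + 1))) \<le> N1 * (2 * D / (real k + 1) * (1 / real (k + 1)))"
      using a N by (intro mult_left_mono mult_right_mono) auto
    moreover have "N2 * (\<alpha> k)\<^sup>2 \<le> N2 * (2 * D / (real k + 1))\<^sup>2"
      using a N \<alpha>_pos[of k] by (intro mult_left_mono power_mono) auto
    ultimately have "noise \<xi>2 k \<le> N1 * (2 * D / (real k + 1) * (1 / real (k + 1))) + N2 * (2 * D / (real k + 1))\<^sup>2"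
      unfolding noise_def N1_def[symmetric] N2_def[symmetric] by linarith
    also have "\<dots> = (N1 * (2 * D) + N2 * (2 * D)\<^sup>2) / (real k + 1)\<^sup>2"
      by (simp add: power_divide add_divide_distrib power2_eq_square add.commute)
    finally show ?case .
  qed
  have "\<exists>K. \<forall>\<^sub>F k in sequentially. mse k \<le> K * (real k + 1) powr (- \<sigma>)"
  proof (rule perturbed_contraction_rate[where \<alpha> = \<alpha> and c = "2 * \<xi>1" and e = "noise \<xi>2" and m = m])
    show "\<exists>t\<in>{k..<k + L}. act t" for k by (rule act_window)
    show "mse (Suc k) \<le> mse k + noise \<xi>2 k" for k by (rule mse_drift(1)[OF \<xi>])
    show "mse (Suc k) \<le> (1 - 2 * \<xi>1 * \<alpha> k) * mse k + noise \<xi>2 k" if "act k" for k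
      by (rule mse_drift(2)[OF \<xi> that])
  qed (use \<xi> m \<sigma> ev in \<open>auto simp: coercive_def noise_nonneg mse_nonneg\<close>)
  then obtain K where K: "\<forall>\<^sub>F k in sequentially. mse k \<le> K * (real k + 1) powr (- \<sigma>)" by blast
  show ?thesis
  proof (rule bigoI[where c = "\<bar>K\<bar>"])
    show "\<forall>\<^sub>F k in sequentially. norm (mse k) \<le> \<bar>K\<bar> * norm (1 / real k powr \<sigma>)"
      using K eventually_gt_at_top[of 0]
    proof eventually_elim
      case (elim k)
      have "mse k \<le> \<bar>K\<bar> * (real k + 1) powr (- \<sigma>)"
        using elim(1) by (meson abs_ge_self mult_right_mono order_trans powr_ge_zero)
      also have "\<dots> \<le> \<bar>K\<bar> * real k powr (- \<sigma>)"
        using elim \<sigma> by (intro mult_left_mono powr_mono2') auto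
      finally show ?case using mse_nonneg by (simp add: powr_minus_divide)
    qed
  qed
qed

end


section \<open>Average consensus under quantized communication\<close>

theorem theorem7:
  fixes E :: "('n::finite \<times> 'n) set"
    and Bw Bc :: "nat \<Rightarrow> 'n \<Rightarrow> nat"
    and \<gamma> \<alpha> :: "nat \<Rightarrow> real"
    and qmin qmax :: real
    and y0 :: "real^'n"
    and M :: "'w measure"
    and x y :: "nat \<Rightarrow> 'w \<Rightarrow> real^'n"
  assumes "CARD('n) \<ge> 2"
    and "strongly_connected_digraph E"
    and A1: "weight_bits Bw"
    and A2: "weight_steps \<gamma>"
    and A3: "consensus_bits Bc"
    and A4: "qmin < qmax" "vec_mean y0 \<in> {qmin..qmax}"
    and A5: "consensus_steps \<alpha>"
    and algorithm: "quantized_consensus M E Bw \<gamma> Bc \<alpha> qmin qmax y0 x y"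
  shows
    "measure M {\<omega> \<in> space M. (\<lambda>k. y k \<omega>) \<longlonglongrightarrow> vec (vec_mean y0)} = 1
     \<and>
     (\<forall>r::real.
        (\<forall>k. integrable M (\<lambda>\<omega>. exp (r * norm (y k \<omega> - vec (vec_mean y0))))) \<and>
        (\<lambda>k. \<integral>\<omega>. exp (r * norm (y k \<omega> - vec (vec_mean y0))) \<partial>M) \<longlonglongrightarrow> 1)
     \<and>
     (\<forall>k. integrable M (\<lambda>\<omega>. sq_error y0 (y k \<omega>)))
     \<and>
     (\<exists>\<xi>1 \<xi>2 :: real. \<xi>1 > 0 \<and> \<xi>2 > 0 \<and>
        (AE \<omega> in M. \<forall>k.
           y k \<omega> \<bullet> (out_laplacian E (weight E Bw \<gamma> k) *v clip_vec qmin qmax (y k \<omega>))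
             \<ge> \<xi>1 * sq_error y0 (y k \<omega>) - \<xi>2 * (\<Sum>i\<in>UNIV. \<bar>imbalance E Bw \<gamma> k i\<bar>)) \<and>
        (\<forall>m::real. m > 0 \<and> \<alpha> \<in> O(\<lambda>k. 1 / real k) \<and> (\<forall>k. \<alpha> k \<ge> m / (real k + 1)) \<longrightarrow>
           (let V = (\<lambda>k. \<integral>\<omega>. sq_error y0 (y k \<omega>) \<partial>M); \<rho> = 2 * \<xi>1 * m in
              (\<rho> > 1 \<longrightarrow> V \<in> O(\<lambda>k. 1 / real k)) \<and>
              (\<rho> = 1 \<longrightarrow> V \<in> O(\<lambda>k. ln (real k) / real k)) \<and>
              (\<rho> < 1 \<longrightarrow> V \<in> O(\<lambda>k. 1 / real k powr \<rho>)))))"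
proof -
  obtain F W where F: "active_schedule F W" "\<And>k i. if F k = 1 then Bc k i \<ge> 1 else Bc k i = 0"
    using A3 unfolding consensus_bits_def by blast
  define L where "L = 2 * W"
  define act where "act k \<longleftrightarrow> F k = 1" for k
  have L: "L \<ge> 2" using F(1) unfolding L_def active_schedule_def by simp
  note balancing = assms(1,2) A1 A2
  obtain wmin wmax where w: "wmin > 0" "\<And>k i. wmin \<le> node_weight E Bw \<gamma> k i"
    "\<And>k i. node_weight E Bw \<gamma> k i \<le> wmax"
    using node_weight_bounds[OF balancing] by blast
  obtain C where C: "C > 0" "\<And>k i. \<bar>imbalance E Bw \<gamma> k i\<bar> \<le> C / real (k + 1)"
    using imbalance_decay[OF balancing] by blast
  interpret quantized_average_consensus E Bw Bc \<gamma> \<alpha> qmin qmax y0 M x y act L wmin wmax C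
  proof
    show "\<exists>t\<in>{k..<k + L}. act t" for k unfolding L_def act_def by (rule active_schedule_window[OF F(1)])
    show "Bc k i > 0" if "act k" for k i using F(2)[of k i] that by (simp add: act_def)
    show "Bc k i = 0" if "\<not> act k" for k i using F(2)[of k i] that by (simp add: act_def)
  qed (use assms(2) A4 A5 algorithm w C in simp_all)
  obtain \<xi> \<xi>2 where \<xi>: "coercive \<xi> \<xi>2" using coercive_exists by blast
  then have \<xi>pos: "\<xi> > 0" "\<xi>2 > 0" by (auto simp: coercive_def)
  \<comment> \<open>A window of length \<open>L\<close> is sure to contain only one active time, which costs a factor \<open>L\<close> in the
    effective contraction. The further factor \<open>2\<close> leaves a surplus in the exponent, so that \<open>\<rho> = 1\<close> is
    not critical and the three cases follow from the single exponent \<open>min \<rho> 1\<close>.\<close>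
  define \<xi>1 where "\<xi>1 = \<xi> / (2 * real L)"
  have \<xi>1: "\<xi>1 > 0" "\<xi>1 \<le> \<xi>" "2 * real L * \<xi>1 = \<xi>"
    unfolding \<xi>1_def using \<xi>pos L by (auto simp: pos_divide_le_eq)
  have form: "AE \<omega> in M. \<forall>k. y k \<omega> \<bullet> (lap k *v clip_vec qmin qmax (y k \<omega>))
      \<ge> \<xi>1 * sq_error y0 (y k \<omega>) - \<xi>2 * (\<Sum>i\<in>UNIV. \<bar>b k i\<bar>)"
    using AE_regular
  proof eventually_elim
    case (elim \<omega>)
    show ?case
    proof
      fix k
      have "\<xi>1 * sq_error y0 (y k \<omega>) \<le> \<xi> * sq_error y0 (y k \<omega>)"
        by (intro mult_right_mono \<xi>1 sq_error_nonneg)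
      moreover have "y k \<omega> \<bullet> (lap k *v clip_vec qmin qmax (y k \<omega>))
        \<ge> \<xi> * sq_error y0 (y k \<omega>) - \<xi>2 * (\<Sum>i\<in>UNIV. \<bar>b k i\<bar>)"
        using \<xi> elim unfolding coercive_def by blast
      ultimately show "y k \<omega> \<bullet> (lap k *v clip_vec qmin qmax (y k \<omega>))
        \<ge> \<xi>1 * sq_error y0 (y k \<omega>) - \<xi>2 * (\<Sum>i\<in>UNIV. \<bar>b k i\<bar>)" by linarith
    qed
  qed
  have rate: "let V = mse; \<rho> = 2 * \<xi>1 * m in
      (\<rho> > 1 \<longrightarrow> V \<in> O(\<lambda>k. 1 / real k)) \<and>
      (\<rho> = 1 \<longrightarrow> V \<in> O(\<lambda>k. ln (real k) / real k)) \<and>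
      (\<rho> < 1 \<longrightarrow> V \<in> O(\<lambda>k. 1 / real k powr \<rho>))"
    if m: "m > 0 \<and> \<alpha> \<in> O(\<lambda>k. 1 / real k) \<and> (\<forall>k. \<alpha> k \<ge> m / (real k + 1))" for m
  proof -
    define \<rho> where "\<rho> = 2 * \<xi>1 * m"
    have \<rho>: "\<rho> > 0" "2 * real L * \<rho> = 2 * \<xi> * m"
      unfolding \<rho>_def \<xi>1(3)[symmetric] using \<xi>1(1) m by simp_all
    have power_rate: "mse \<in> O(\<lambda>k. 1 / real k powr min \<rho> 1)"
    proof (rule mse_rate[OF \<xi>])
      have "2 * real L * min \<rho> 1 \<le> 2 * real L * \<rho>" by (intro mult_left_mono) auto
      then show "2 * real L * min \<rho> 1 \<le> 2 * \<xi> * m" unfolding \<rho>(2) .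
    qed (use m \<rho>(1) in auto)
    have harmonic: "mse \<in> O(\<lambda>k. 1 / real k)" if "\<rho> \<ge> 1" using power_rate that by (simp add: min_absorb2)
    have "(\<lambda>k. 1 / real k) \<in> O(\<lambda>k. ln (real k) / real k)" by real_asymp
    then have "mse \<in> O(\<lambda>k. ln (real k) / real k)" if "\<rho> \<ge> 1" by (rule landau_o.big_trans[OF harmonic[OF that]])
    moreover have "mse \<in> O(\<lambda>k. 1 / real k powr \<rho>)" if "\<rho> < 1"
      using power_rate unfolding min_absorb1[OF less_imp_le[OF that]] .
    ultimately show ?thesis unfolding Let_def \<rho>_def[symmetric] using harmonic by simp
  qed
  show ?thesis
    by (intro conjI, rule prob_consensus, intro allI conjI exp_moments, intro allI sq_error_integrable,
        rule exI[of _ \<xi>1], rule exI[of _ \<xi>2], intro conjI \<xi>1(1) \<xi>pos(2) form allI impI,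
        erule rate[unfolded mse_def[abs_def]])
qed

end
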